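(* Let $p$ and $p^{h}$ be the solutions of the convected Helmholtz problem in the infinite duct $\Omega$ with right-hand sides $f+1_{\Omega_f}\dot W$ and $f+\dot W^{h}$, respectively (both problems are defined in the context). Let $\Omega_b$ be an open bounded domain in $\mathbb{R}^2$ with $\Omega_f\subset\Omega_b\subset\Omega$. Suppose $h$ is sufficiently small. Then $$E\big[\|p-p^{h}\|^2_{L^2(\Omega_b)}\big]\leq C\,h^{2-\epsilon},$$ where $0<\epsilon<1$ and $C$ is a positive constant independent of $\epsilon$ and $h$.
   Context: **Data.** Let $d>0$, $\Omega=\{(x_1,x_2): x_1\in\mathbb{R},\ x_2\in(0,d)\}$, Mach number $0\le M<1$, wave number $k>0$. Let $f\in L^2(\Omega)$ have compact support $\Omega_f=\mathrm{supp}(f)\subset\Omega$. $\dot W$ is the formal derivative of the white noise in space, $\int\cdot\,dW$ is the corresponding stochastic integral, and $1_A$ is the indicator function of a set $A$. **Discretized noise.** Let $\{K_i\}_{i=1}^N$ be a quasi-uniform triangulation of $\Omega_f$ (each element has at most one curved edge), with $h=\max_i\mathrm{diam}\,K_i$ and $|K_i|$ the area of $K_i$. Put $\xi_i=|K_i|^{-1/2}\int_{K_i}dW(x)$ (i.i.d. normal with mean 0 and variance 1) and $\dot W^{h}(x)=\sum_{i=1}^N|K_i|^{-1/2}\xi_i1_{K_i}(x)$; write $dW^h(y)=\dot W^h(y)\,dy$. **Problems.** $p$ and $p^h$ solve $(1-M^2)\partial_{x_1}^2u+\partial_{x_2}^2u+2ikM\,\partial_{x_1}u+k^2u=F$ in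 $\Omega$, $\partial_{x_2}u=0$ on $\partial\Omega$, with $F=f+1_{\Omega_f}\dot W$ for $u=p$ and $F=f+\dot W^h$ for $u=p^h$. They are written as $$p(x)=\int_\Omega G(x,y)f(y)\,dy+\int_{\Omega}G(x,y)1_{\Omega_f}(y)\,dW(y),\qquad p^h(x)=\int_\Omega G(x,y)f(y)\,dy+\int_{\Omega}G(x,y)1_{\Omega_f}(y)\,dW^h(y),$$ where $G$ is the Green function of this problem, written by the method of images as $$G(x,y)=\Phi(x,y)+\Phi(x,-y)+\sum_{n=1}^{\infty}\Big(\Phi(x,e^+_n-y)+\Phi(x,e^+_n+y)+\Phi(x,e^-_n-y)+\Phi(x,e^-_n+y)\Big),\qquad e^{\pm}_n=(0,\pm2dn),$$ $$\Phi(x,y)=\frac{i}{4\sqrt{1-M^2}}H^{(1)}_0(k\rho(x-y))\,e^{-i\frac{kM}{1-M^2}(x_1-y_1)},\qquad \rho(x)=\frac{\sqrt{x_1^2+(1-M^2)x_2^2}}{1-M^2},$$ and $H^{(1)}_0$ is the Hankel function of the first kind of order $0$. *)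

theory Defs
  imports "HOL-Probability.Probability"
begin

definition duct :: "real \<Rightarrow> (real \<times> real) set" where
  "duct d = {x. 0 < snd x \<and> snd x < d}"

text \<open>Support of a class of functions modulo null sets, relative to the open set \<open>A\<close> on which
  the functions live.  Compactness of this set therefore already means compactness inside \<open>A\<close>.\<close>

definition ess_support :: "(real \<times> real) set \<Rightarrow> (real \<times> real \<Rightarrow> complex) \<Rightarrow> (real \<times> real) set" where
  "ess_support A f =
     {x \<in> A. \<forall>U. open U \<and> x \<in> U \<longrightarrow> \<not> (AE y in lebesgue. y \<in> U \<inter> A \<longrightarrow> f y = 0)}"

subsection \<open>Hankel function and Green function\<close>

text \<open>Ascending series for positive real argument; the summand of index 0 in the second series
  vanishes because \<open>harm 0 = 0\<close>.\<close>

definition bessel_J0 :: "real \<Rightarrow> real" where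
  "bessel_J0 z = (\<Sum>m. (-1) ^ m * (z / 2) ^ (2 * m) / (fact m)\<^sup>2)"

definition bessel_Y0 :: "real \<Rightarrow> real" where
  "bessel_Y0 z = 2 / pi * (ln (z / 2) + euler_mascheroni) * bessel_J0 z
     - 2 / pi * (\<Sum>m. (-1) ^ m * harm m * (z / 2) ^ (2 * m) / (fact m)\<^sup>2)"

definition hankel1_0 :: "real \<Rightarrow> complex" where
  "hankel1_0 z = complex_of_real (bessel_J0 z) + \<i> * complex_of_real (bessel_Y0 z)"

definition rho :: "real \<Rightarrow> real \<times> real \<Rightarrow> real" where
  "rho M x = sqrt ((fst x)\<^sup>2 + (1 - M\<^sup>2) * (snd x)\<^sup>2) / (1 - M\<^sup>2)"

definition fund_sol :: "real \<Rightarrow> real \<Rightarrow> real \<times> real \<Rightarrow> real \<times> real \<Rightarrow> complex" where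
  "fund_sol M k x y =
     \<i> / complex_of_real (4 * sqrt (1 - M\<^sup>2)) * hankel1_0 (k * rho M (x - y))
     * exp (- (\<i> * complex_of_real (k * M / (1 - M\<^sup>2) * (fst x - fst y))))"

text \<open>Green function of the duct by the method of images.  The argument \<open>\<sigma>\<close> is the map that sends
  a source to its image.  In the usual way of writing the formula, \<open>\<sigma> y\<close> is printed as \<open>-y\<close>;
  read literally this is the point reflection \<open>uminus\<close>, while the Neumann condition on
  the walls of the duct is met by the mirror image \<open>mirror y\<close>, in which only the transversal
  coordinate changes sign.  Keeping \<open>\<sigma>\<close> as an argument lets both readings be treated at once.
  The series is only conditionally convergent, whence \<open>suminf\<close>.\<close>

definition mirror :: "real \<times> real \<Rightarrow> real \<times> real" where
  "mirror y = (fst y, - snd y)"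

definition duct_green ::
  "(real \<times> real \<Rightarrow> real \<times> real) \<Rightarrow> real \<Rightarrow> real \<Rightarrow> real \<Rightarrow> real \<times> real \<Rightarrow> real \<times> real \<Rightarrow> complex" where
  "duct_green \<sigma> d M k x y =
     fund_sol M k x y + fund_sol M k x (\<sigma> y) +
     (\<Sum>n. let ep = (0, 2 * d * real (Suc n)); em = (0, - (2 * d * real (Suc n))) in
        fund_sol M k x (ep + \<sigma> y) + fund_sol M k x (ep + y) +
        fund_sol M k x (em + \<sigma> y) + fund_sol M k x (em + y))"

subsection \<open>White noise and its stochastic integral\<close>

definition fin_borel :: "(real \<times> real) set set" where
  "fin_borel = {A \<in> sets lborel. emeasure lborel A < \<infinity>}"

text \<open>Gaussian white noise on the plane, based on Lebesgue measure, as a random set function.\<close>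

definition white_noise :: "'w measure \<Rightarrow> ((real \<times> real) set \<Rightarrow> 'w \<Rightarrow> real) \<Rightarrow> bool" where
  "white_noise P W \<longleftrightarrow>
     prob_space P \<and>
     (\<forall>A\<in>fin_borel. W A \<in> borel_measurable P) \<and>
     (\<forall>A\<in>fin_borel. measure lborel A = 0 \<longrightarrow> (AE \<omega> in P. W A \<omega> = 0)) \<and>
     (\<forall>A\<in>fin_borel. measure lborel A > 0 \<longrightarrow>
        distributed P lborel (W A) (\<lambda>t. ennreal (normal_density 0 (sqrt (measure lborel A)) t))) \<and>
     (\<forall>A\<in>fin_borel. \<forall>B\<in>fin_borel. A \<inter> B = {} \<longrightarrow>
        (AE \<omega> in P. W (A \<union> B) \<omega> = W A \<omega> + W B \<omega>)) \<and>
     (\<forall>\<A>. finite \<A> \<and> \<A> \<subseteq> fin_borel \<and> disjoint \<A> \<longrightarrow>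
        prob_space.indep_vars P (\<lambda>_. borel) W \<A>)"

definition simple_noise_integral ::
  "((real \<times> real) set \<Rightarrow> 'w \<Rightarrow> real) \<Rightarrow> (real \<times> real \<Rightarrow> complex) \<Rightarrow> 'w \<Rightarrow> complex" where
  "simple_noise_integral W s \<omega> = (\<Sum>c\<in>range s - {0}. c * complex_of_real (W (s -` {c}) \<omega>))"

text \<open>\<open>has_noise_integral P W A \<phi> X\<close>: the random variable \<open>X\<close> is (a version of) the stochastic
  integral of the deterministic function \<open>\<phi>\<close> over \<open>A\<close> with respect to \<open>W\<close>, that is, the mean-square
  limit of the integrals of simple functions converging to \<open>\<phi>\<close> in the square mean over \<open>A\<close>.
  This determines \<open>X\<close> up to almost sure equality, hence a relation rather than a function.\<close>

definition has_noise_integral ::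
  "'w measure \<Rightarrow> ((real \<times> real) set \<Rightarrow> 'w \<Rightarrow> real) \<Rightarrow> (real \<times> real) set
     \<Rightarrow> (real \<times> real \<Rightarrow> complex) \<Rightarrow> ('w \<Rightarrow> complex) \<Rightarrow> bool" where
  "has_noise_integral P W A \<phi> X \<longleftrightarrow>
     set_borel_measurable lborel A \<phi> \<and> X \<in> borel_measurable P \<and>
     (\<exists>s. (\<forall>n. Bochner_Integration.simple_bochner_integrable lborel (s n)) \<and>
        (\<lambda>n. \<integral>\<^sup>+ y. ennreal ((cmod (s n y - indicat_real A y *\<^sub>R \<phi> y))\<^sup>2) \<partial>lborel) \<longlonglongrightarrow> 0 \<and>
        (\<lambda>n. \<integral>\<^sup>+ \<omega>. ennreal ((cmod (simple_noise_integral W (s n) \<omega> - X \<omega>))\<^sup>2) \<partial>P) \<longlonglongrightarrow> 0)"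

subsection \<open>Triangulations and discretized noise\<close>

text \<open>A closed triangle with vertices \<open>a\<close>, \<open>b\<close>, \<open>c\<close> whose edge from \<open>b\<close> to \<open>c\<close> is a piecewise
  continuously differentiable arc \<open>g\<close> (possibly a segment) and whose other two edges are
  segments.  \<open>V\<close> is the set of its vertices and \<open>E\<close> the set of its edges.\<close>

definition curved_triangle ::
  "(real \<times> real) set \<Rightarrow> (real \<times> real) set \<Rightarrow> (real \<times> real) set set \<Rightarrow> bool" where
  "curved_triangle K V E \<longleftrightarrow>
     (\<exists>a b c g. let J = g +++ linepath c a +++ linepath a b in
        arc g \<and> valid_path g \<and> pathstart g = b \<and> pathfinish g = c \<and> simple_path J \<and>
        K = path_image J \<union> inside (path_image J) \<and>
        V = {a, b, c} \<and>
        E = {path_image g, closed_segment c a, closed_segment a b})"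

definition triangulation :: "(real \<times> real) set \<Rightarrow> (real \<times> real) set set \<Rightarrow> bool" where
  "triangulation S \<T> \<longleftrightarrow>
     finite \<T> \<and> \<Union>\<T> = S \<and>
     (\<exists>V E. (\<forall>K\<in>\<T>. curved_triangle K (V K) (E K)) \<and>
        (\<forall>K\<in>\<T>. \<forall>L\<in>\<T>. K \<noteq> L \<longrightarrow>
           K \<inter> L = {} \<or> (\<exists>v \<in> V K \<inter> V L. K \<inter> L = {v}) \<or> K \<inter> L \<in> E K \<inter> E L))"

definition mesh_size :: "(real \<times> real) set set \<Rightarrow> real" where
  "mesh_size \<T> = Max (diameter ` \<T>)"

text \<open>Quasi-uniformity with constant \<open>\<gamma>\<close>: the largest disc contained in an element has a diameter
  of at least \<open>\<gamma>\<close> times the mesh size.  A quasi-uniform family of triangulations is one whose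
  members satisfy this with a common \<open>\<gamma> > 0\<close>.\<close>

definition quasi_uniform :: "real \<Rightarrow> (real \<times> real) set set \<Rightarrow> bool" where
  "quasi_uniform \<gamma> \<T> \<longleftrightarrow> (\<forall>K\<in>\<T>. \<exists>z r. \<gamma> * mesh_size \<T> \<le> 2 * r \<and> cball z r \<subseteq> K)"

definition noise_coeff ::
  "((real \<times> real) set \<Rightarrow> 'w \<Rightarrow> real) \<Rightarrow> (real \<times> real) set \<Rightarrow> 'w \<Rightarrow> real" where
  "noise_coeff W K \<omega> = measure lborel K powr (- 1 / 2) * W K \<omega>"

definition discrete_noise ::
  "((real \<times> real) set \<Rightarrow> 'w \<Rightarrow> real) \<Rightarrow> (real \<times> real) set set \<Rightarrow> 'w \<Rightarrow> real \<times> real \<Rightarrow> real" where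
  "discrete_noise W \<T> \<omega> y =
     (\<Sum>K\<in>\<T>. measure lborel K powr (- 1 / 2) * noise_coeff W K \<omega> * indicat_real K y)"

subsection \<open>The two problems\<close>

text \<open>Both solutions are understood through their representation by the Green function \<open>G\<close>.  As the
  stochastic integral is determined only up to a null event for each \<open>x\<close>, the solution of the first
  problem is a jointly measurable random field, so that its spatial norms are random variables.\<close>

definition deterministic_part ::
  "(real \<times> real) set \<Rightarrow> (real \<times> real \<Rightarrow> real \<times> real \<Rightarrow> complex) \<Rightarrow> (real \<times> real \<Rightarrow> complex)
     \<Rightarrow> real \<times> real \<Rightarrow> complex" where
  "deterministic_part D G f x = (LINT y|lebesgue_on D. G x y * f y)"

definition noise_solution ::
  "'w measure \<Rightarrow> ((real \<times> real) set \<Rightarrow> 'w \<Rightarrow> real) \<Rightarrow> (real \<times> real) set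
     \<Rightarrow> (real \<times> real \<Rightarrow> real \<times> real \<Rightarrow> complex) \<Rightarrow> (real \<times> real \<Rightarrow> complex)
     \<Rightarrow> (real \<times> real \<Rightarrow> 'w \<Rightarrow> complex) \<Rightarrow> bool" where
  "noise_solution P W D G f p \<longleftrightarrow>
     (\<lambda>(x, \<omega>). p x \<omega>) \<in> borel_measurable (restrict_space lborel D \<Otimes>\<^sub>M P) \<and>
     (\<forall>x\<in>D. has_noise_integral P W D
        (\<lambda>y. G x y * indicator (ess_support D f) y)
        (\<lambda>\<omega>. p x \<omega> - deterministic_part D G f x))"

definition discrete_solution ::
  "((real \<times> real) set \<Rightarrow> 'w \<Rightarrow> real) \<Rightarrow> (real \<times> real) set
     \<Rightarrow> (real \<times> real \<Rightarrow> real \<times> real \<Rightarrow> complex) \<Rightarrow> (real \<times> real \<Rightarrow> complex)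
     \<Rightarrow> (real \<times> real) set set \<Rightarrow> real \<times> real \<Rightarrow> 'w \<Rightarrow> complex" where
  "discrete_solution W D G f \<T> x \<omega> =
     deterministic_part D G f x +
     (LINT y|lebesgue_on D.
        G x y * indicator (ess_support D f) y * complex_of_real (discrete_noise W \<T> \<omega> y))"

text \<open>Expected squared spatial norm, with values in the extended nonnegative reals, so that an upper
  bound by a real number includes finiteness.\<close>

definition expected_sq_L2_norm ::
  "'w measure \<Rightarrow> (real \<times> real) set \<Rightarrow> (real \<times> real \<Rightarrow> 'w \<Rightarrow> complex) \<Rightarrow> ennreal" where
  "expected_sq_L2_norm P B u =
     (\<integral>\<^sup>+ \<omega>. (\<integral>\<^sup>+ x\<in>B. ennreal ((cmod (u x \<omega>))\<^sup>2) \<partial>lborel) \<partial>P)"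

end

theory Submission
  imports Defs
begin

text \<open>By the isometry property of white noise, the mean square of \<open>p x - p\<^sup>h x\<close> is controlled by the
  squared distance in \<open>y\<close> of \<open>G x y\<close> from its averages over the cells.  It therefore suffices to
  show \<open>\<bar>G x y - G x z\<bar> \<le> C \<bar>y - z\<bar>\<^sup>q (1 + \<bar>x - y\<bar>\<^bsup>-q\<^esup> + \<bar>x - z\<bar>\<^bsup>-q\<^esup>)\<close> for almost all
  points and every \<open>q < 1\<close>: this gives the rate \<open>h\<^bsup>2q\<^esup>\<close>, and with \<open>2q = 2 - \<epsilon>/2\<close> the constant is
  absorbed by \<open>h\<^bsup>\<epsilon>/2\<^esup>\<close> for small \<open>h\<close>, so that even \<open>C = 1\<close> is possible.

  The term \<open>\<Phi>(x, y)\<close> has a logarithmic singularity, which yields the Hoelder bound.  For the conditionally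
  convergent image series, Bessel's equation alone gives
  \<open>H(r) = (P cos r + Q sin r) / sqrt r + O(r\<^bsup>-3/2\<^esup>)\<close> for some \<open>P\<close>, \<open>Q\<close>, with the same bound for the
  Lipschitz constant of the remainder.  Hence the \<open>n\<close>-th pair of images of \<open>y\<close> is \<open>\<lambda>\<^sub>n\<close> times a fixed
  Lipschitz function, up to an error with a summable Lipschitz constant.  Whether \<open>\<Sum>n. \<lambda>\<^sub>n\<close> converges need
  not be decided.\<close>

section \<open>Bessel functions\<close>

text \<open>The obstacle is the image series: its terms have size \<open>n^(-1/2)\<close> and
  differentiation in \<open>y\<close> does not improve this, so neither the terms nor their
  Lipschitz constants can be summed absolutely. The remedy is to treat the image shifted up and the
  image shifted down by the same amount together. For large \<open>n\<close> the phase at either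
  image is linear in the transversal coordinates up to an error of order \<open>1 / n\<close>, in
  size and in Lipschitz constant. By the addition theorem, phases \<open>s + t\<close> and
  \<open>s - t\<close> with the same amplitude add up to \<open>2 cos t\<close> times a function of
  \<open>s\<close>, so the index enters the leading part only as a scalar factor. If these scalars
  have a divergent sum, the whole series diverges wherever the fixed factor is nonzero, which
  excludes only countably many lines.

  The exponent stays below 1 because the gradient of the logarithm, of size
  \<open>1 / |x - y|\<close>, just fails to be square integrable in the plane, while the weight
  \<open>|x - y|^(-2q)\<close> is locally integrable for \<open>q < 1\<close>. The constants depend
  on \<open>q\<close>, hence on \<epsilon>; the threshold for the mesh size takes up this
  dependence.\<close>

lemma powser_bessel_ode:
  fixes c d :: "nat \<Rightarrow> real"
  assumes s: "\<And>w. summable (\<lambda>n. c n * w ^ n)"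
    and rec: "\<And>n. (real n + 1)\<^sup>2 * c (Suc n) + c n = d n"
  shows "w * (\<Sum>n. diffs (diffs c) n * w ^ n) + (\<Sum>n. diffs c n * w ^ n) + (\<Sum>n. c n * w ^ n)
    = (\<Sum>n. d n * w ^ n)"
proof -
  have s1: "summable (\<lambda>n. diffs c n * w ^ n)" for w using s by (rule termdiff_converges_all)
  have s2: "summable (\<lambda>n. diffs (diffs c) n * w ^ n)" for w using s1 by (rule termdiff_converges_all)
  define f where "f n = real n * diffs c n" for n
  have f_Suc: "f (Suc n) = diffs (diffs c) n" for n by (simp add: f_def diffs_def)
  have sf: "summable (\<lambda>n. f n * w ^ n)"
    using s2[of w] unfolding f_Suc[symmetric] summable_powser_split_head .
  have "(\<Sum>n. f n * w ^ n) = (\<Sum>n. diffs (diffs c) n * w ^ n) * w"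
    using powser_split_head(1)[OF sf] unfolding f_Suc by (simp add: f_def[of 0])
  hence "w * (\<Sum>n. diffs (diffs c) n * w ^ n) + (\<Sum>n. diffs c n * w ^ n) + (\<Sum>n. c n * w ^ n)
    = (\<Sum>n. f n * w ^ n + diffs c n * w ^ n + c n * w ^ n)"
    using suminf_add[OF sf s1] suminf_add[OF summable_add[OF sf s1] s] by (simp add: mult.commute)
  also have "\<dots> = (\<Sum>n. d n * w ^ n)"
  proof (rule suminf_cong)
    fix n
    have "f n + diffs c n + c n = d n"
      using rec[of n] by (simp add: f_def diffs_def algebra_simps power2_eq_square)
    thus "f n * w ^ n + diffs c n * w ^ n + c n * w ^ n = d n * w ^ n"
      by (metis distrib_right)
  qed
  finally show ?thesis .
qed

text \<open>The variable is \<open>w = r\<^sup>2 / 4\<close>. In it Bessel's equation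
  \<open>r v'' + v' + r v = 0\<close> becomes \<open>w F'' + F' + F = 0\<close>, and the
  coefficients of a power series solution obey a two-term recursion with factor
  \<open>(n + 1)\<^sup>2\<close>.\<close>

definition coeff_J :: "nat \<Rightarrow> real" where "coeff_J m = (-1) ^ m / (fact m)\<^sup>2"
definition coeff_Y :: "nat \<Rightarrow> real" where "coeff_Y m = (-1) ^ m * harm m / (fact m)\<^sup>2"

text \<open>Crude but sufficient: one of the two factorials in \<open>coeff_Y\<close> absorbs the
  harmonic number, and the other leaves an exponential series as a majorant.\<close>

lemma harm_le_fact: "harm m \<le> (fact m :: real)"
proof (induction m)
  case (Suc m)
  show ?case
  proof (cases "m = 0")
    case False
    have "harm (Suc m) = harm m + 1 / real (Suc m)" by (simp add: harm_Suc inverse_eq_divide)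
    also have "\<dots> \<le> fact m + 1 * fact m"
    proof (intro add_mono Suc)
      have "1 / real (Suc m) \<le> 1" by simp
      also have "(1::real) \<le> 1 * fact m" by (simp add: fact_ge_1)
      finally show "1 / real (Suc m) \<le> 1 * fact m" .
    qed
    also have "\<dots> \<le> real (Suc m) * fact m"
      using False by (simp add: algebra_simps)
    also have "\<dots> = fact (Suc m)" by simp
    finally show ?thesis .
  qed (simp add: harm_Suc harm_expand)
qed (simp add: harm_expand)

lemma summable_coeff_J: "summable (\<lambda>n. coeff_J n * w ^ n)"
proof (rule summable_comparison_test')
  show "summable (\<lambda>n. inverse (fact n) * \<bar>w\<bar> ^ n)" by (rule summable_exp)
  show "norm (coeff_J n * w ^ n) \<le> inverse (fact n) * \<bar>w\<bar> ^ n" for n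
  proof -
    have "\<bar>coeff_J n\<bar> \<le> inverse (fact n)"
      by (simp add: coeff_J_def abs_mult power2_eq_square field_simps power_abs fact_ge_1)
    thus ?thesis by (simp add: abs_mult power_abs mult_right_mono)
  qed
qed

lemma summable_coeff_Y: "summable (\<lambda>n. coeff_Y n * w ^ n)"
proof (rule summable_comparison_test')
  show "summable (\<lambda>n. inverse (fact n) * \<bar>w\<bar> ^ n)" by (rule summable_exp)
  show "norm (coeff_Y n * w ^ n) \<le> inverse (fact n) * \<bar>w\<bar> ^ n" for n
  proof -
    have "\<bar>coeff_Y n\<bar> \<le> inverse (fact n)"
      using harm_le_fact[of n] harm_nonneg[of n, where 'a = real]
      by (simp add: coeff_Y_def abs_mult power2_eq_square field_simps power_abs)
    thus ?thesis by (simp add: abs_mult power_abs mult_right_mono)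
  qed
qed

definition powser :: "(nat \<Rightarrow> real) \<Rightarrow> real \<Rightarrow> real" where
  "powser c w = (\<Sum>n. c n * w ^ n)"

lemma powser_coeff_J_deriv:
  "(powser coeff_J has_real_derivative powser (diffs coeff_J) w) (at w)"
  "(powser (diffs coeff_J) has_real_derivative powser (diffs (diffs coeff_J)) w) (at w)"
  unfolding powser_def
  by (intro termdiffs_strong_converges_everywhere termdiff_converges_all summable_coeff_J)+

lemma powser_coeff_Y_deriv:
  "(powser coeff_Y has_real_derivative powser (diffs coeff_Y) w) (at w)"
  "(powser (diffs coeff_Y) has_real_derivative powser (diffs (diffs coeff_Y)) w) (at w)"
  unfolding powser_def
  by (intro termdiffs_strong_converges_everywhere termdiff_converges_all summable_coeff_Y)+

lemma coeff_J_ode: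
  "w * powser (diffs (diffs coeff_J)) w + powser (diffs coeff_J) w + powser coeff_J w = 0"
proof -
  have "(real n + 1)\<^sup>2 * coeff_J (Suc n) + coeff_J n = 0" for n
  proof -
    have "(fact (Suc n))\<^sup>2 = (real n + 1)\<^sup>2 * (fact n)\<^sup>2" by (simp add: power_mult_distrib add.commute)
    thus ?thesis by (simp add: coeff_J_def field_simps del: fact_Suc)
  qed
  from powser_bessel_ode[OF summable_coeff_J this, of w] show ?thesis by (simp add: powser_def)
qed

text \<open>Passing from \<open>harm n\<close> to \<open>harm (Suc n)\<close> adds
  \<open>1 / (n + 1)\<close>. This increment spoils the homogeneous recursion, and what it leaves
  over is the coefficient of the derivative of the J-series.\<close>

lemma coeff_Y_ode:
  "w * powser (diffs (diffs coeff_Y)) w + powser (diffs coeff_Y) w + powser coeff_Y w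
     = powser (diffs coeff_J) w"
proof -
  have "(real n + 1)\<^sup>2 * coeff_Y (Suc n) + coeff_Y n = diffs coeff_J n" for n
  proof -
    have "(fact (Suc n))\<^sup>2 = (real n + 1)\<^sup>2 * (fact n)\<^sup>2"
      by (simp add: power_mult_distrib add.commute)
    have "(real n + 1)\<^sup>2 * coeff_Y (Suc n) = - ((-1) ^ n * (harm n + 1 / (real n + 1)) / (fact n)\<^sup>2)"
    proof -
      have "(real n + 1)\<^sup>2 \<noteq> 0" by (simp add: add_eq_0_iff)
      thus ?thesis
        unfolding coeff_Y_def harm_Suc \<open>(fact (Suc n))\<^sup>2 = _\<close>
        by (simp add: inverse_eq_divide add.commute)
    qed
    moreover have "diffs coeff_J n = - ((-1) ^ n * (1 / (real n + 1)) / (fact n)\<^sup>2)"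
    proof -
      have "q * (- (a / (q\<^sup>2 * b))) = - (a * (1 / q) / b)" if "q \<noteq> 0" for q a b :: real
        using that by (cases "b = 0") (simp_all add: field_simps power2_eq_square)
      from this[of "real n + 1" "(-1) ^ n" "(fact n)\<^sup>2"] show ?thesis
        unfolding diffs_def coeff_J_def \<open>(fact (Suc n))\<^sup>2 = _\<close> by (simp add: add.commute)
    qed
    ultimately show ?thesis by (simp only: coeff_Y_def distrib_left add_divide_distrib)
  qed
  from powser_bessel_ode[OF summable_coeff_Y this, of w] show ?thesis by (simp add: powser_def)
qed

text \<open>The logarithmic second solution: \<open>ln (r / 2)\<close> equals
  \<open>ln w / 2\<close> at \<open>w = r\<^sup>2 / 4\<close>. Adding a multiple of the J-series and
  scaling by \<open>2 / pi\<close> gives \<open>bessel_Y0\<close>.\<close>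

definition log_sol :: "real \<Rightarrow> real" where
  "log_sol w = ln w / 2 * powser coeff_J w - powser coeff_Y w"
definition log_sol' :: "real \<Rightarrow> real" where
  "log_sol' w = powser coeff_J w / (2 * w) + ln w / 2 * powser (diffs coeff_J) w - powser (diffs coeff_Y) w"
definition log_sol'' :: "real \<Rightarrow> real" where
  "log_sol'' w = powser (diffs coeff_J) w / w - powser coeff_J w / (2 * w\<^sup>2)
     + ln w / 2 * powser (diffs (diffs coeff_J)) w - powser (diffs (diffs coeff_Y)) w"

lemma log_sol_deriv:
  assumes "w > 0"
  shows "(log_sol has_real_derivative log_sol' w) (at w)"
    "(log_sol' has_real_derivative log_sol'' w) (at w)"
  unfolding log_sol_def [abs_def] log_sol'_def[abs_def] log_sol''_def
  using assms
  by (auto intro!: derivative_eq_intros powser_coeff_J_deriv powser_coeff_Y_deriv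
      simp: field_simps power2_eq_square)

text \<open>The derivatives of \<open>ln w\<close> leave one copy of the derivative of the J-series,
  since the terms with \<open>1 / w\<close> cancel. This copy compensates the right-hand side of
  \<open>coeff_Y_ode\<close>.\<close>

lemma log_sol_ode:
  assumes "w > 0"
  shows "w * log_sol'' w + log_sol' w + log_sol w = 0"
proof -
  have "w * log_sol'' w + log_sol' w + log_sol w
   = ln w / 2 * (w * powser (diffs (diffs coeff_J)) w + powser (diffs coeff_J) w + powser coeff_J w)
     + powser (diffs coeff_J) w
     - (w * powser (diffs (diffs coeff_Y)) w + powser (diffs coeff_Y) w + powser coeff_Y w)"
    using assms by (simp add: log_sol''_def log_sol'_def log_sol_def field_simps power2_eq_square)
  thus ?thesis by (simp add: coeff_J_ode coeff_Y_ode)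
qed

lemma bessel_J0_eq: "bessel_J0 r = powser coeff_J (r\<^sup>2 / 4)"
  unfolding bessel_J0_def powser_def coeff_J_def
  by (rule suminf_cong) (simp add: power_mult power_divide)

lemma bessel_Y0_eq:
  assumes "r > 0"
  shows "bessel_Y0 r = 2 / pi * (log_sol (r\<^sup>2 / 4) + euler_mascheroni * powser coeff_J (r\<^sup>2 / 4))"
proof -
  have a: "(\<Sum>m. (-1) ^ m * harm m * (r / 2) ^ (2 * m) / (fact m)\<^sup>2) = powser coeff_Y (r\<^sup>2 / 4)"
    unfolding powser_def coeff_Y_def
    by (rule suminf_cong) (simp add: power_mult power_divide)
  have "ln (r\<^sup>2 / 4) = ln ((r / 2)\<^sup>2)" by (simp add: power_divide)
  also have "\<dots> = 2 * ln (r / 2)" using assms by (subst ln_realpow) auto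
  finally show ?thesis unfolding bessel_Y0_def a bessel_J0_eq log_sol_def by (simp add: algebra_simps)
qed

section \<open>Asymptotics at infinity from a perturbed oscillator\<close>

lemma limit_of_deriv_bound:
  fixes p p' :: "real \<Rightarrow> real"
  assumes D: "\<And>r. r \<ge> 1 \<Longrightarrow> (p has_real_derivative p' r) (at r)"
    and B: "\<And>r. r \<ge> 1 \<Longrightarrow> \<bar>p' r\<bar> \<le> B / r\<^sup>2"
  shows "\<exists>P. \<forall>r\<ge>1. \<bar>p r - P\<bar> \<le> B / r"
proof -
  have B0: "B \<ge> 0" using B[of 1] by simp
  \<comment> \<open>The upper envelope \<open>p r + B / r\<close> decreases and the lower envelope
    \<open>p r - B / r\<close> increases. Hence every value of the lower one is at most every value
    of the upper one, and the supremum of the lower one is the limit, with error at most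
    \<open>B / r\<close>.\<close>
  have dec: "p s + B / s \<le> p r + B / r" if "1 \<le> r" "r \<le> s" for r s
  proof (rule DERIV_nonpos_imp_nonincreasing[OF that(2)])
    fix x assume "r \<le> x" "x \<le> s"
    hence x: "x \<ge> 1" using that by simp
    show "\<exists>y. ((\<lambda>r. p r + B / r) has_real_derivative y) (at x) \<and> y \<le> 0"
      using B[OF x] x by (intro exI[of _ "p' x - B / x\<^sup>2"])
        (auto intro!: derivative_eq_intros D simp: power2_eq_square)
  qed
  have inc: "p r - B / r \<le> p s - B / s" if "1 \<le> r" "r \<le> s" for r s
  proof (rule DERIV_nonneg_imp_nondecreasing[OF that(2)])
    fix x assume "r \<le> x" "x \<le> s"
    hence x: "x \<ge> 1" using that by simp
    show "\<exists>y. ((\<lambda>r. p r - B / r) has_real_derivative y) (at x) \<and> 0 \<le> y"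
      using B[OF x] x by (intro exI[of _ "p' x + B / x\<^sup>2"])
        (auto intro!: derivative_eq_intros D simp: power2_eq_square)
  qed
  have cross: "p r - B / r \<le> p s + B / s" if "1 \<le> r" "1 \<le> s" for r s
  proof -
    have "p r - B / r \<le> p (max r s) - B / max r s" using that by (intro inc) auto
    also have "\<dots> \<le> p (max r s) + B / max r s" using B0 that by simp
    also have "\<dots> \<le> p s + B / s" using that by (intro dec) auto
    finally show ?thesis .
  qed
  define P where "P = (SUP r\<in>{1..}. p r - B / r)"
  have "p r - B / r \<le> P" if "r \<ge> 1" for r
    unfolding P_def using that cross[of _ 1] by (intro cSUP_upper bdd_aboveI2[where M = "p 1 + B / 1"]) auto
  moreover have "P \<le> p r + B / r" if "r \<ge> 1" for r
    unfolding P_def using that cross by (intro cSUP_least) auto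
  ultimately show ?thesis by (intro exI[of _ P]) (auto simp: abs_le_iff algebra_simps)
qed

text \<open>Variation of constants: for an exact oscillator the two combinations of \<open>u\<close>
  and \<open>u'\<close> would be constant. The perturbation gives them derivatives of size
  \<open>|u| / (4 r\<^sup>2)\<close>, so they converge once \<open>u\<close> is known to be
  bounded.\<close>

lemma perturbed_oscillator_asymptotics:
  fixes u u' :: "real \<Rightarrow> real"
  assumes D1: "\<And>r. r > 0 \<Longrightarrow> (u has_real_derivative u' r) (at r)"
    and D2: "\<And>r. r > 0 \<Longrightarrow> (u' has_real_derivative - u r - u r / (4 * r\<^sup>2)) (at r)"
  shows "\<exists>P Q C. C \<ge> 0 \<and> (\<forall>r\<ge>1. \<bar>u r * cos r - u' r * sin r - P\<bar> \<le> C / r \<and>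
           \<bar>u r * sin r + u' r * cos r - Q\<bar> \<le> C / r)"
proof -
  \<comment> \<open>The energy \<open>u\<^sup>2 + u'\<^sup>2\<close> alone need not decrease: its
    derivative is \<open>- u u' / (2 r\<^sup>2)\<close>. The factor \<open>exp (1 / (4 r))\<close>
    completes the square, so that the derivative of \<open>E\<close> is
    \<open>- (u + u')\<^sup>2 / (4 r\<^sup>2)\<close> times the exponential.\<close>
  define E where "E r = ((u r)\<^sup>2 + (u' r)\<^sup>2) * exp (1 / (4 * r))" for r
  define B where "B = sqrt (E 1)"
  have E1: "E 1 \<ge> 0" by (simp add: E_def)
  have dec: "E r \<le> E 1" if r: "r \<ge> 1" for r
  proof (rule DERIV_nonpos_imp_nonincreasing[OF r])
    fix x :: real assume "1 \<le> x" "x \<le> r"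
    hence x: "x > 0" by simp
    have "(E has_real_derivative - ((u x + u' x)\<^sup>2 / (4 * x\<^sup>2) * exp (1 / (4 * x)))) (at x)"
      unfolding E_def [abs_def]
      using x by (auto intro!: derivative_eq_intros D1 D2 simp: field_simps power2_eq_square)
    thus "\<exists>y. (E has_real_derivative y) (at x) \<and> y \<le> 0"
      by (intro exI conjI, assumption) simp
  qed
  have u: "\<bar>u r\<bar> \<le> B" if r: "r \<ge> 1" for r
  proof -
    have "(u r)\<^sup>2 * 1 \<le> E r" unfolding E_def using r by (intro mult_mono) auto
    also have "\<dots> \<le> E 1" by (rule dec[OF r])
    finally show ?thesis by (simp add: B_def real_le_rsqrt)
  qed
  have bd: "\<bar>c\<bar> \<le> 1 \<Longrightarrow> \<bar>u r * c / (4 * r\<^sup>2)\<bar> \<le> (B / 4) / r\<^sup>2" if r: "r \<ge> 1" for r c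
  proof -
    assume c: "\<bar>c\<bar> \<le> 1"
    have "\<bar>u r\<bar> * \<bar>c\<bar> \<le> B * 1" using u[OF r] c by (intro mult_mono) auto
    thus ?thesis using r by (simp add: abs_mult field_simps)
  qed
  obtain P where P: "\<forall>r\<ge>1. \<bar>(u r * cos r - u' r * sin r) - P\<bar> \<le> (B / 4) / r"
  proof (rule exE[OF limit_of_deriv_bound])
    show "((\<lambda>r. u r * cos r - u' r * sin r) has_real_derivative u r * sin r / (4 * r\<^sup>2)) (at r)"
      if "r \<ge> 1" for r
      using that by (auto intro!: derivative_eq_intros D1 D2 simp: field_simps)
    show "\<bar>u r * sin r / (4 * r\<^sup>2)\<bar> \<le> (B / 4) / r\<^sup>2" if "r \<ge> 1" for r
      by (rule bd[OF that]) simp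
  qed auto
  obtain Q where Q: "\<forall>r\<ge>1. \<bar>(u r * sin r + u' r * cos r) - Q\<bar> \<le> (B / 4) / r"
  proof (rule exE[OF limit_of_deriv_bound])
    show "((\<lambda>r. u r * sin r + u' r * cos r) has_real_derivative u r * (- cos r) / (4 * r\<^sup>2)) (at r)"
      if "r \<ge> 1" for r
      using that by (auto intro!: derivative_eq_intros D1 D2 simp: field_simps)
    show "\<bar>u r * (- cos r) / (4 * r\<^sup>2)\<bar> \<le> (B / 4) / r\<^sup>2" if "r \<ge> 1" for r
      by (rule bd[OF that]) simp
  qed auto
  show ?thesis
    using P Q E1 by (intro exI[of _ P] exI[of _ Q] exI[of _ "B / 4"]) (auto simp: B_def)
qed

text \<open>The order \<open>R^(-3/2)\<close> is required of the values and of the Lipschitz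
  constant on the half-line from \<open>R\<close>: with \<open>R\<close> growing like the image
  index both are summable. Differences are used in place of a derivative because the later estimates
  compare two source points.\<close>

definition decaying :: "(real \<Rightarrow> 'a :: real_normed_vector) \<Rightarrow> bool" where
  "decaying e \<longleftrightarrow> (\<exists>C. \<forall>R\<ge>1. \<forall>r\<ge>R. \<forall>s\<ge>R.
     norm (e r) \<le> C / (R * sqrt R) \<and> norm (e r - e s) \<le> C / (R * sqrt R) * \<bar>r - s\<bar>)"

lemma decayingE:
  assumes "decaying e"
  obtains C where "\<And>R r s. \<lbrakk>R \<ge> 1; r \<ge> R; s \<ge> R\<rbrakk> \<Longrightarrow> norm (e r) \<le> C / (R * sqrt R)"
    "\<And>R r s. \<lbrakk>R \<ge> 1; r \<ge> R; s \<ge> R\<rbrakk> \<Longrightarrow> norm (e r - e s) \<le> C / (R * sqrt R) * \<bar>r - s\<bar>"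
  using assms unfolding decaying_def by metis

lemma decaying_cong:
  assumes "decaying e" "\<And>r. r \<ge> 1 \<Longrightarrow> e' r = e r"
  shows "decaying e'"
proof -
  obtain C where C: "\<And>R r s. \<lbrakk>R \<ge> 1; r \<ge> R; s \<ge> R\<rbrakk> \<Longrightarrow> norm (e r) \<le> C / (R * sqrt R)"
    "\<And>R r s. \<lbrakk>R \<ge> 1; r \<ge> R; s \<ge> R\<rbrakk> \<Longrightarrow> norm (e r - e s) \<le> C / (R * sqrt R) * \<bar>r - s\<bar>"
    using decayingE[OF assms(1)] by blast
  show ?thesis
    unfolding decaying_def
  proof (intro exI[of _ C] allI impI)
    fix R r s :: real assume h: "1 \<le> R" "R \<le> r" "R \<le> s"
    thus "norm (e' r) \<le> C / (R * sqrt R) \<and> norm (e' r - e' s) \<le> C / (R * sqrt R) * \<bar>r - s\<bar>"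
      using C[OF h] assms(2)[of r] assms(2)[of s] by simp
  qed
qed

lemma decaying_Complex:
  assumes "decaying f" "decaying g"
  shows "decaying (\<lambda>r. Complex (f r) (g r))"
proof -
  obtain A where A: "\<And>R r s. \<lbrakk>R \<ge> 1; r \<ge> R; s \<ge> R\<rbrakk> \<Longrightarrow> norm (f r) \<le> A / (R * sqrt R)"
    "\<And>R r s. \<lbrakk>R \<ge> 1; r \<ge> R; s \<ge> R\<rbrakk> \<Longrightarrow> norm (f r - f s) \<le> A / (R * sqrt R) * \<bar>r - s\<bar>"
    using decayingE[OF assms(1)] by blast
  obtain B where B: "\<And>R r s. \<lbrakk>R \<ge> 1; r \<ge> R; s \<ge> R\<rbrakk> \<Longrightarrow> norm (g r) \<le> B / (R * sqrt R)"
    "\<And>R r s. \<lbrakk>R \<ge> 1; r \<ge> R; s \<ge> R\<rbrakk> \<Longrightarrow> norm (g r - g s) \<le> B / (R * sqrt R) * \<bar>r - s\<bar>"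
    using decayingE[OF assms(2)] by blast
  have bd: "cmod (Complex x y) \<le> a + b" if "norm x \<le> a" "norm y \<le> b" for x y a b
    using cmod_le[of "Complex x y"] that by simp
  show ?thesis
    unfolding decaying_def
  proof (intro exI[of _ "A + B"] allI impI)
    fix R r s :: real assume h: "1 \<le> R" "R \<le> r" "R \<le> s"
    show "cmod (Complex (f r) (g r)) \<le> (A + B) / (R * sqrt R) \<and>
      cmod (Complex (f r) (g r) - Complex (f s) (g s)) \<le> (A + B) / (R * sqrt R) * \<bar>r - s\<bar>"
      using bd[OF A(1)[OF h] B(1)[OF h]] bd[OF A(2)[OF h] B(2)[OF h]]
      by (simp add: add_divide_distrib distrib_right minus_complex.code)
  qed
qed

text \<open>The substitution \<open>u = sqrt r * v\<close> removes the first-order term and turns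
  Bessel's equation into the oscillator with perturbation \<open>u / (4 r\<^sup>2)\<close>. Dividing
  by \<open>sqrt r\<close> afterwards raises the error from order \<open>1 / r\<close> to order
  \<open>r^(-3/2)\<close>.\<close>

lemma bessel_ode_asymptotics:
  fixes v v' v'' :: "real \<Rightarrow> real"
  assumes D: "\<And>r. r > 0 \<Longrightarrow> (v has_real_derivative v' r) (at r)"
    "\<And>r. r > 0 \<Longrightarrow> (v' has_real_derivative v'' r) (at r)"
    and ode: "\<And>r. r > 0 \<Longrightarrow> r * v'' r + v' r + r * v r = 0"
  shows "\<exists>P Q. decaying (\<lambda>r. v r - (P * cos r + Q * sin r) / sqrt r)"
proof -
  define u where "u r = sqrt r * v r" for r
  define u' where "u' r = v r / (2 * sqrt r) + sqrt r * v' r" for r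
  have D1: "(u has_real_derivative u' r) (at r)" if "r > 0" for r
    unfolding u_def [abs_def] u'_def
    using that by (auto intro!: derivative_eq_intros D simp: field_simps)
  have D2: "(u' has_real_derivative - u r - u r / (4 * r\<^sup>2)) (at r)" if r: "r > 0" for r
  proof -
    have ode': "r * v'' r = - v' r - r * v r" using ode[OF r] by simp
    define q where "q = sqrt r"
    have q: "q > 0" "r = q * q" using r by (auto simp: q_def)
    have "(u' has_real_derivative v' r / (2 * q) - v r * (2 * (inverse q / 2)) / (2 * q)\<^sup>2
        + (inverse q / 2 * v' r + q * v'' r)) (at r)"
      unfolding u'_def [abs_def] q_def
      using r by (auto intro!: derivative_eq_intros D simp: power2_eq_square field_simps)
    also have "v' r / (2 * q) - v r * (2 * (inverse q / 2)) / (2 * q)\<^sup>2 + (inverse q / 2 * v' r + q * v'' r)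
       = - u r - u r / (4 * r\<^sup>2)"
    proof -
      have "v'' r = (- v' r - (q * q) * v r) / (q * q)"
        unfolding q(2)[symmetric] using r ode' by (simp add: eq_divide_eq mult.commute)
      moreover have "a' / (2 * q) - a * (2 * (inverse q / 2)) / (2 * q)\<^sup>2
         + (inverse q / 2 * a' + q * ((- a' - (q * q) * a) / (q * q)))
         = - (q * a) - q * a / (4 * (q * q)\<^sup>2)" for a a'
        using q(1) by (simp add: field_simps power2_eq_square)
      ultimately show ?thesis unfolding u_def q_def[symmetric] by (simp only: q(2)[symmetric])
    qed
    finally show ?thesis .
  qed
  obtain P Q C where C: "C \<ge> 0" and
    PQ: "\<And>r. r \<ge> 1 \<Longrightarrow> \<bar>u r * cos r - u' r * sin r - P\<bar> \<le> C / r"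
        "\<And>r. r \<ge> 1 \<Longrightarrow> \<bar>u r * sin r + u' r * cos r - Q\<bar> \<le> C / r"
    using perturbed_oscillator_asymptotics[of u u'] D1 D2 by blast
  define p where "p r = u r * cos r - u' r * sin r - P" for r
  define q where "q r = u r * sin r + u' r * cos r - Q" for r
  define e where "e r = v r - (P * cos r + Q * sin r) / sqrt r" for r
  \<comment> \<open>No derivatives of \<open>p\<close> and \<open>q\<close> occur here: the
    combination of them that would appear vanishes, as always in variation of constants. Only
    \<open>p\<close> and \<open>q\<close> themselves are left, both of order \<open>1 / r\<close>,
    and so the derivative decays as fast as \<open>e\<close>.\<close>
  define e' where "e' r = (q r * cos r - p r * sin r) / sqrt r - (p r * cos r + q r * sin r) / (2 * r * sqrt r)" for r
  have u_eq: "u r = (p r + P) * cos r + (q r + Q) * sin r" for r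
  proof -
    have "(p r + P) * cos r + (q r + Q) * sin r = u r * (cos r * cos r + sin r * sin r)"
      unfolding p_def q_def by (simp only: algebra_simps)
    thus ?thesis by (simp only: sin_cos_squared_add3 mult_1_right)
  qed
  have u'_eq: "u' r = (q r + Q) * cos r - (p r + P) * sin r" for r
  proof -
    have "(q r + Q) * cos r - (p r + P) * sin r = u' r * (cos r * cos r + sin r * sin r)"
      unfolding p_def q_def by (simp only: algebra_simps)
    thus ?thesis by (simp only: sin_cos_squared_add3 mult_1_right)
  qed
  have pq: "\<bar>p r * c + q r * c'\<bar> \<le> 2 * C / r" if "r \<ge> 1" "\<bar>c\<bar> \<le> 1" "\<bar>c'\<bar> \<le> 1" for r c c'
  proof -
    have "\<bar>p r * c + q r * c'\<bar> \<le> \<bar>p r\<bar> * \<bar>c\<bar> + \<bar>q r\<bar> * \<bar>c'\<bar>" by (metis abs_mult abs_triangle_ineq)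
    also have "\<dots> \<le> C / r * 1 + C / r * 1"
      using PQ[of r] that C unfolding p_def q_def by (intro add_mono mult_mono) auto
    finally show ?thesis by simp
  qed
  have e_eq: "e r = (p r * cos r + q r * sin r) / sqrt r" if "r > 0" for r
  proof -
    have "v r = u r / sqrt r" using that by (simp add: u_def)
    thus ?thesis unfolding e_def u_eq by (simp add: diff_divide_distrib[symmetric] algebra_simps)
  qed
  have e_bd: "\<bar>e r\<bar> \<le> 2 * C / (r * sqrt r)" if "r \<ge> 1" for r
    using divide_right_mono[OF pq[OF that, of "cos r" "sin r"], of "sqrt r"] that
    by (simp add: e_eq abs_divide)
  have e'_bd: "\<bar>e' r\<bar> \<le> 3 * C / (r * sqrt r)" if r: "r \<ge> 1" for r
  proof -
    have "\<bar>(q r * cos r - p r * sin r) / sqrt r\<bar> \<le> 2 * C / (r * sqrt r)"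
      using divide_right_mono[OF pq[OF r, of "- sin r" "cos r"], of "sqrt r"] r
      by (simp add: abs_divide algebra_simps)
    moreover have "\<bar>(p r * cos r + q r * sin r) / (2 * r * sqrt r)\<bar> \<le> C / (r * sqrt r)"
    proof -
      have "\<bar>(p r * cos r + q r * sin r) / (2 * r * sqrt r)\<bar> = \<bar>e r\<bar> / (2 * r)"
        using r by (simp add: e_eq abs_divide)
      also have "\<dots> \<le> \<bar>e r\<bar> / 2" using r by (intro divide_left_mono) auto
      also have "\<dots> \<le> C / (r * sqrt r)" using e_bd[OF r] by (simp add: mult.commute)
      finally show ?thesis .
    qed
    ultimately have "\<bar>e' r\<bar> \<le> 2 * C / (r * sqrt r) + C / (r * sqrt r)"
      unfolding e'_def by (intro order.trans[OF abs_triangle_ineq4] add_mono)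
    also have "\<dots> = 3 * C / (r * sqrt r)" by (simp add: add_divide_distrib[symmetric])
    finally show ?thesis .
  qed
  have e_deriv: "(e has_real_derivative e' r) (at r)" if r: "r > 0" for r
  proof -
    have "((\<lambda>r. u r / sqrt r - (P * cos r + Q * sin r) / sqrt r) has_real_derivative e' r) (at r)"
    proof -
      define z where "z = sqrt r"
      have z: "z > 0" "r = z * z" using r by (auto simp: z_def)
      have "((\<lambda>r. u r / sqrt r - (P * cos r + Q * sin r) / sqrt r) has_real_derivative
         (u' r * z - u r * (inverse z / 2)) / (z * z)
          - ((Q * cos r - P * sin r) * z - (P * cos r + Q * sin r) * (inverse z / 2)) / (z * z)) (at r)"
        unfolding z_def using r by (auto intro!: derivative_eq_intros D1)
      also have "(u' r * z - u r * (inverse z / 2)) / (z * z)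
          - ((Q * cos r - P * sin r) * z - (P * cos r + Q * sin r) * (inverse z / 2)) / (z * z)
         = ((u' r - (Q * cos r - P * sin r))) / z - (u r - (P * cos r + Q * sin r)) / (2 * (z * z) * z)"
        using z(1) by (simp add: field_simps)
      also have "\<dots> = e' r"
        unfolding e'_def z_def[symmetric] z(2)[symmetric] u_eq u'_eq by (simp add: algebra_simps)
      finally show ?thesis .
    qed
    moreover have "eventually (\<lambda>r. u r / sqrt r - (P * cos r + Q * sin r) / sqrt r = e r) (nhds r)"
    proof (rule eventually_mono[OF eventually_nhds_in_open[of "{0<..}" r]])
      fix x :: real assume "x \<in> {0<..}"
      thus "u x / sqrt x - (P * cos x + Q * sin x) / sqrt x = e x" by (simp add: e_def u_def)
    qed (use r in auto)
    ultimately show ?thesis by (subst (asm) DERIV_cong_ev[OF refl _ refl]) auto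
  qed
  have "\<bar>e r\<bar> \<le> (3 * C) / (R * sqrt R) \<and> \<bar>e r - e s\<bar> \<le> (3 * C) / (R * sqrt R) * \<bar>r - s\<bar>"
    if "R \<ge> 1" "r \<ge> R" "s \<ge> R" for R r s
  proof
    have mono: "3 * C / (x * sqrt x) \<le> 3 * C / (R * sqrt R)" if "x \<ge> R" for x
      using that \<open>R \<ge> 1\<close> C by (intro divide_left_mono mult_mono) auto
    have "\<bar>e r\<bar> \<le> 2 * C / (r * sqrt r)" using that by (intro e_bd) auto
    also have "\<dots> \<le> 3 * C / (r * sqrt r)" using that C by (intro divide_right_mono) auto
    also have "\<dots> \<le> 3 * C / (R * sqrt R)" using that by (intro mono) auto
    finally show "\<bar>e r\<bar> \<le> (3 * C) / (R * sqrt R)" .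
    have "norm (e r - e s) \<le> (3 * C) / (R * sqrt R) * norm (r - s)"
    proof (rule field_differentiable_bound[of "{R..}"])
      show "(e has_field_derivative e' z) (at z within {R..})" if "z \<in> {R..}" for z
        by (rule has_field_derivative_at_within, rule e_deriv) (use that \<open>R \<ge> 1\<close> in auto)
      show "norm (e' z) \<le> (3 * C) / (R * sqrt R)" if "z \<in> {R..}" for z
      proof -
        have "z \<ge> 1" "z \<ge> R" using that \<open>R \<ge> 1\<close> by simp_all
        from order.trans[OF e'_bd[OF this(1)] mono[OF this(2)]] show ?thesis by (simp only: real_norm_def)
      qed
    qed (use that in auto)
    thus "\<bar>e r - e s\<bar> \<le> (3 * C) / (R * sqrt R) * \<bar>r - s\<bar>" by simp
  qed
  hence "decaying e" unfolding decaying_def real_norm_def by blast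
  thus ?thesis unfolding e_def by blast
qed

lemma DERIV_square_div_4:
  fixes F :: "real \<Rightarrow> real"
  assumes "(F has_real_derivative D) (at (r\<^sup>2 / 4))"
  shows "((\<lambda>r. F (r\<^sup>2 / 4)) has_real_derivative r / 2 * D) (at r)"
proof -
  have "((\<lambda>r. r\<^sup>2 / 4) has_real_derivative r / 2) (at r)"
    by (auto intro!: derivative_eq_intros)
  from DERIV_chain2[OF assms this] show ?thesis by (simp add: mult.commute)
qed

text \<open>For \<open>v r = F (r\<^sup>2 / 4)\<close> the expression
  \<open>r v'' + v' + r v\<close> is \<open>r\<close> times \<open>w F'' + F' + F\<close>, so
  solutions in \<open>w\<close> become solutions of Bessel's equation in \<open>r\<close>.\<close>

lemma bessel_w_asymptotics:
  fixes F F' F'' :: "real \<Rightarrow> real"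
  assumes D: "\<And>w. w > 0 \<Longrightarrow> (F has_real_derivative F' w) (at w)"
    "\<And>w. w > 0 \<Longrightarrow> (F' has_real_derivative F'' w) (at w)"
    and ode: "\<And>w. w > 0 \<Longrightarrow> w * F'' w + F' w + F w = 0"
    and v: "\<And>r. r > 0 \<Longrightarrow> v r = F (r\<^sup>2 / 4)"
  shows "\<exists>P Q. decaying (\<lambda>r. v r - (P * cos r + Q * sin r) / sqrt r)"
proof -
  have "\<exists>P Q. decaying (\<lambda>r. F (r\<^sup>2 / 4) - (P * cos r + Q * sin r) / sqrt r)"
  proof (rule bessel_ode_asymptotics)
    fix r :: real assume r: "r > 0"
    show "((\<lambda>r. F (r\<^sup>2 / 4)) has_real_derivative r / 2 * F' (r\<^sup>2 / 4)) (at r)"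
      using r by (intro DERIV_square_div_4 D) simp
    show "((\<lambda>r. r / 2 * F' (r\<^sup>2 / 4)) has_real_derivative F' (r\<^sup>2 / 4) / 2 + r\<^sup>2 / 4 * F'' (r\<^sup>2 / 4)) (at r)"
    proof -
      have "((\<lambda>r. r / 2) has_real_derivative 1 / 2) (at r)" by (auto intro!: derivative_eq_intros)
      from DERIV_mult[OF this DERIV_square_div_4[OF D(2)]] show ?thesis
        using r by (simp add: power2_eq_square algebra_simps)
    qed
    have "r * (F' (r\<^sup>2 / 4) / 2 + r\<^sup>2 / 4 * F'' (r\<^sup>2 / 4)) + r / 2 * F' (r\<^sup>2 / 4) + r * F (r\<^sup>2 / 4)
      = r * (r\<^sup>2 / 4 * F'' (r\<^sup>2 / 4) + F' (r\<^sup>2 / 4) + F (r\<^sup>2 / 4))" by (simp add: algebra_simps)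
    thus "r * (F' (r\<^sup>2 / 4) / 2 + r\<^sup>2 / 4 * F'' (r\<^sup>2 / 4)) + r / 2 * F' (r\<^sup>2 / 4) + r * F (r\<^sup>2 / 4) = 0"
      using ode[of "r\<^sup>2 / 4"] r by simp
  qed
  then obtain P Q where "decaying (\<lambda>r. F (r\<^sup>2 / 4) - (P * cos r + Q * sin r) / sqrt r)" by blast
  hence "decaying (\<lambda>r. v r - (P * cos r + Q * sin r) / sqrt r)"
    by (rule decaying_cong) (simp add: v)
  thus ?thesis by blast
qed

text \<open>These functions form a space that is invariant under translation of \<open>t\<close>.
  Differences of shifted values are therefore again of this form, with changed amplitudes.\<close>

definition osc :: "complex \<Rightarrow> complex \<Rightarrow> real \<Rightarrow> complex" where
  "osc P Q t = P * of_real (cos t) + Q * of_real (sin t)"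

lemma hankel_asymptotics:
  "\<exists>P Q. decaying (\<lambda>r. hankel1_0 r - osc P Q r / sqrt r)"
proof -
  obtain PJ QJ where J: "decaying (\<lambda>r. bessel_J0 r - (PJ * cos r + QJ * sin r) / sqrt r)"
    using bessel_w_asymptotics[OF powser_coeff_J_deriv coeff_J_ode bessel_J0_eq] by blast
  obtain PY QY where Y: "decaying (\<lambda>r. bessel_Y0 r - (PY * cos r + QY * sin r) / sqrt r)"
  proof -
    have "\<exists>P Q. decaying (\<lambda>r. bessel_Y0 r - (P * cos r + Q * sin r) / sqrt r)"
    proof (rule bessel_w_asymptotics)
      fix w :: real assume w: "w > 0"
      show "((\<lambda>w. 2 / pi * (log_sol w + euler_mascheroni * powser coeff_J w)) has_real_derivative
          2 / pi * (log_sol' w + euler_mascheroni * powser (diffs coeff_J) w)) (at w)"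
        using w by (auto intro!: derivative_eq_intros log_sol_deriv powser_coeff_J_deriv)
      show "((\<lambda>w. 2 / pi * (log_sol' w + euler_mascheroni * powser (diffs coeff_J) w)) has_real_derivative
          2 / pi * (log_sol'' w + euler_mascheroni * powser (diffs (diffs coeff_J)) w)) (at w)"
        using w by (auto intro!: derivative_eq_intros log_sol_deriv powser_coeff_J_deriv)
      have "w * (2 / pi * (log_sol'' w + euler_mascheroni * powser (diffs (diffs coeff_J)) w)) +
         2 / pi * (log_sol' w + euler_mascheroni * powser (diffs coeff_J) w) +
         2 / pi * (log_sol w + euler_mascheroni * powser coeff_J w)
        = 2 / pi * ((w * log_sol'' w + log_sol' w + log_sol w) + euler_mascheroni *
           (w * powser (diffs (diffs coeff_J)) w + powser (diffs coeff_J) w + powser coeff_J w))"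
        by (simp add: field_simps)
      thus "w * (2 / pi * (log_sol'' w + euler_mascheroni * powser (diffs (diffs coeff_J)) w)) +
         2 / pi * (log_sol' w + euler_mascheroni * powser (diffs coeff_J) w) +
         2 / pi * (log_sol w + euler_mascheroni * powser coeff_J w) = 0"
        by (simp add: log_sol_ode[OF w] coeff_J_ode)
    qed (rule bessel_Y0_eq)
    thus ?thesis using that by blast
  qed
  define P where "P = complex_of_real PJ + \<i> * complex_of_real PY"
  define Q where "Q = complex_of_real QJ + \<i> * complex_of_real QY"
  have H: "hankel1_0 r - osc P Q r / sqrt r = Complex (bessel_J0 r - (PJ * cos r + QJ * sin r) / sqrt r)
     (bessel_Y0 r - (PY * cos r + QY * sin r) / sqrt r)" for r
    by (auto simp: complex_eq_iff hankel1_0_def osc_def P_def Q_def)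
  show ?thesis by (intro exI[of _ P] exI[of _ Q] decaying_cong[OF decaying_Complex[OF J Y]] H)
qed

section \<open>Behaviour near the logarithmic singularity\<close>

lemma C1_square_lipschitz:
  fixes F F' F'' :: "real \<Rightarrow> real"
  assumes D: "\<And>w. (F has_real_derivative F' w) (at w)" "\<And>w. (F' has_real_derivative F'' w) (at w)"
  shows "\<exists>L\<ge>0. \<forall>r\<in>{0..R}. \<forall>s\<in>{0..R}. \<bar>F (r\<^sup>2 / 4) - F (s\<^sup>2 / 4)\<bar> \<le> L * \<bar>r - s\<bar> \<and> \<bar>F (r\<^sup>2 / 4)\<bar> \<le> L"
proof -
  have cF: "continuous_on A F" for A using D(1) by (intro continuous_at_imp_continuous_on ballI DERIV_isCont)
  have cF': "continuous_on A F'" for A using D(2) by (intro continuous_at_imp_continuous_on ballI DERIV_isCont)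
  \<comment> \<open>The derivative of \<open>F (r\<^sup>2 / 4)\<close> is continuous up to
    \<open>r = 0\<close>, so compactness bounds it there too. This is why the entire parts of the
    Bessel functions cause no singularity.\<close>
  have "compact ((\<lambda>r. r / 2 * F' (r\<^sup>2 / 4)) ` {0..R})" "compact ((\<lambda>r. F (r\<^sup>2 / 4)) ` {0..R})"
    by (intro compact_continuous_image continuous_intros continuous_on_compose2[OF cF'[of UNIV]]
        continuous_on_compose2[OF cF[of UNIV]]; simp)+
  hence "bounded ((\<lambda>r. r / 2 * F' (r\<^sup>2 / 4)) ` {0..R} \<union> (\<lambda>r. F (r\<^sup>2 / 4)) ` {0..R})"
    by (simp add: compact_imp_bounded)
  then obtain L where L: "\<And>x. x \<in> (\<lambda>r. r / 2 * F' (r\<^sup>2 / 4)) ` {0..R} \<union> (\<lambda>r. F (r\<^sup>2 / 4)) ` {0..R} \<Longrightarrow> norm x \<le> L"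
    and "L > 0"
    unfolding bounded_pos by blast
  have "\<bar>F (r\<^sup>2 / 4) - F (s\<^sup>2 / 4)\<bar> \<le> L * \<bar>r - s\<bar>" if "r \<in> {0..R}" "s \<in> {0..R}" for r s
  proof -
    have "norm (F (r\<^sup>2 / 4) - F (s\<^sup>2 / 4)) \<le> L * norm (r - s)"
    proof (rule field_differentiable_bound[of "{0..R}" "\<lambda>r. F (r\<^sup>2 / 4)" "\<lambda>r. r / 2 * F' (r\<^sup>2 / 4)"])
      show "((\<lambda>r. F (r\<^sup>2 / 4)) has_real_derivative z / 2 * F' (z\<^sup>2 / 4)) (at z within {0..R})" for z
        by (rule has_field_derivative_at_within)
            (rule DERIV_square_div_4[OF D(1)])
      show "norm (z / 2 * F' (z\<^sup>2 / 4)) \<le> L" if "z \<in> {0..R}" for z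
        using that by (intro L) auto
    qed (use that in auto)
    thus ?thesis by simp
  qed
  thus ?thesis using L \<open>L > 0\<close> by (intro exI[of _ L]) auto
qed

text \<open>The logarithm is kept explicit because the bound serves twice: away from the origin it
  becomes a Lipschitz estimate, and near the origin a Hoelder estimate. The term
  \<open>|ln r|\<close> comes from splitting the difference of \<open>ln r * j r\<close> as
  \<open>ln r * (j r - j s) + (ln r - ln s) * j s\<close>.\<close>

lemma hankel_near:
  "\<exists>C\<ge>0. \<forall>r\<in>{0<..R}. \<forall>s\<in>{0<..R}.
     cmod (hankel1_0 r - hankel1_0 s) \<le> C * (\<bar>r - s\<bar> * (1 + \<bar>ln r\<bar>) + \<bar>ln r - ln s\<bar>)"
proof -
  define j where "j r = powser coeff_J (r\<^sup>2 / 4)" for r :: real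
  define y where "y r = powser coeff_Y (r\<^sup>2 / 4)" for r :: real
  obtain Lj where Lj: "Lj \<ge> 0" "\<And>r s. r \<in> {0..R} \<Longrightarrow> s \<in> {0..R} \<Longrightarrow> \<bar>j r - j s\<bar> \<le> Lj * \<bar>r - s\<bar>"
     "\<And>r. r \<in> {0..R} \<Longrightarrow> \<bar>j r\<bar> \<le> Lj"
    using C1_square_lipschitz[OF powser_coeff_J_deriv, of R] unfolding j_def by blast
  obtain Ly where Ly: "Ly \<ge> 0" "\<And>r s. r \<in> {0..R} \<Longrightarrow> s \<in> {0..R} \<Longrightarrow> \<bar>y r - y s\<bar> \<le> Ly * \<bar>r - s\<bar>"
    using C1_square_lipschitz[OF powser_coeff_Y_deriv, of R] unfolding y_def by blast
  \<comment> \<open>The summand \<open>- ln 2\<close> comes from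
    \<open>ln (r / 2) = ln r - ln 2\<close>.\<close>
  define c where "c = euler_mascheroni - (ln 2 :: real)"
  have Y: "bessel_Y0 r = 2 / pi * (ln r * j r + c * j r - y r)" if "r > 0" for r
  proof -
    have "ln (r\<^sup>2 / 4) = 2 * ln r - 2 * ln 2"
    proof -
      have "ln (r\<^sup>2 / 4) = ln ((r / 2)\<^sup>2)" by (simp add: power_divide)
      also have "\<dots> = 2 * ln (r / 2)" using that by (subst ln_realpow) auto
      finally show ?thesis using that by (simp add: ln_div)
    qed
    hence *: "ln (r\<^sup>2 / 4) / 2 = ln r - ln 2" by simp
    show ?thesis
      unfolding bessel_Y0_eq[OF that] log_sol_def * c_def j_def y_def by (simp add: algebra_simps)
  qed
  have J: "bessel_J0 r = j r" for r by (simp add: bessel_J0_eq j_def)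
  define C where "C = Lj + (Lj + \<bar>c\<bar> * Lj + Ly)"
  have "cmod (hankel1_0 r - hankel1_0 s) \<le> C * (\<bar>r - s\<bar> * (1 + \<bar>ln r\<bar>) + \<bar>ln r - ln s\<bar>)"
    if rs: "r \<in> {0<..R}" "s \<in> {0<..R}" for r s
  proof -
    define D where "D = \<bar>r - s\<bar> * (1 + \<bar>ln r\<bar>) + \<bar>ln r - ln s\<bar>"
    have rs': "r \<in> {0..R}" "s \<in> {0..R}" "r > 0" "s > 0" using rs by auto
    have D1: "\<bar>r - s\<bar> \<le> D" unfolding D_def by (simp add: algebra_simps add_nonneg_nonneg)
    have a: "\<bar>j r - j s\<bar> \<le> Lj * D"
      using Lj(2)[OF rs'(1,2)] mult_left_mono[OF D1 Lj(1)] by linarith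
    have b: "\<bar>y r - y s\<bar> \<le> Ly * D"
      using Ly(2)[OF rs'(1,2)] mult_left_mono[OF D1 Ly(1)] by linarith
    have l: "\<bar>ln r * j r - ln s * j s\<bar> \<le> Lj * D"
    proof -
      have "\<bar>ln r * j r - ln s * j s\<bar> = \<bar>ln r * (j r - j s) + (ln r - ln s) * j s\<bar>" by (simp add: algebra_simps)
      also have "\<dots> \<le> \<bar>ln r\<bar> * \<bar>j r - j s\<bar> + \<bar>ln r - ln s\<bar> * \<bar>j s\<bar>" by (metis abs_mult abs_triangle_ineq)
      also have "\<dots> \<le> \<bar>ln r\<bar> * (Lj * \<bar>r - s\<bar>) + \<bar>ln r - ln s\<bar> * Lj"
        using Lj rs' by (intro add_mono mult_left_mono) auto
      also have "\<dots> \<le> Lj * D" unfolding D_def using Lj(1) by (simp add: algebra_simps)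
      finally show ?thesis .
    qed
    have "\<bar>bessel_Y0 r - bessel_Y0 s\<bar>
        = 2 / pi * \<bar>(ln r * j r - ln s * j s) + c * (j r - j s) - (y r - y s)\<bar>"
    proof -
      have "bessel_Y0 r - bessel_Y0 s
        = 2 / pi * ((ln r * j r - ln s * j s) + c * (j r - j s) - (y r - y s))"
        unfolding Y[OF rs'(3)] Y[OF rs'(4)] right_diff_distrib[symmetric] by (simp add: algebra_simps)
      thus ?thesis by (simp only: abs_mult) simp
    qed
    also have "\<dots> \<le> 1 * (\<bar>ln r * j r - ln s * j s\<bar> + \<bar>c\<bar> * \<bar>j r - j s\<bar> + \<bar>y r - y s\<bar>)"
    proof (rule mult_mono)
      show "2 / pi \<le> 1" using pi_ge_two by simp
      show "\<bar>(ln r * j r - ln s * j s) + c * (j r - j s) - (y r - y s)\<bar> \<le>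
         \<bar>ln r * j r - ln s * j s\<bar> + \<bar>c\<bar> * \<bar>j r - j s\<bar> + \<bar>y r - y s\<bar>"
        using abs_mult[of c "j r - j s"] by linarith
    qed auto
    also have "\<dots> \<le> 1 * (Lj * D + \<bar>c\<bar> * (Lj * D) + Ly * D)"
      using a b l by (intro mult_left_mono add_mono) auto
    finally have Yd: "\<bar>bessel_Y0 r - bessel_Y0 s\<bar> \<le> Lj * D + \<bar>c\<bar> * (Lj * D) + Ly * D" by simp
    have "cmod (hankel1_0 r - hankel1_0 s) \<le> \<bar>bessel_J0 r - bessel_J0 s\<bar> + \<bar>bessel_Y0 r - bessel_Y0 s\<bar>"
      using cmod_le[of "hankel1_0 r - hankel1_0 s"] by (simp add: hankel1_0_def)
    also have "\<dots> \<le> Lj * D + (Lj * D + \<bar>c\<bar> * (Lj * D) + Ly * D)"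
      using a Yd unfolding J by (intro add_mono)
    also have "\<dots> = C * D" by (simp add: C_def algebra_simps)
    finally show ?thesis unfolding D_def .
  qed
  moreover have "C \<ge> 0" using Lj(1) Ly(1) by (simp add: C_def)
  ultimately show ?thesis by blast
qed

section \<open>Oscillating asymptotics of image terms\<close>

lemma abs_cos_diff_le: "\<bar>cos x - cos y\<bar> \<le> \<bar>x - y\<bar>" for x y :: real
proof -
  have "norm (cos x - cos y) \<le> 1 * norm (x - y)"
    by (rule field_differentiable_bound[of UNIV cos "\<lambda>x. - sin x"])
      (auto intro!: derivative_eq_intros)
  thus ?thesis by simp
qed

lemma abs_sin_diff_le: "\<bar>sin x - sin y\<bar> \<le> \<bar>x - y\<bar>" for x y :: real
proof -
  have "norm (sin x - sin y) \<le> 1 * norm (x - y)"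
    by (rule field_differentiable_bound[of UNIV sin cos])
      (auto intro!: derivative_eq_intros)
  thus ?thesis by simp
qed

lemma cmod_cis_diff_le: "cmod (cis x - cis y) \<le> 2 * \<bar>x - y\<bar>"
  using cmod_le[of "cis x - cis y"] abs_cos_diff_le[of x y] abs_sin_diff_le[of x y] by simp

lemma osc_bound: "cmod (osc P Q x) \<le> cmod P + cmod Q"
proof -
  have "cmod (osc P Q x) \<le> cmod P * \<bar>cos x\<bar> + cmod Q * \<bar>sin x\<bar>"
    unfolding osc_def by (rule order.trans[OF norm_triangle_ineq]) (simp add: norm_mult)
  also have "\<dots> \<le> cmod P * 1 + cmod Q * 1" by (intro add_mono mult_left_mono) auto
  finally show ?thesis by simp
qed

lemma osc_lipschitz: "cmod (osc P Q x - osc P Q y) \<le> (cmod P + cmod Q) * \<bar>x - y\<bar>"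
proof -
  have "osc P Q x - osc P Q y = P * of_real (cos x - cos y) + Q * of_real (sin x - sin y)"
    by (simp add: osc_def algebra_simps)
  also have "cmod \<dots> \<le> cmod P * \<bar>cos x - cos y\<bar> + cmod Q * \<bar>sin x - sin y\<bar>"
    by (rule order.trans[OF norm_triangle_ineq]) (simp add: norm_mult del: of_real_diff)
  also have "\<dots> \<le> cmod P * \<bar>x - y\<bar> + cmod Q * \<bar>x - y\<bar>"
    by (intro add_mono mult_left_mono abs_cos_diff_le abs_sin_diff_le) auto
  finally show ?thesis by (simp add: algebra_simps)
qed

text \<open>A shift by \<open>e'\<close> turns the oscillation into one whose amplitudes are smaller
  by the factor \<open>|e'|\<close>; this treats the common part of the two shifts, and the rest
  costs \<open>|e - e'|\<close>. Bounding the two differences separately would lose the smallness of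
  the shifts, and with it the summability over the images.\<close>

lemma osc_second_difference:
  "cmod ((osc P Q (x + e) - osc P Q x) - (osc P Q (y + e') - osc P Q y))
     \<le> (cmod P + cmod Q) * (\<bar>e - e'\<bar> + 2 * \<bar>e'\<bar> * \<bar>x - y\<bar>)"
proof -
  define P' where "P' = P * of_real (cos e' - 1) + Q * of_real (sin e')"
  define Q' where "Q' = Q * of_real (cos e' - 1) - P * of_real (sin e')"
  have eq: "osc P Q (z + e') - osc P Q z = osc P' Q' z" for z
    by (simp add: osc_def P'_def Q'_def cos_add sin_add algebra_simps)
  have c: "\<bar>cos e' - 1\<bar> \<le> \<bar>e'\<bar>" "\<bar>sin e'\<bar> \<le> \<bar>e'\<bar>"
    using abs_cos_diff_le[of e' 0] abs_sin_diff_le[of e' 0] by auto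
  have "cmod P' \<le> cmod P * \<bar>cos e' - 1\<bar> + cmod Q * \<bar>sin e'\<bar>"
    unfolding P'_def by (rule order.trans[OF norm_triangle_ineq]) (simp only: norm_mult norm_of_real order_refl)
  also have "\<dots> \<le> cmod P * \<bar>e'\<bar> + cmod Q * \<bar>e'\<bar>" using c by (intro add_mono mult_left_mono) auto
  finally have P': "cmod P' \<le> (cmod P + cmod Q) * \<bar>e'\<bar>" by (simp add: algebra_simps)
  have "cmod Q' \<le> cmod Q * \<bar>cos e' - 1\<bar> + cmod P * \<bar>sin e'\<bar>"
    unfolding Q'_def by (rule order.trans[OF norm_triangle_ineq4]) (simp only: norm_mult norm_of_real order_refl)
  also have "\<dots> \<le> cmod Q * \<bar>e'\<bar> + cmod P * \<bar>e'\<bar>" using c by (intro add_mono mult_left_mono) auto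
  finally have Q': "cmod Q' \<le> (cmod P + cmod Q) * \<bar>e'\<bar>" by (simp add: algebra_simps)
  have "(osc P Q (x + e) - osc P Q x) - (osc P Q (y + e') - osc P Q y)
      = (osc P Q (x + e) - osc P Q (x + e')) + (osc P' Q' x - osc P' Q' y)"
    using eq[of x] eq[of y] by (simp add: algebra_simps)
  also have "cmod \<dots> \<le> (cmod P + cmod Q) * \<bar>(x + e) - (x + e')\<bar> + (cmod P' + cmod Q') * \<bar>x - y\<bar>"
    by (intro order.trans[OF norm_triangle_ineq] add_mono osc_lipschitz)
  also have "\<dots> \<le> (cmod P + cmod Q) * \<bar>e - e'\<bar> + (2 * ((cmod P + cmod Q) * \<bar>e'\<bar>)) * \<bar>x - y\<bar>"
    using P' Q' by (intro add_mono mult_right_mono) auto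
  finally show ?thesis by (simp add: algebra_simps)
qed

text \<open>This separates the image index from the position: with \<open>x\<close> the phase of the
  pure shift and \<open>y\<close> the phase due to the transversal offset, the two images of a pair
  combine to a product.\<close>

lemma osc_add_osc_diff: "osc P Q (x + y) + osc P Q (x - y) = 2 * of_real (cos y) * osc P Q x"
  by (simp add: osc_def cos_add cos_diff sin_add sin_diff algebra_simps)

text \<open>Beyond \<open>\<nu> / 2\<close> the function \<open>1 / sqrt r\<close> has a slope of
  order \<open>\<nu>^(-3/2)\<close>. Hence its value can be frozen at \<nu>, which depends on the
  image index only, at a summable cost.\<close>

lemma inverse_sqrt_lipschitz:
  assumes \<nu>: "\<nu> > 0" and r: "\<nu> / 2 \<le> r" and s: "\<nu> / 2 \<le> s"
  shows "\<bar>1 / sqrt r - 1 / sqrt s\<bar> \<le> 2 / (\<nu> * sqrt \<nu>) * \<bar>r - s\<bar>"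
proof -
  have rs: "r > 0" "s > 0" using assms by auto
  define q where "q = sqrt (\<nu> / 2)"
  have q: "q > 0" "q \<le> sqrt r" "q \<le> sqrt s" "q * q = \<nu> / 2" using assms by (auto simp: q_def)
  have sq: "sqrt \<nu> \<le> 2 * q"
  proof -
    have "sqrt \<nu> \<le> sqrt (4 * (\<nu> / 2))" using \<nu> by (intro real_sqrt_le_mono) auto
    also have "\<dots> = 2 * q" by (simp only: real_sqrt_mult real_sqrt_four q_def)
    finally show ?thesis .
  qed
  have "1 / sqrt r - 1 / sqrt s = (s - r) / (sqrt r * sqrt s * (sqrt r + sqrt s))"
  proof -
    have p: "sqrt r > 0" "sqrt s > 0" using rs by auto
    have "s - r = (sqrt s - sqrt r) * (sqrt r + sqrt s)"
      using rs by (simp add: algebra_simps)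
    have "1 / x - 1 / y = (y - x) * (x + y) / (x * y * (x + y))" if "x > 0" "y > 0" for x y :: real
      using that by (simp add: divide_simps)
    from this[OF p] show ?thesis unfolding \<open>s - r = _\<close> .
  qed
  moreover have "sqrt r * sqrt s * (sqrt r + sqrt s) > 0" using rs by (intro mult_pos_pos add_pos_pos) auto
  ultimately have "\<bar>1 / sqrt r - 1 / sqrt s\<bar> = \<bar>r - s\<bar> / (sqrt r * sqrt s * (sqrt r + sqrt s))"
    by (simp only: abs_divide abs_of_pos abs_minus_commute)
  also have "\<dots> \<le> \<bar>r - s\<bar> / (q * q * (2 * q))"
    using q rs by (intro divide_left_mono mult_mono mult_pos_pos add_pos_pos) auto
  also have "\<dots> \<le> \<bar>r - s\<bar> / (\<nu> / 2 * sqrt \<nu>)"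
    unfolding q(4) using sq \<nu> q(1) by (intro divide_left_mono mult_left_mono) auto
  also have "\<dots> = 2 / (\<nu> * sqrt \<nu>) * \<bar>r - s\<bar>" using \<nu> by (simp add: field_simps)
  finally show ?thesis .
qed

text \<open>Two quantities are simplified in the leading term: the phase \<open>r\<close> is
  replaced by its linearisation \<theta>, and the amplitude \<open>1 / sqrt r\<close> is frozen at
  \<nu>.\<close>

definition phase_err where
  "phase_err P Q \<nu> r \<theta> = hankel1_0 r - osc P Q \<theta> / complex_of_real (sqrt \<nu>)"

text \<open>Here \<open>r\<close> and \<open>s\<close> are the exact arguments for two source
  points, \<theta> and \<phi> their linearisations, and \<open>t\<close> stands for the distance of
  the points. If the linearisation error is of order \<open>1 / \<nu>\<close>, both in size and in
  its dependence on the point, then the total error is of order \<open>\<nu>^(-3/2)\<close> in both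
  senses.\<close>

lemma hankel_far:
  assumes amp: "decaying (\<lambda>r. hankel1_0 r - osc P Q r / sqrt r)" and b: "b \<ge> 0"
  obtains C where "C \<ge> 0"
    "\<And>\<nu> r s \<theta> \<phi> t. \<lbrakk>\<nu> \<ge> 2 * b + 2; \<bar>r - \<nu>\<bar> \<le> b; \<bar>s - \<nu>\<bar> \<le> b; \<bar>r - \<theta>\<bar> \<le> b / \<nu>; \<bar>s - \<phi>\<bar> \<le> b / \<nu>;
       \<bar>(r - \<theta>) - (s - \<phi>)\<bar> \<le> b / \<nu> * t; \<bar>r - s\<bar> \<le> b * t; \<bar>\<theta> - \<phi>\<bar> \<le> b * t; t \<ge> 0\<rbrakk> \<Longrightarrow>
      cmod (phase_err P Q \<nu> r \<theta>) \<le> C / (\<nu> * sqrt \<nu>) \<and>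
      cmod (phase_err P Q \<nu> r \<theta> - phase_err P Q \<nu> s \<phi>) \<le> C / (\<nu> * sqrt \<nu>) * t"
proof -
  define e where "e r = hankel1_0 r - osc P Q r / sqrt r" for r
  obtain C where C: "\<And>R r s. \<lbrakk>R \<ge> 1; r \<ge> R; s \<ge> R\<rbrakk> \<Longrightarrow> cmod (e r) \<le> C / (R * sqrt R)"
    "\<And>R r s. \<lbrakk>R \<ge> 1; r \<ge> R; s \<ge> R\<rbrakk> \<Longrightarrow> cmod (e r - e s) \<le> C / (R * sqrt R) * \<bar>r - s\<bar>"
    using decayingE[OF amp[folded e_def]] by blast
  have C0: "C \<ge> 0" using order.trans[OF norm_ge_zero C(1)[of 1 1 1]] by simp
  define A where "A = cmod P + cmod Q"
  have A0: "A \<ge> 0" by (simp add: A_def)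
  define C' where "C' = (4 * C + 2 * b * A + A * b) + (4 * C * b + (2 * b * A + 2 * b * (A * b)) + (A * (b + 2 * b * b)))"
  show ?thesis
  proof (rule that[of C'])
    show "C' \<ge> 0" unfolding C'_def using C0 A0 b by simp
    fix \<nu> r s \<theta> \<phi> t :: real
    assume h: "\<nu> \<ge> 2 * b + 2" "\<bar>r - \<nu>\<bar> \<le> b" "\<bar>s - \<nu>\<bar> \<le> b" "\<bar>r - \<theta>\<bar> \<le> b / \<nu>" "\<bar>s - \<phi>\<bar> \<le> b / \<nu>"
       "\<bar>(r - \<theta>) - (s - \<phi>)\<bar> \<le> b / \<nu> * t" "\<bar>r - s\<bar> \<le> b * t" "\<bar>\<theta> - \<phi>\<bar> \<le> b * t" "t \<ge> 0"
    define z where "z = 1 / (\<nu> * sqrt \<nu>)"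
    \<comment> \<open>The threshold \<open>2 * b + 2\<close> keeps every argument within
      \<open>b\<close> of \<nu> beyond \<open>\<nu> / 2\<close>, and \<open>\<nu> / 2\<close> beyond
      1, where the asymptotics hold.\<close>
    have \<nu>: "\<nu> > 0" "\<nu> / 2 \<ge> 1" "r \<ge> \<nu> / 2" "s \<ge> \<nu> / 2" using h b by linarith+
    have z0: "z \<ge> 0" using \<nu> by (simp add: z_def)
    have far: "C / (\<nu> / 2 * sqrt (\<nu> / 2)) \<le> 4 * C * z"
    proof -
      have "sqrt \<nu> \<le> sqrt (4 * (\<nu> / 2))" using \<nu> by (intro real_sqrt_le_mono) auto
      also have "\<dots> = 2 * sqrt (\<nu> / 2)" by (simp only: real_sqrt_mult real_sqrt_four)
      finally have "sqrt \<nu> / 2 \<le> sqrt (\<nu> / 2)" by simp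
      hence "C / (\<nu> / 2 * sqrt (\<nu> / 2)) \<le> C / (\<nu> / 2 * (sqrt \<nu> / 2))"
        using \<nu> C0 by (intro divide_left_mono mult_left_mono) auto
      also have "\<dots> = 4 * C * z" using \<nu> by (simp add: z_def field_simps)
      finally show ?thesis .
    qed
    define g where "g r = 1 / sqrt r - 1 / sqrt \<nu>" for r
    have dec: "phase_err P Q \<nu> r \<theta> = e r + of_real (g r) * osc P Q r + (osc P Q r - osc P Q \<theta>) / sqrt \<nu>"
      for r \<theta> by (simp add: phase_err_def e_def g_def algebra_simps diff_divide_distrib)
    have e1: "cmod (e r) \<le> 4 * C * z" using C(1)[of "\<nu> / 2" r s] \<nu> far by simp
    have e2: "cmod (e r - e s) \<le> (4 * C * z) * (b * t)"
    proof -
      have "cmod (e r - e s) \<le> C / (\<nu> / 2 * sqrt (\<nu> / 2)) * \<bar>r - s\<bar>"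
        using C(2)[of "\<nu> / 2" r s] \<nu> by simp
      also have "\<dots> \<le> (4 * C * z) * (b * t)" using far h(7) C0 z0 by (intro mult_mono) auto
      finally show ?thesis .
    qed
    have g1: "\<bar>g x\<bar> \<le> 2 * b * z" if "\<bar>x - \<nu>\<bar> \<le> b" "x \<ge> \<nu> / 2" for x
    proof -
      have "\<bar>g x\<bar> \<le> 2 / (\<nu> * sqrt \<nu>) * \<bar>x - \<nu>\<bar>"
        unfolding g_def using \<nu> that by (intro inverse_sqrt_lipschitz) auto
      also have "\<dots> \<le> 2 / (\<nu> * sqrt \<nu>) * b" using that \<nu> by (intro mult_left_mono) auto
      finally show ?thesis by (simp add: z_def)
    qed
    have g2: "\<bar>g r - g s\<bar> \<le> 2 * b * t * z"
    proof -
      have "\<bar>g r - g s\<bar> \<le> 2 / (\<nu> * sqrt \<nu>) * \<bar>r - s\<bar>"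
        unfolding g_def using inverse_sqrt_lipschitz[of \<nu> r s] \<nu> by simp
      also have "\<dots> \<le> 2 / (\<nu> * sqrt \<nu>) * (b * t)" using h(7) \<nu> by (intro mult_left_mono) auto
      finally show ?thesis by (simp add: z_def)
    qed
    have o: "cmod (osc P Q x) \<le> A" for x unfolding A_def by (rule osc_bound)
    have ol: "cmod (osc P Q x - osc P Q y) \<le> A * \<bar>x - y\<bar>" for x y unfolding A_def by (rule osc_lipschitz)
    have s1: "cmod ((osc P Q r - osc P Q \<theta>) / sqrt \<nu>) \<le> A * b * z"
    proof -
      have "cmod ((osc P Q r - osc P Q \<theta>) / sqrt \<nu>) = cmod (osc P Q r - osc P Q \<theta>) / sqrt \<nu>"
        using \<nu> by (simp add: norm_divide)
      also have "\<dots> \<le> A * (b / \<nu>) / sqrt \<nu>"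
        using \<nu> by (intro divide_right_mono order.trans[OF ol[of r \<theta>] mult_left_mono[OF h(4) A0]]) auto
      finally have "cmod ((osc P Q r - osc P Q \<theta>) / sqrt \<nu>) \<le> A * (b / \<nu>) / sqrt \<nu>" .
      thus ?thesis by (simp add: z_def)
    qed
    have s2: "cmod ((osc P Q r - osc P Q \<theta>) / sqrt \<nu> - (osc P Q s - osc P Q \<phi>) / sqrt \<nu>) \<le> A * (b + 2 * b * b) * t * z"
    proof -
      have "cmod ((osc P Q r - osc P Q \<theta>) - (osc P Q s - osc P Q \<phi>))
         \<le> A * (\<bar>(r - \<theta>) - (s - \<phi>)\<bar> + 2 * \<bar>s - \<phi>\<bar> * \<bar>\<theta> - \<phi>\<bar>)"
        using osc_second_difference[of P Q \<theta> "r - \<theta>" \<phi> "s - \<phi>"] by (simp add: A_def)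
      also have "\<dots> \<le> A * (b / \<nu> * t + 2 * (b / \<nu>) * (b * t))"
        using h b \<nu> A0 by (intro mult_left_mono add_mono mult_mono) auto
      also have "\<dots> = A * (b + 2 * b * b) * t / \<nu>" using \<nu> by (simp add: field_simps)
      finally have "cmod ((osc P Q r - osc P Q \<theta>) - (osc P Q s - osc P Q \<phi>)) / sqrt \<nu> \<le> A * (b + 2 * b * b) * t / \<nu> / sqrt \<nu>"
        using \<nu> by (intro divide_right_mono) auto
      thus ?thesis using \<nu> by (simp add: z_def diff_divide_distrib[symmetric] norm_divide)
    qed
    have m1: "cmod (of_real (g r) * osc P Q r) \<le> 2 * b * z * A"
      using g1[of r] h(2) \<nu> o[of r] b z0 by (auto simp: norm_mult intro!: mult_mono)
    have m2: "cmod (of_real (g r) * osc P Q r - of_real (g s) * osc P Q s) \<le> 2 * b * t * z * A + 2 * b * z * (A * (b * t))"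
    proof -
      have "of_real (g r) * osc P Q r - of_real (g s) * osc P Q s
         = of_real (g r - g s) * osc P Q r + of_real (g s) * (osc P Q r - osc P Q s)"
        by (simp add: algebra_simps)
      also have "cmod \<dots> \<le> \<bar>g r - g s\<bar> * cmod (osc P Q r) + \<bar>g s\<bar> * cmod (osc P Q r - osc P Q s)"
        by (rule order.trans[OF norm_triangle_ineq]) (simp only: norm_mult norm_of_real order_refl)
      also have "\<dots> \<le> 2 * b * t * z * A + 2 * b * z * (A * (b * t))"
        using g1[of s] g2 o[of r] order.trans[OF ol[of r s] mult_left_mono[OF h(7) A0]] h(3,9) \<nu> b z0
        by (intro add_mono mult_mono) auto
      finally show ?thesis .
    qed
    show "cmod (phase_err P Q \<nu> r \<theta>) \<le> C' / (\<nu> * sqrt \<nu>) \<and>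
      cmod (phase_err P Q \<nu> r \<theta> - phase_err P Q \<nu> s \<phi>) \<le> C' / (\<nu> * sqrt \<nu>) * t"
    proof
      have "cmod (phase_err P Q \<nu> r \<theta>) \<le> 4 * C * z + 2 * b * z * A + A * b * z"
        unfolding dec using e1 m1 s1 by (intro order.trans[OF norm_triangle_ineq] add_mono)
      also have "\<dots> = (4 * C + 2 * b * A + A * b) * z" by (simp add: algebra_simps)
      also have "\<dots> \<le> C' * z" unfolding C'_def using C0 A0 b z0 by (intro mult_right_mono) auto
      finally show "cmod (phase_err P Q \<nu> r \<theta>) \<le> C' / (\<nu> * sqrt \<nu>)" by (simp add: z_def)
      have "phase_err P Q \<nu> r \<theta> - phase_err P Q \<nu> s \<phi>
        = (e r - e s) + (of_real (g r) * osc P Q r - of_real (g s) * osc P Q s)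
          + ((osc P Q r - osc P Q \<theta>) / sqrt \<nu> - (osc P Q s - osc P Q \<phi>) / sqrt \<nu>)"
        unfolding dec by (simp add: algebra_simps)
      also have "cmod \<dots> \<le> (4 * C * z) * (b * t) + (2 * b * t * z * A + 2 * b * z * (A * (b * t))) + A * (b + 2 * b * b) * t * z"
        by (intro order.trans[OF norm_triangle_ineq] add_mono e2 m2 s2)
      also have "\<dots> = (4 * C * b + (2 * b * A + 2 * b * (A * b)) + (A * (b + 2 * b * b))) * (z * t)"
        by (simp add: algebra_simps)
      also have "\<dots> \<le> C' * (z * t)" unfolding C'_def using C0 A0 b z0 h(9) by (intro mult_right_mono) auto
      finally show "cmod (phase_err P Q \<nu> r \<theta> - phase_err P Q \<nu> s \<phi>) \<le> C' / (\<nu> * sqrt \<nu>) * t"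
        by (simp add: z_def)
    qed
  qed
qed

text \<open>Rationalising, \<open>sqrt (a\<^sup>2 + c\<^sup>2) - a = c\<^sup>2 / (sqrt (a\<^sup>2 +
  c\<^sup>2) + a)\<close>. With a long leg \<open>a\<close> and a bounded leg \<open>c\<close>, this
  quotient and its Lipschitz constant are of order \<open>1 / A\<close>. It is the error of
  linearising the distance to a remote image.\<close>

lemma hypotenuse_excess:
  fixes a c a' c' :: real
  assumes A: "A \<ge> 1" "a \<ge> A" "a' \<ge> A" and D: "\<bar>c\<bar> \<le> D" "\<bar>c'\<bar> \<le> D"
  shows "\<bar>sqrt (a\<^sup>2 + c\<^sup>2) - a\<bar> \<le> D\<^sup>2 / A"
    and "\<bar>(sqrt (a\<^sup>2 + c\<^sup>2) - a) - (sqrt (a'\<^sup>2 + c'\<^sup>2) - a')\<bar>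
        \<le> (2 * D + 2 * D\<^sup>2) / A * (\<bar>a - a'\<bar> + \<bar>c - c'\<bar>)"
proof -
  define S where "S a c = sqrt (a\<^sup>2 + c\<^sup>2) + a" for a c :: real
  have S: "S a c \<ge> A" if "a \<ge> A" for a c
  proof -
    have "0 \<le> sqrt (a\<^sup>2 + c\<^sup>2)" by simp
    thus ?thesis using that unfolding S_def by linarith
  qed
  have eq: "sqrt (a\<^sup>2 + c\<^sup>2) - a = c\<^sup>2 / S a c" if "a \<ge> A" for a c
  proof -
    have "(sqrt (a\<^sup>2 + c\<^sup>2) - a) * S a c = c\<^sup>2"
      unfolding S_def by (simp add: algebra_simps power2_eq_square[symmetric])
    thus ?thesis using S[OF that, of c] A by (simp add: eq_divide_eq)
  qed
  have c2: "c\<^sup>2 \<le> D\<^sup>2" "c'\<^sup>2 \<le> D\<^sup>2" using power_mono[OF D(1), of 2] power_mono[OF D(2), of 2] by auto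
  show "\<bar>sqrt (a\<^sup>2 + c\<^sup>2) - a\<bar> \<le> D\<^sup>2 / A"
    unfolding eq[OF A(2)] using S[OF A(2), of c] A c2 by (simp add: abs_divide) (intro frac_le, auto)
  have S': "\<bar>S a c - S a' c'\<bar> \<le> 2 * (\<bar>a - a'\<bar> + \<bar>c - c'\<bar>)"
  proof -
    have "\<bar>sqrt (a\<^sup>2 + c\<^sup>2) - sqrt (a'\<^sup>2 + c'\<^sup>2)\<bar> = \<bar>norm (a, c) - norm (a', c')\<bar>" by (simp add: norm_Pair)
    also have "\<dots> \<le> norm ((a, c) - (a', c'))" by (rule norm_triangle_ineq3)
    also have "\<dots> \<le> \<bar>a - a'\<bar> + \<bar>c - c'\<bar>" using norm_Pair_le[of "a - a'" "c - c'"] by simp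
    finally have "\<bar>sqrt (a\<^sup>2 + c\<^sup>2) - sqrt (a'\<^sup>2 + c'\<^sup>2)\<bar> \<le> \<bar>a - a'\<bar> + \<bar>c - c'\<bar>" .
    moreover have "\<bar>p + a - (q + a')\<bar> \<le> 2 * (\<bar>a - a'\<bar> + \<bar>c - c'\<bar>)"
      if "\<bar>p - q\<bar> \<le> \<bar>a - a'\<bar> + \<bar>c - c'\<bar>" for p q :: real
    proof -
      have "\<bar>p + a - (q + a')\<bar> \<le> \<bar>p - q\<bar> + \<bar>a - a'\<bar>"
        using abs_triangle_ineq[of "p - q" "a - a'"] by (simp add: algebra_simps)
      also have "\<dots> \<le> (\<bar>a - a'\<bar> + \<bar>c - c'\<bar>) + (\<bar>a - a'\<bar> + \<bar>c - c'\<bar>)"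
        by (intro add_mono that) simp
      finally show ?thesis by simp
    qed
    ultimately show ?thesis unfolding S_def by blast
  qed
  have "c\<^sup>2 / S a c - c'\<^sup>2 / S a' c' = (c - c') * (c + c') / S a c + c'\<^sup>2 * (S a' c' - S a c) / (S a c * S a' c')"
    using S[OF A(2), of c] S[OF A(3), of c'] A(1) by (simp add: field_simps power2_eq_square)
  also have "\<bar>\<dots>\<bar> \<le> \<bar>c - c'\<bar> * \<bar>c + c'\<bar> / S a c + c'\<^sup>2 * \<bar>S a' c' - S a c\<bar> / (S a c * S a' c')"
    using S[OF A(2), of c] S[OF A(3), of c'] A(1)
    by (intro order.trans[OF abs_triangle_ineq]) (simp add: abs_mult abs_divide)
  also have "\<dots> \<le> \<bar>c - c'\<bar> * (2 * D) / A + D\<^sup>2 * (2 * (\<bar>a - a'\<bar> + \<bar>c - c'\<bar>)) / (A * 1)"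
    using S[OF A(2), of c] S[OF A(3), of c'] A(1) c2 D S'
    by (intro add_mono frac_le mult_mono) auto
  also have "\<dots> \<le> (\<bar>a - a'\<bar> + \<bar>c - c'\<bar>) * (2 * D) / A + D\<^sup>2 * (2 * (\<bar>a - a'\<bar> + \<bar>c - c'\<bar>)) / A"
    using A(1) D by (intro add_mono divide_right_mono mult_right_mono) auto
  also have "\<dots> = (2 * D + 2 * D\<^sup>2) / A * (\<bar>a - a'\<bar> + \<bar>c - c'\<bar>)"
    using A(1) by (simp add: field_simps)
  finally show "\<bar>(sqrt (a\<^sup>2 + c\<^sup>2) - a) - (sqrt (a'\<^sup>2 + c'\<^sup>2) - a')\<bar>
        \<le> (2 * D + 2 * D\<^sup>2) / A * (\<bar>a - a'\<bar> + \<bar>c - c'\<bar>)"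
    unfolding eq[OF A(2)] eq[OF A(3)] .
qed

section \<open>The Green function of the duct\<close>

lemma abs_ln_le_powr:
  fixes r q R :: real
  assumes "0 < r" "r \<le> R" "0 < q"
  shows "1 + \<bar>ln r\<bar> \<le> (1 / q + (1 + \<bar>ln R\<bar>) * (1 + R powr q)) * r powr (- q)"
proof -
  have R: "R > 0" using assms by simp
  have one: "1 \<le> (1 + R powr q) * r powr (- q)"
  proof -
    have "1 = R powr q * R powr (- q)" using R by (simp add: powr_minus)
    also have "\<dots> \<le> (1 + R powr q) * r powr (- q)"
      using assms R by (intro mult_mono powr_mono2') auto
    finally show ?thesis .
  qed
  have "\<bar>ln r\<bar> \<le> 1 / q * r powr (- q) + \<bar>ln R\<bar> * 1"
  proof (cases "r \<le> 1")
    case True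
    have "ln (1 / r) \<le> (1 / r) powr q / q" using True assms by (intro ln_powr_bound) auto
    also have "(1 / r) powr q = r powr (- q)" using assms by (simp add: powr_minus powr_divide inverse_eq_divide)
    finally show ?thesis using True assms by (simp add: ln_div)
  next
    case False
    hence "\<bar>ln r\<bar> \<le> \<bar>ln R\<bar>" using assms by simp
    thus ?thesis using assms by (simp add: add_increasing)
  qed
  also have "\<dots> \<le> 1 / q * r powr (- q) + \<bar>ln R\<bar> * ((1 + R powr q) * r powr (- q))"
    using one by (intro add_left_mono mult_left_mono) auto
  finally show ?thesis using one by (simp add: algebra_simps)
qed

text \<open>With \<open>x = (r - s) / s\<close> everything reduces to
  \<open>ln (1 + x) \<le> 2 / q * x powr q\<close>. For \<open>x \<le> 1\<close> this follows from
  \<open>ln (1 + x) \<le> x\<close>, and otherwise from the power bound for the logarithm and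
  \<open>1 + x \<le> 2 * x\<close>. The sum of both negative powers covers either order of
  \<open>r\<close> and \<open>s\<close>.\<close>

lemma abs_ln_diff_le_powr:
  fixes r s q :: real
  assumes "0 < r" "0 < s" "0 < q" "q \<le> 1"
  shows "\<bar>ln r - ln s\<bar> \<le> 2 / q * \<bar>r - s\<bar> powr q * (r powr (- q) + s powr (- q))"
proof -
  have *: "ln r - ln s \<le> 2 / q * (r - s) powr q * s powr (- q)" if "0 < s" "s \<le> r" for r s :: real
  proof -
    define x where "x = (r - s) / s"
    have x: "x \<ge> 0" "r = s * (1 + x)" using that by (auto simp: x_def field_simps)
    have "ln r - ln s = ln (1 + x)" using that x by (simp add: ln_mult)
    also have "\<dots> \<le> 2 / q * x powr q"
    proof (cases "x \<le> 1")
      case True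
      have "ln (1 + x) \<le> x" using x ln_add_one_self_le_self by blast
      also have "x \<le> x powr q"
        using powr_mono'[of q 1 x] assms x True by (cases "x = 0") auto
      also have "x powr q = 1 * x powr q" by simp
      also have "\<dots> \<le> 2 / q * x powr q" using assms by (intro mult_right_mono) auto
      finally show ?thesis .
    next
      case False
      have "ln (1 + x) \<le> (1 + x) powr q / q" using x assms by (intro ln_powr_bound) auto
      also have "\<dots> \<le> (2 * x) powr q / q"
        using False assms by (intro divide_right_mono powr_mono2) auto
      also have "(2 * x) powr q = 2 powr q * x powr q" using x by (simp add: powr_mult)
      also have "\<dots> / q \<le> 2 * x powr q / q"
        using powr_mono[of q 1 2] assms by (intro divide_right_mono mult_right_mono) auto
      finally show ?thesis by simp
    qed
    also have "x powr q = (r - s) powr q * s powr (- q)"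
      using that by (simp add: x_def powr_divide powr_minus_divide)
    finally show ?thesis by (simp add: mult.assoc)
  qed
  show ?thesis
  proof (cases "s \<le> r")
    case True
    have "\<bar>ln r - ln s\<bar> = ln r - ln s" using True assms by simp
    also have "\<dots> \<le> 2 / q * \<bar>r - s\<bar> powr q * s powr (- q)" using *[OF assms(2) True] True by simp
    also have "\<dots> \<le> 2 / q * \<bar>r - s\<bar> powr q * (r powr (- q) + s powr (- q))"
      using assms by (intro mult_left_mono) auto
    finally show ?thesis .
  next
    case False
    have "\<bar>ln r - ln s\<bar> = ln s - ln r" using False assms by simp
    also have "\<dots> \<le> 2 / q * \<bar>r - s\<bar> powr q * r powr (- q)" using *[of r s] assms False by (simp add: abs_minus_commute)
    also have "\<dots> \<le> 2 / q * \<bar>r - s\<bar> powr q * (r powr (- q) + s powr (- q))"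
      using assms by (intro mult_left_mono) auto
    finally show ?thesis .
  qed
qed

text \<open>On a bounded range a Lipschitz bound is also a Hoelder bound, which brings the smooth
  parts to the same exponent as the singular one.\<close>

lemma le_powr_mult_powr:
  fixes t q K :: real
  assumes t: "0 \<le> t" "t \<le> K" and q: "0 < q" "q < 1"
  shows "t \<le> K powr (1 - q) * t powr q"
proof (cases "t = 0")
  case False
  have "t = t powr (1 - q) * t powr q" using False t q by (simp add: powr_add[symmetric])
  also have "\<dots> \<le> K powr (1 - q) * t powr q"
    using t q by (intro mult_right_mono powr_mono2) auto
  finally show ?thesis .
qed (use q in auto)

lemma norm_real_pair: "norm (x, y) = sqrt (x\<^sup>2 + y\<^sup>2)" for x y :: real
  by (simp add: norm_Pair)

lemma abs_fst_le_norm: "\<bar>fst w\<bar> \<le> norm w" for w :: "real \<times> real"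
  using norm_fst_le[of "fst w" "snd w"] by simp

lemma abs_snd_le_norm: "\<bar>snd w\<bar> \<le> norm w" for w :: "real \<times> real"
  using norm_snd_le[of "snd w" "fst w"] by simp

section \<open>Stretched coordinates and the fundamental solution\<close>

locale convected_duct =
  fixes d M k :: real
  assumes d: "d > 0" and M0: "0 \<le> M" and M1: "M < 1" and k: "k > 0"
begin

text \<open>\<open>b\<close> is the Prandtl-Glauert factor of the convected equation. \<kappa> is
  the phase gained per unit of transversal length, the direction in which the images are lined up,
  and \<alpha> is the rate of the convective phase along the duct.\<close>

definition b where "b = sqrt (1 - M\<^sup>2)"
definition \<kappa> where "\<kappa> = k / b"
definition \<alpha> where "\<alpha> = k * M / (1 - M\<^sup>2)"
definition c0 where "c0 = \<i> / complex_of_real (4 * b)"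

lemma M2: "0 < 1 - M\<^sup>2" "1 - M\<^sup>2 \<le> 1"
  using M0 M1 by (auto simp: power_less_one_iff abs_square_less_1)

lemma b: "0 < b" "b \<le> 1" "b\<^sup>2 = 1 - M\<^sup>2"
  using M2 by (auto simp: b_def)

lemma \<kappa>_pos: "\<kappa> > 0" using b k by (simp add: \<kappa>_def)
lemma \<alpha>_nonneg: "\<alpha> \<ge> 0" using M2 M0 k by (simp add: \<alpha>_def)

definition profile :: "real \<times> real \<Rightarrow> complex" where
  "profile u = hankel1_0 (k * rho M u) * cis (- (\<alpha> * fst u))"

lemma fund_sol_eq: "fund_sol M k x y = c0 * profile (x - y)"
  by (simp add: fund_sol_def profile_def c0_def b_def \<alpha>_def cis_conv_exp)

lemma rho_eq_norm: "rho M u = norm (fst u / b\<^sup>2, snd u / b)"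
proof -
  have "b * b = 1 - M\<^sup>2" using b(3) by (simp add: power2_eq_square)
  have "norm (fst u / b\<^sup>2, snd u / b) = sqrt ((fst u / b\<^sup>2)\<^sup>2 + (snd u / b)\<^sup>2)" by (rule norm_real_pair)
  also have "(fst u / b\<^sup>2)\<^sup>2 + (snd u / b)\<^sup>2 = ((fst u)\<^sup>2 + b\<^sup>2 * (snd u)\<^sup>2) / (b\<^sup>2)\<^sup>2"
    using b(1) by (simp add: field_simps power2_eq_square)
  also have "sqrt \<dots> = rho M u" using M2 unfolding rho_def b(3) by (simp add: real_sqrt_divide)
  finally show ?thesis ..
qed

text \<open>The transversal coordinate is left unscaled under the root so that
  \<open>hypotenuse_excess\<close> applies, with the transversal distance to an image as the long
  leg.\<close>

lemma k_rho_eq: "k * rho M u = \<kappa> * sqrt ((snd u)\<^sup>2 + (fst u / b)\<^sup>2)"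
proof -
  have "norm (fst u / b\<^sup>2, snd u / b) = norm ((1 / b) *\<^sub>R (snd u, fst u / b))"
    by (simp add: norm_real_pair power2_eq_square add.commute)
  also have "\<dots> = 1 / b * sqrt ((snd u)\<^sup>2 + (fst u / b)\<^sup>2)"
    using b(1) by (subst norm_scaleR) (simp add: norm_real_pair)
  finally show ?thesis by (simp add: rho_eq_norm \<kappa>_def)
qed

lemma norm_le_rho: "norm u \<le> rho M u"
proof -
  have b2: "b\<^sup>2 \<le> 1" "b\<^sup>2 > 0" using b(1,2) by (auto simp: power_le_one)
  have 1: "\<bar>fst u\<bar> \<le> \<bar>fst u / b\<^sup>2\<bar>" "\<bar>snd u\<bar> \<le> \<bar>snd u / b\<bar>"
    using b2 b(1,2) by (simp_all add: abs_divide pos_le_divide_eq mult_left_le)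
  have "norm u = sqrt ((fst u)\<^sup>2 + (snd u)\<^sup>2)" by (simp add: norm_prod_def)
  also have "\<dots> \<le> sqrt ((fst u / b\<^sup>2)\<^sup>2 + (snd u / b)\<^sup>2)"
    using 1 by (intro real_sqrt_le_mono add_mono) (simp_all only: abs_le_square_iff)
  finally show ?thesis by (simp add: rho_eq_norm norm_real_pair)
qed

lemma rho_le_norm: "rho M u \<le> norm u / b\<^sup>2"
proof -
  have "rho M u = norm ((1 / b\<^sup>2) *\<^sub>R (fst u, b * snd u))"
    using b(1) by (simp add: rho_eq_norm power2_eq_square)
  also have "\<dots> = norm (fst u, b * snd u) / b\<^sup>2" by (subst norm_scaleR) simp
  also have "\<dots> \<le> norm (fst u, snd u) / b\<^sup>2"
  proof (intro divide_right_mono)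
    have "\<bar>b * snd u\<bar> \<le> \<bar>snd u\<bar>" using b by (simp add: abs_mult mult_left_le_one_le)
    thus "norm (fst u, b * snd u) \<le> norm (fst u, snd u)"
      unfolding norm_real_pair abs_le_square_iff by (intro real_sqrt_le_mono add_left_mono)
  qed simp
  finally show ?thesis by simp
qed

lemma rho_lipschitz: "\<bar>rho M u - rho M v\<bar> \<le> norm (u - v) / b\<^sup>2"
proof -
  have "\<bar>rho M u - rho M v\<bar> \<le> norm ((fst u / b\<^sup>2, snd u / b) - (fst v / b\<^sup>2, snd v / b))"
    unfolding rho_eq_norm by (rule norm_triangle_ineq3)
  also have "\<dots> = rho M (u - v)" by (simp add: rho_eq_norm diff_divide_distrib)
  also have "\<dots> \<le> norm (u - v) / b\<^sup>2" by (rule rho_le_norm)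
  finally show ?thesis .
qed

lemma profile_near:
  obtains C where "C \<ge> 0"
    "\<And>u v. \<lbrakk>u \<noteq> 0; v \<noteq> 0; norm u \<le> R; norm v \<le> R\<rbrakk> \<Longrightarrow>
       cmod (profile u - profile v) \<le> C * (norm (u - v) * (1 + \<bar>ln (k * rho M u)\<bar>)
           + \<bar>ln (k * rho M u) - ln (k * rho M v)\<bar>)"
proof (cases "R > 0")
  \<comment> \<open>No nonzero vector has norm at most \<open>R\<close> here, so the estimate holds
    vacuously.\<close>
  case False
  have "norm u > R" if "u \<noteq> 0" for u :: "real \<times> real"
    using that False by (meson not_less order.strict_trans1 zero_less_norm_iff)
  thus ?thesis by (intro that[of 0]) (auto simp: not_le[symmetric])
next
  case R: True
  define R' where "R' = k * R / b\<^sup>2"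
  have R': "R' > 0" using R k b(1) by (simp add: R'_def)
  obtain C where C: "C \<ge> 0" "\<And>r s. r \<in> {0<..R'} \<Longrightarrow> s \<in> {0<..R'} \<Longrightarrow>
     cmod (hankel1_0 r - hankel1_0 s) \<le> C * (\<bar>r - s\<bar> * (1 + \<bar>ln r\<bar>) + \<bar>ln r - ln s\<bar>)"
    using hankel_near[of R'] by blast
  \<comment> \<open>Comparison with the fixed endpoint \<open>R'\<close> turns the difference
    estimate into a bound on the size of the Hankel function. The size matters because the phase
    factor multiplying it varies as well.\<close>
  define B where "B = cmod (hankel1_0 R') + C * (R' + 1 + \<bar>ln R'\<bar>)"
  have B0: "B \<ge> 0" using C R' by (simp add: B_def)
  have bd: "cmod (hankel1_0 r) \<le> B * (1 + \<bar>ln r\<bar>)" if r: "r \<in> {0<..R'}" for r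
  proof -
    have "cmod (hankel1_0 r) \<le> cmod (hankel1_0 R') + cmod (hankel1_0 r - hankel1_0 R')"
      using norm_triangle_ineq[of "hankel1_0 R'" "hankel1_0 r - hankel1_0 R'"] by simp
    also have "\<dots> \<le> cmod (hankel1_0 R') * (1 + \<bar>ln r\<bar>) + C * ((R' + 1 + \<bar>ln R'\<bar>) * (1 + \<bar>ln r\<bar>))"
    proof (rule add_mono)
      show "cmod (hankel1_0 R') \<le> cmod (hankel1_0 R') * (1 + \<bar>ln r\<bar>)" by (simp add: distrib_left)
      have "cmod (hankel1_0 r - hankel1_0 R') \<le> C * (\<bar>r - R'\<bar> * (1 + \<bar>ln r\<bar>) + \<bar>ln r - ln R'\<bar>)"
        using r R' by (intro C) auto
      also have "\<dots> \<le> C * ((R' + 1 + \<bar>ln R'\<bar>) * (1 + \<bar>ln r\<bar>))"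
      proof (intro mult_left_mono C)
        have "\<bar>r - R'\<bar> * (1 + \<bar>ln r\<bar>) \<le> R' * (1 + \<bar>ln r\<bar>)" using r by (intro mult_right_mono) auto
        moreover have "\<bar>ln r - ln R'\<bar> \<le> (1 + \<bar>ln R'\<bar>) * (1 + \<bar>ln r\<bar>)"
          by (simp add: algebra_simps) (smt (verit) mult_nonneg_nonneg)
        ultimately show "\<bar>r - R'\<bar> * (1 + \<bar>ln r\<bar>) + \<bar>ln r - ln R'\<bar> \<le> (R' + 1 + \<bar>ln R'\<bar>) * (1 + \<bar>ln r\<bar>)"
          by (simp add: algebra_simps)
      qed
      finally show "cmod (hankel1_0 r - hankel1_0 R') \<le> C * ((R' + 1 + \<bar>ln R'\<bar>) * (1 + \<bar>ln r\<bar>))" .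
    qed
    also have "\<dots> = B * (1 + \<bar>ln r\<bar>)" by (simp add: B_def algebra_simps)
    finally show ?thesis .
  qed
  define C' where "C' = C * (k / b\<^sup>2 + 1) + B * (2 * \<alpha>)"
  show ?thesis
  proof (rule that[of C'])
    show "C' \<ge> 0" unfolding C'_def using C(1) B0 \<alpha>_nonneg k b(1) by simp
    fix u v :: "real \<times> real" assume uv: "u \<noteq> 0" "v \<noteq> 0" "norm u \<le> R" "norm v \<le> R"
    define r where "r = k * rho M u"
    define s where "s = k * rho M v"
    define t where "t = norm (u - v)"
    have rng: "k * rho M w \<in> {0<..R'}" if "w \<noteq> 0" "norm w \<le> R" for w
    proof -
      have "0 < norm w" using that by simp
      also have "\<dots> \<le> rho M w" by (rule norm_le_rho)
      finally have "0 < rho M w" .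
      moreover have "rho M w \<le> R / b\<^sup>2"
        by (rule order.trans[OF rho_le_norm]) (use that in \<open>intro divide_right_mono, auto\<close>)
      ultimately show ?thesis using k mult_left_mono[of "rho M w" "R / b\<^sup>2" k] by (simp add: R'_def)
    qed
    have rs: "r \<in> {0<..R'}" "s \<in> {0<..R'}" unfolding r_def s_def using rng uv by auto
    have rst: "\<bar>r - s\<bar> \<le> k / b\<^sup>2 * t"
      using mult_left_mono[OF rho_lipschitz[of u v], of k] k
      by (simp add: r_def s_def t_def right_diff_distrib[symmetric] abs_mult)
    have t0: "t \<ge> 0" by (simp add: t_def)
    define D where "D = t * (1 + \<bar>ln r\<bar>) + \<bar>ln r - ln s\<bar>"
    have D: "t * (1 + \<bar>ln r\<bar>) \<le> D" by (simp add: D_def)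
    have H: "cmod (hankel1_0 r - hankel1_0 s) \<le> C * ((k / b\<^sup>2 + 1) * D)"
    proof -
      have "cmod (hankel1_0 r - hankel1_0 s) \<le> C * (\<bar>r - s\<bar> * (1 + \<bar>ln r\<bar>) + \<bar>ln r - ln s\<bar>)"
        by (rule C(2)[OF rs])
      also have "\<dots> \<le> C * ((k / b\<^sup>2 * t) * (1 + \<bar>ln r\<bar>) + \<bar>ln r - ln s\<bar>)"
        using rst by (intro mult_left_mono C add_right_mono mult_right_mono) auto
      also have "\<dots> \<le> C * (k / b\<^sup>2 * D + D)"
      proof (intro mult_left_mono C add_mono)
        show "k / b\<^sup>2 * t * (1 + \<bar>ln r\<bar>) \<le> k / b\<^sup>2 * D"
          using mult_left_mono[OF D, of "k / b\<^sup>2"] k by (simp add: mult.assoc)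
        show "\<bar>ln r - ln s\<bar> \<le> D" using t0 by (simp add: D_def)
      qed
      finally show ?thesis by (simp add: distrib_right)
    qed
    have cis: "cmod (cis (- (\<alpha> * fst u)) - cis (- (\<alpha> * fst v))) \<le> 2 * \<alpha> * t"
    proof -
      have "cmod (cis (- (\<alpha> * fst u)) - cis (- (\<alpha> * fst v))) \<le> 2 * \<bar>- (\<alpha> * fst u) - - (\<alpha> * fst v)\<bar>"
        by (rule cmod_cis_diff_le)
      also have "\<dots> = 2 * \<alpha> * \<bar>fst (u - v)\<bar>"
      proof -
        have "- (\<alpha> * fst u) - - (\<alpha> * fst v) = \<alpha> * - fst (u - v)" by (simp add: algebra_simps)
        thus ?thesis using \<alpha>_nonneg by (simp only: abs_mult abs_minus_cancel)
      qed
      also have "\<dots> \<le> 2 * \<alpha> * t" unfolding t_def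
        using abs_fst_le_norm[of "u - v"] \<alpha>_nonneg by (intro mult_left_mono) auto
      finally show ?thesis .
    qed
    have "profile u - profile v = (hankel1_0 r - hankel1_0 s) * cis (- (\<alpha> * fst v))
        + hankel1_0 r * (cis (- (\<alpha> * fst u)) - cis (- (\<alpha> * fst v)))"
      unfolding profile_def r_def s_def by (simp add: algebra_simps)
    also have "cmod \<dots> \<le> cmod (hankel1_0 r - hankel1_0 s) + cmod (hankel1_0 r) * cmod (cis (- (\<alpha> * fst u)) - cis (- (\<alpha> * fst v)))"
      by (rule order.trans[OF norm_triangle_ineq]) (simp add: norm_mult)
    also have "\<dots> \<le> C * ((k / b\<^sup>2 + 1) * D) + (B * (1 + \<bar>ln r\<bar>)) * (2 * \<alpha> * t)"
      using H bd[OF rs(1)] cis B0 by (intro add_mono mult_mono) auto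
    also have "\<dots> = C * ((k / b\<^sup>2 + 1) * D) + B * (2 * \<alpha>) * (t * (1 + \<bar>ln r\<bar>))"
      by (simp add: algebra_simps)
    also have "\<dots> \<le> C * ((k / b\<^sup>2 + 1) * D) + B * (2 * \<alpha>) * D"
      using D B0 \<alpha>_nonneg by (intro add_left_mono mult_left_mono) auto
    also have "\<dots> = C' * D" by (simp add: C'_def algebra_simps)
    finally show "cmod (profile u - profile v) \<le> C' * (norm (u - v) * (1 + \<bar>ln (k * rho M u)\<bar>)
           + \<bar>ln (k * rho M u) - ln (k * rho M v)\<bar>)"
      unfolding D_def r_def s_def t_def .
  qed
qed

lemma k_rho_bounds:
  assumes "u \<noteq> 0"
  shows "0 < k * norm u" "k * norm u \<le> k * rho M u" "0 < k * rho M u" "k * rho M u \<le> k / b\<^sup>2 * norm u"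
proof -
  show 1: "0 < k * norm u" using assms k by simp
  show 2: "k * norm u \<le> k * rho M u" using norm_le_rho k by (intro mult_left_mono) auto
  show "0 < k * rho M u" using 1 2 by linarith
  show "k * rho M u \<le> k / b\<^sup>2 * norm u" using mult_left_mono[OF rho_le_norm[of u], of k] k by simp
qed

lemma k_rho_lipschitz: "\<bar>k * rho M u - k * rho M v\<bar> \<le> k / b\<^sup>2 * norm (u - v)"
  using mult_left_mono[OF rho_lipschitz[of u v], of k] k
  by (simp add: right_diff_distrib[symmetric] abs_mult)

text \<open>On an annulus the logarithm and its slope are bounded. This serves the reflected source
  and the finitely many image pairs that are too near for the asymptotics.\<close>

lemma profile_lipschitz_away:
  assumes \<delta>: "\<delta> > 0"
  obtains L where "L \<ge> 0"
    "\<And>u v. \<lbrakk>\<delta> \<le> norm u; norm u \<le> R; \<delta> \<le> norm v; norm v \<le> R\<rbrakk> \<Longrightarrow>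
       cmod (profile u - profile v) \<le> L * norm (u - v)"
proof -
  obtain C where C: "C \<ge> 0"
    "\<And>u v. \<lbrakk>u \<noteq> 0; v \<noteq> 0; norm u \<le> R; norm v \<le> R\<rbrakk> \<Longrightarrow>
       cmod (profile u - profile v) \<le> C * (norm (u - v) * (1 + \<bar>ln (k * rho M u)\<bar>)
           + \<bar>ln (k * rho M u) - ln (k * rho M v)\<bar>)"
    using profile_near by blast
  define B where "B = 1 + \<bar>ln (k * \<delta>)\<bar> + \<bar>ln (k / b\<^sup>2 * R)\<bar> + k / b\<^sup>2 / (k * \<delta>)"
  show ?thesis
  proof (rule that[of "C * B"])
    show "C * B \<ge> 0" unfolding B_def using C(1) k b(1) \<delta> by (intro mult_nonneg_nonneg add_nonneg_nonneg) auto
    fix u v :: "real \<times> real" assume h: "\<delta> \<le> norm u" "norm u \<le> R" "\<delta> \<le> norm v" "norm v \<le> R"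
    have nz: "u \<noteq> 0" "v \<noteq> 0" using h \<delta> by auto
    define r where "r = k * rho M u"
    define s where "s = k * rho M v"
    have r: "k * \<delta> \<le> r" "r \<le> k / b\<^sup>2 * R"
    proof -
      have "k * \<delta> \<le> k * norm u" using h k by simp
      thus "k * \<delta> \<le> r" using k_rho_bounds(2)[OF nz(1)] by (simp add: r_def)
      have "k / b\<^sup>2 * norm u \<le> k / b\<^sup>2 * R" using h k by (intro mult_left_mono) auto
      thus "r \<le> k / b\<^sup>2 * R" using k_rho_bounds(4)[OF nz(1)] by (simp add: r_def)
    qed
    have s: "k * \<delta> \<le> s"
    proof -
      have "k * \<delta> \<le> k * norm v" using h k by simp
      thus ?thesis using k_rho_bounds(2)[OF nz(2)] by (simp add: s_def)
    qed
    have kd: "k * \<delta> > 0" using k \<delta> by simp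
    have ln1: "\<bar>ln r\<bar> \<le> \<bar>ln (k * \<delta>)\<bar> + \<bar>ln (k / b\<^sup>2 * R)\<bar>"
    proof -
      have "ln (k * \<delta>) \<le> ln r" "ln r \<le> ln (k / b\<^sup>2 * R)" using r kd by (auto intro!: ln_mono)
      thus ?thesis by linarith
    qed
    have ln2: "\<bar>ln x - ln y\<bar> \<le> \<bar>x - y\<bar> / (k * \<delta>)" if "k * \<delta> \<le> x" "k * \<delta> \<le> y" for x y
    proof -
      have "x > 0" "y > 0" using that kd by auto
      hence "ln x - ln y \<le> (x - y) / y" "ln y - ln x \<le> (y - x) / x" by (auto intro: ln_diff_le)
      moreover have "(x - y) / y \<le> \<bar>x - y\<bar> / (k * \<delta>)"  "(y - x) / x \<le> \<bar>x - y\<bar> / (k * \<delta>)"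
        using that kd by (auto intro!: frac_le)
      ultimately show ?thesis by linarith
    qed
    have "\<bar>ln r - ln s\<bar> \<le> k / b\<^sup>2 / (k * \<delta>) * norm (u - v)"
    proof -
      have "\<bar>ln r - ln s\<bar> \<le> \<bar>r - s\<bar> / (k * \<delta>)" by (rule ln2[OF r(1) s])
      also have "\<dots> \<le> (k / b\<^sup>2 * norm (u - v)) / (k * \<delta>)"
        unfolding r_def s_def using kd by (intro divide_right_mono k_rho_lipschitz) auto
      finally show ?thesis by (simp only: times_divide_eq_left)
    qed
    hence "norm (u - v) * (1 + \<bar>ln r\<bar>) + \<bar>ln r - ln s\<bar>
        \<le> norm (u - v) * (1 + (\<bar>ln (k * \<delta>)\<bar> + \<bar>ln (k / b\<^sup>2 * R)\<bar>)) + k / b\<^sup>2 / (k * \<delta>) * norm (u - v)"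
      using ln1 by (intro add_mono mult_left_mono) auto
    also have "\<dots> = B * norm (u - v)" by (simp add: B_def algebra_simps)
    finally have "C * (norm (u - v) * (1 + \<bar>ln r\<bar>) + \<bar>ln r - ln s\<bar>) \<le> C * (B * norm (u - v))"
      using C(1) by (intro mult_left_mono) auto
    thus "cmod (profile u - profile v) \<le> C * B * norm (u - v)"
      using C(2)[OF nz h(2,4)] unfolding r_def s_def by (simp add: mult.assoc)
  qed
qed

text \<open>The difference of logarithms is invariant under scaling, so an increment to the power
  \<open>q\<close> must be balanced by a weight of degree \<open>-q\<close> in the distance to the
  singularity. The remaining terms have spare powers of the increment, and boundedness of the region
  brings them to the same form.\<close>

lemma profile_hoelder:
  assumes q: "0 < q" "q < 1" and R: "R > 0"
  obtains L where "L \<ge> 0"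
    "\<And>u v. \<lbrakk>u \<noteq> 0; v \<noteq> 0; norm u \<le> R; norm v \<le> R\<rbrakk> \<Longrightarrow>
       cmod (profile u - profile v) \<le> L * norm (u - v) powr q * (norm u powr (- q) + norm v powr (- q))"
proof -
  obtain C where C: "C \<ge> 0"
    "\<And>u v. \<lbrakk>u \<noteq> 0; v \<noteq> 0; norm u \<le> R; norm v \<le> R\<rbrakk> \<Longrightarrow>
       cmod (profile u - profile v) \<le> C * (norm (u - v) * (1 + \<bar>ln (k * rho M u)\<bar>)
           + \<bar>ln (k * rho M u) - ln (k * rho M v)\<bar>)"
    using profile_near by blast
  define R' where "R' = k / b\<^sup>2 * R"
  define K where "K = 1 / q + (1 + \<bar>ln R'\<bar>) * (1 + R' powr q)"
  have K0: "K \<ge> 0" using q by (auto simp: K_def)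
  define B where "B = (2 * R) powr (1 - q) * K * k powr (- q) + 2 / q * (k / b\<^sup>2) powr q * k powr (- q)"
  have B0: "B \<ge> 0" unfolding B_def using K0 q by simp
  show ?thesis
  proof (rule that[of "C * B"])
    show "C * B \<ge> 0" using C(1) B0 by simp
    fix u v :: "real \<times> real" assume h: "u \<noteq> 0" "v \<noteq> 0" "norm u \<le> R" "norm v \<le> R"
    define r where "r = k * rho M u"
    define s where "s = k * rho M v"
    define t where "t = norm (u - v)"
    define W where "W = norm u powr (- q) + norm v powr (- q)"
    have t: "0 \<le> t" "t \<le> 2 * R" using norm_triangle_ineq4[of u v] h by (auto simp: t_def)
    have rp: "r > 0" "s > 0" unfolding r_def s_def using k_rho_bounds(3) h by auto
    have rR: "r \<le> R'"
    proof -
      have "k / b\<^sup>2 * norm u \<le> R'" unfolding R'_def using h k by (intro mult_left_mono) auto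
      thus ?thesis using k_rho_bounds(4)[OF h(1)] by (simp add: r_def)
    qed
    have pw: "(k * rho M w) powr (- q) \<le> k powr (- q) * norm w powr (- q)" if "w \<noteq> 0" for w
    proof -
      have "(k * rho M w) powr (- q) \<le> (k * norm w) powr (- q)"
        using k_rho_bounds[OF that] q by (intro powr_mono2') auto
      also have "\<dots> = k powr (- q) * norm w powr (- q)" using k by (simp add: powr_mult)
      finally show ?thesis .
    qed
    have W0: "W \<ge> 0" by (simp add: W_def)
    have rs: "r powr (- q) + s powr (- q) \<le> k powr (- q) * W"
      using pw[OF h(1)] pw[OF h(2)] by (simp add: r_def s_def W_def distrib_left)
    have r1: "r powr (- q) \<le> k powr (- q) * W"
      using pw[OF h(1)] by (simp add: r_def W_def distrib_left add_increasing2)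
    have tt: "t \<le> (2 * R) powr (1 - q) * t powr q" using t q by (intro le_powr_mult_powr) auto
    have p1: "t * (1 + \<bar>ln r\<bar>) \<le> ((2 * R) powr (1 - q) * t powr q) * (K * (k powr (- q) * W))"
    proof (intro mult_mono tt)
      have "1 + \<bar>ln r\<bar> \<le> K * r powr (- q)" unfolding K_def using rp rR q by (intro abs_ln_le_powr) auto
      also have "\<dots> \<le> K * (k powr (- q) * W)" using r1 K0 by (intro mult_left_mono)
      finally show "1 + \<bar>ln r\<bar> \<le> K * (k powr (- q) * W)" .
    qed (auto simp: t)
    have p2: "\<bar>ln r - ln s\<bar> \<le> 2 / q * ((k / b\<^sup>2) powr q * t powr q) * (k powr (- q) * W)"
    proof -
      have "\<bar>r - s\<bar> powr q \<le> (k / b\<^sup>2 * t) powr q"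
        using k_rho_lipschitz[of u v] q unfolding r_def s_def t_def by (intro powr_mono2) auto
      also have "\<dots> = (k / b\<^sup>2) powr q * t powr q" using k t by (intro powr_mult)
      finally have p: "\<bar>r - s\<bar> powr q \<le> (k / b\<^sup>2) powr q * t powr q" .
      have "\<bar>ln r - ln s\<bar> \<le> 2 / q * \<bar>r - s\<bar> powr q * (r powr (- q) + s powr (- q))"
        using rp q by (intro abs_ln_diff_le_powr) auto
      also have "\<dots> \<le> 2 / q * ((k / b\<^sup>2) powr q * t powr q) * (k powr (- q) * W)"
        using p rs q by (intro mult_mono mult_left_mono) auto
      finally show ?thesis .
    qed
    have "cmod (profile u - profile v) \<le> C * (t * (1 + \<bar>ln r\<bar>) + \<bar>ln r - ln s\<bar>)"
      using C(2)[OF h] unfolding r_def s_def t_def .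
    also have "\<dots> \<le> C * (((2 * R) powr (1 - q) * t powr q) * (K * (k powr (- q) * W)) +
        2 / q * ((k / b\<^sup>2) powr q * t powr q) * (k powr (- q) * W))"
      using p1 p2 C(1) by (intro mult_left_mono add_mono)
    also have "\<dots> = C * B * t powr q * W" by (simp add: B_def algebra_simps)
    finally show "cmod (profile u - profile v) \<le> C * B * norm (u - v) powr q * (norm u powr (- q) + norm v powr (- q))"
      unfolding W_def t_def .
  qed
qed

section \<open>Pairs of images of the source\<close>

definition N where "N n = 2 * d * real (Suc n)"
definition \<nu> where "\<nu> n = \<kappa> * N n"
definition lam where "lam P Q n = osc P Q (\<nu> n) / sqrt (\<nu> n)"
definition mode where
  "mode x y = 2 * c0 * cis (- (\<alpha> * (fst x - fst y))) * of_real (cos (\<kappa> * (snd y - snd x)))"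
definition image_pair where
  "image_pair n x y = fund_sol M k x ((0, N n) + y) + fund_sol M k x ((0, - N n) + y)"
definition err where "err P Q n x y = image_pair n x y - lam P Q n * mode x y"

text \<open>The sign \<open>g\<close> selects the image shifted up or down. For a remote image
  \<open>N n + g * (snd y - snd x)\<close> is the exact transversal distance, so only the
  longitudinal offset is neglected in the phase.\<close>

definition image_err where
  "image_err P Q g n x y =
     phase_err P Q (\<nu> n) (k * rho M (x - ((0, g * N n) + y))) (\<kappa> * (N n + g * (snd y - snd x)))"

text \<open>The box is symmetric in both coordinates, so it contains the reflections of its
  points.\<close>

definition in_box where "in_box R x \<longleftrightarrow> \<bar>fst x\<bar> \<le> R \<and> \<bar>snd x\<bar> \<le> d" for x :: "real \<times> real"

lemma N_pos: "N n > 0" using d by (simp add: N_def)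
lemma \<nu>_pos: "\<nu> n > 0" using N_pos \<kappa>_pos by (simp add: \<nu>_def)

text \<open>The Hankel argument at an image is \<kappa> times a hypotenuse whose long leg is the
  transversal distance and whose short leg is bounded by \<open>D\<close>. Thus
  \<open>hypotenuse_excess\<close> supplies the phase errors that \<open>hankel_far\<close> asks
  for, uniformly over the box and in \<open>n\<close>.\<close>

lemma image_far:
  assumes amp: "decaying (\<lambda>r. hankel1_0 r - osc P Q r / sqrt r)" and R: "R > 0"
  obtains C n0 where "C \<ge> 0"
    "\<And>n g x y y'. \<lbrakk>n \<ge> n0; g = 1 \<or> g = -1; in_box R x; in_box R y; in_box R y'\<rbrakk> \<Longrightarrow>
      cmod (image_err P Q g n x y) \<le> C / (\<nu> n * sqrt (\<nu> n)) \<and>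
      cmod (image_err P Q g n x y - image_err P Q g n x y') \<le> C / (\<nu> n * sqrt (\<nu> n)) * norm (y - y')"
proof -
  define D where "D = 2 * R / b"
  define G where "G = (2 * D + 2 * D\<^sup>2) * (1 + 1 / b)"
  have D0: "D \<ge> 0" "G \<ge> 0" using R b(1) by (auto simp: D_def G_def)
  \<comment> \<open>One constant for all hypotheses of \<open>hankel_far\<close>. The first two
    summands bound the size and the variation of the phase error after \<open>N n / 2\<close> has
    been converted to \<open>\<nu> n\<close>; the others bound the distance of the argument from
    \<open>\<nu> n\<close> and the variations of argument and phase.\<close>
  define B where "B = 2 * \<kappa>\<^sup>2 * D\<^sup>2 + 2 * \<kappa>\<^sup>2 * G + \<kappa> + \<kappa> * G + \<kappa> * D\<^sup>2 + 2 * \<kappa> * d"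
  have Bn: "0 \<le> 2 * \<kappa>\<^sup>2 * D\<^sup>2" "0 \<le> 2 * \<kappa>\<^sup>2 * G" "0 \<le> \<kappa>" "0 \<le> \<kappa> * G" "0 \<le> \<kappa> * D\<^sup>2" "0 \<le> 2 * \<kappa> * d"
    using \<kappa>_pos D0 d by auto
  have B0: "B \<ge> 0" using Bn by (simp add: B_def)
  obtain C where C: "C \<ge> 0"
    "\<And>\<nu> r s \<theta> \<phi> t. \<lbrakk>\<nu> \<ge> 2 * B + 2; \<bar>r - \<nu>\<bar> \<le> B; \<bar>s - \<nu>\<bar> \<le> B; \<bar>r - \<theta>\<bar> \<le> B / \<nu>; \<bar>s - \<phi>\<bar> \<le> B / \<nu>;
       \<bar>(r - \<theta>) - (s - \<phi>)\<bar> \<le> B / \<nu> * t; \<bar>r - s\<bar> \<le> B * t; \<bar>\<theta> - \<phi>\<bar> \<le> B * t; t \<ge> 0\<rbrakk> \<Longrightarrow>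
      cmod (phase_err P Q \<nu> r \<theta>) \<le> C / (\<nu> * sqrt \<nu>) \<and>
      cmod (phase_err P Q \<nu> r \<theta> - phase_err P Q \<nu> s \<phi>) \<le> C / (\<nu> * sqrt \<nu>) * t"
    using hankel_far[OF amp B0] by blast
  \<comment> \<open>The entry \<open>4 * d + 2\<close> keeps the long leg above
    \<open>N n / 2\<close>, since it differs from \<open>N n\<close> by at most
    \<open>2 * d\<close>, and keeps \<open>N n / 2\<close> above 1. The other entry gives
    \<open>\<nu> n \<ge> 2 * B + 2\<close>.\<close>
  obtain n0 :: nat where n0: "real n0 > max (4 * d + 2) ((2 * B + 2) / \<kappa>) / (2 * d)"
    using reals_Archimedean2 by blast
  show ?thesis
  proof (rule that[of C n0])
    show "C \<ge> 0" by (rule C(1))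
    fix n and g :: real and x y y' :: "real \<times> real"
    assume n: "n \<ge> n0" and g: "g = 1 \<or> g = -1" and box: "in_box R x" "in_box R y" "in_box R y'"
    have Nn: "N n \<ge> max (4 * d + 2) ((2 * B + 2) / \<kappa>)"
    proof -
      have "max (4 * d + 2) ((2 * B + 2) / \<kappa>) \<le> 2 * d * real n0" using n0 d by (simp add: field_simps)
      also have "\<dots> \<le> N n" unfolding N_def using n d by (intro mult_left_mono) auto
      finally show ?thesis .
    qed
    hence N1: "N n \<ge> 4 * d + 2" "N n / 2 \<ge> 1" using d by auto
    have \<nu>B: "\<nu> n \<ge> 2 * B + 2"
    proof -
      have "(2 * B + 2) / \<kappa> \<le> N n" using Nn by simp
      thus ?thesis using \<kappa>_pos by (simp add: \<nu>_def field_simps)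
    qed
    define a where "a y = N n + g * (snd y - snd x)" for y :: "real \<times> real"
    define c where "c y = (fst x - fst y) / b" for y :: "real \<times> real"
    define r where "r y = k * rho M (x - ((0, g * N n) + y))" for y
    have r_eq: "r y = \<kappa> * sqrt ((a y)\<^sup>2 + (c y)\<^sup>2)" for y
    proof -
      have "(snd (x - ((0, g * N n) + y)))\<^sup>2 = (a y)\<^sup>2"
        using g by (auto simp: a_def power2_eq_square algebra_simps)
      thus ?thesis by (simp add: r_def k_rho_eq c_def)
    qed
    have ab: "\<bar>a y - N n\<bar> \<le> 2 * d" if "in_box R y" for y
      using that box(1) g unfolding a_def in_box_def by auto
    have a: "a y \<ge> N n / 2" if "in_box R y" for y using ab[OF that] N1 by linarith
    have c: "\<bar>c y\<bar> \<le> D" if "in_box R y" for y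
    proof -
      have "\<bar>fst x - fst y\<bar> \<le> 2 * R" using that box(1) unfolding in_box_def by linarith
      thus ?thesis using b(1) unfolding c_def D_def by (simp add: abs_divide divide_right_mono)
    qed
    have ex: "\<bar>r y - \<kappa> * a y\<bar> \<le> \<kappa> * (D\<^sup>2 / (N n / 2))" if "in_box R y" for y
    proof -
      have "\<bar>r y - \<kappa> * a y\<bar> = \<kappa> * \<bar>sqrt ((a y)\<^sup>2 + (c y)\<^sup>2) - a y\<bar>"
        using \<kappa>_pos by (simp add: r_eq right_diff_distrib[symmetric] abs_mult)
      also have "\<dots> \<le> \<kappa> * (D\<^sup>2 / (N n / 2))"
        using hypotenuse_excess(1)[OF N1(2) a[OF that] a[OF that] c[OF that] c[OF that]] \<kappa>_pos
        by (intro mult_left_mono) auto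
      finally show ?thesis .
    qed
    have conv: "\<kappa> * (X / (N n / 2)) = 2 * \<kappa>\<^sup>2 * X / \<nu> n" for X
      using \<kappa>_pos N_pos[of n] by (simp add: \<nu>_def field_simps power2_eq_square)
    have le1: "\<kappa> * (X / (N n / 2)) \<le> \<kappa> * X" if "X \<ge> 0" for X
    proof -
      have "X / (N n / 2) \<le> X / 1" using N1 that by (intro divide_left_mono) auto
      from mult_left_mono[OF this, of \<kappa>] show ?thesis using \<kappa>_pos by simp
    qed
    define t where "t = norm (y - y')"
    have t0: "t \<ge> 0" by (simp add: t_def)
    have ta: "\<bar>a y - a y'\<bar> \<le> t"
    proof -
      have "\<bar>a y - a y'\<bar> = \<bar>snd (y - y')\<bar>" using g by (auto simp: a_def)
      thus ?thesis using abs_snd_le_norm[of "y - y'"] by (simp add: t_def)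
    qed
    have tc: "\<bar>c y - c y'\<bar> \<le> t / b"
    proof -
      have "c y - c y' = - fst (y - y') / b" by (simp add: c_def diff_divide_distrib)
      hence "\<bar>c y - c y'\<bar> = \<bar>fst (y - y')\<bar> / b" using b(1) by (simp add: abs_divide)
      thus ?thesis using abs_fst_le_norm[of "y - y'"] b(1) by (simp add: t_def divide_right_mono)
    qed
    have ex2: "\<bar>(r y - \<kappa> * a y) - (r y' - \<kappa> * a y')\<bar> \<le> \<kappa> * (G * t / (N n / 2))"
    proof -
      have "(r y - \<kappa> * a y) - (r y' - \<kappa> * a y') = \<kappa> * ((sqrt ((a y)\<^sup>2 + (c y)\<^sup>2) - a y) - (sqrt ((a y')\<^sup>2 + (c y')\<^sup>2) - a y'))"
        by (simp add: r_eq algebra_simps)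
      hence "\<bar>(r y - \<kappa> * a y) - (r y' - \<kappa> * a y')\<bar> = \<kappa> * \<bar>(sqrt ((a y)\<^sup>2 + (c y)\<^sup>2) - a y) - (sqrt ((a y')\<^sup>2 + (c y')\<^sup>2) - a y')\<bar>"
        using \<kappa>_pos by (simp add: abs_mult)
      also have "\<dots> \<le> \<kappa> * ((2 * D + 2 * D\<^sup>2) / (N n / 2) * (\<bar>a y - a y'\<bar> + \<bar>c y - c y'\<bar>))"
        using hypotenuse_excess(2)[OF N1(2) a[OF box(2)] a[OF box(3)] c[OF box(2)] c[OF box(3)]] \<kappa>_pos
        by (intro mult_left_mono) auto
      also have "\<dots> \<le> \<kappa> * ((2 * D + 2 * D\<^sup>2) / (N n / 2) * (t + t / b))"
        using ta tc \<kappa>_pos D0 N_pos[of n] by (intro mult_left_mono add_mono) auto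
      also have "\<dots> = \<kappa> * (G * t / (N n / 2))" by (simp add: G_def algebra_simps)
      finally show ?thesis .
    qed
    have h4: "\<bar>r y - \<kappa> * a y\<bar> \<le> B / \<nu> n" if "in_box R y" for y
    proof -
      have "2 * \<kappa>\<^sup>2 * D\<^sup>2 / \<nu> n \<le> B / \<nu> n"
        using \<nu>_pos[of n] Bn by (intro divide_right_mono) (auto simp: B_def)
      thus ?thesis using ex[OF that] unfolding conv by linarith
    qed
    have h2: "\<bar>r y - \<nu> n\<bar> \<le> B" if "in_box R y" for y
    proof -
      have "\<bar>\<kappa> * a y - \<nu> n\<bar> = \<kappa> * \<bar>a y - N n\<bar>"
        using \<kappa>_pos by (simp add: \<nu>_def right_diff_distrib[symmetric] abs_mult)
      also have "\<dots> \<le> \<kappa> * (2 * d)" using ab[OF that] \<kappa>_pos by (intro mult_left_mono) auto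
      finally have "\<bar>\<kappa> * a y - \<nu> n\<bar> \<le> 2 * \<kappa> * d" by simp
      moreover have "\<bar>r y - \<kappa> * a y\<bar> \<le> \<kappa> * D\<^sup>2" using ex[OF that] le1[of "D\<^sup>2"] by simp
      ultimately show ?thesis using Bn unfolding B_def by linarith
    qed
    have h8: "\<bar>\<kappa> * a y - \<kappa> * a y'\<bar> \<le> \<kappa> * t"
      using ta \<kappa>_pos by (simp add: right_diff_distrib[symmetric] abs_mult)
    have "\<bar>r y - r y'\<bar> \<le> (\<kappa> * G + \<kappa>) * t"
      using ex2 h8 le1[of "G * t"] D0 t0 by (simp add: algebra_simps)
    also have "\<dots> \<le> B * t" using Bn t0 unfolding B_def by (intro mult_right_mono) auto
    finally have h7: "\<bar>r y - r y'\<bar> \<le> B * t" .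
    have h8': "\<bar>\<kappa> * a y - \<kappa> * a y'\<bar> \<le> B * t"
      by (rule order.trans[OF h8]) (use Bn t0 in \<open>auto simp: B_def intro!: mult_right_mono\<close>)
    have h6: "\<bar>(r y - \<kappa> * a y) - (r y' - \<kappa> * a y')\<bar> \<le> B / \<nu> n * t"
    proof -
      have "2 * \<kappa>\<^sup>2 * (G * t) / \<nu> n = 2 * \<kappa>\<^sup>2 * G / \<nu> n * t" by simp
      also have "\<dots> \<le> B / \<nu> n * t"
        using \<nu>_pos[of n] Bn t0 by (intro mult_right_mono divide_right_mono) (auto simp: B_def)
      finally show ?thesis using ex2 unfolding conv by linarith
    qed
    from C(2)[OF \<nu>B h2[OF box(2)] h2[OF box(3)] h4[OF box(2)] h4[OF box(3)] h6 h7 h8' t0]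
    show "cmod (image_err P Q g n x y) \<le> C / (\<nu> n * sqrt (\<nu> n)) \<and>
      cmod (image_err P Q g n x y - image_err P Q g n x y') \<le> C / (\<nu> n * sqrt (\<nu> n)) * norm (y - y')"
      unfolding r_def a_def t_def image_err_def .
  qed
qed

lemma norm_le_abs_fst_abs_snd: "norm w \<le> \<bar>fst w\<bar> + \<bar>snd w\<bar>" for w :: "real \<times> real"
  using norm_Pair_le[of "fst w" "snd w"] by simp

lemma phase_lipschitz:
  fixes y y' :: "real \<times> real"
  shows "cmod (cis (- (\<alpha> * (a - fst y))) - cis (- (\<alpha> * (a - fst y')))) \<le> 2 * \<alpha> * norm (y - y')"
proof -
  have "cmod (cis (- (\<alpha> * (a - fst y))) - cis (- (\<alpha> * (a - fst y'))))
      \<le> 2 * \<bar>- (\<alpha> * (a - fst y)) - - (\<alpha> * (a - fst y'))\<bar>" by (rule cmod_cis_diff_le)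
  also have "- (\<alpha> * (a - fst y)) - - (\<alpha> * (a - fst y')) = \<alpha> * fst (y - y')" by (simp add: algebra_simps)
  also have "2 * \<bar>\<alpha> * fst (y - y')\<bar> = 2 * \<alpha> * \<bar>fst (y - y')\<bar>" using \<alpha>_nonneg by (simp add: abs_mult)
  also have "\<dots> \<le> 2 * \<alpha> * norm (y - y')"
    using \<alpha>_nonneg by (intro mult_left_mono abs_fst_le_norm) auto
  finally show ?thesis .
qed

lemma phase_mult_lipschitz:
  fixes F :: "real \<times> real \<Rightarrow> complex"
  assumes "cmod (F y) \<le> B" "cmod (F y - F y') \<le> L * norm (y - y')"
  shows "cmod (cis (- (\<alpha> * (a - fst y))) * F y - cis (- (\<alpha> * (a - fst y'))) * F y')
    \<le> (2 * \<alpha> * B + L) * norm (y - y')"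
proof -
  have "cis (- (\<alpha> * (a - fst y))) * F y - cis (- (\<alpha> * (a - fst y'))) * F y'
     = (cis (- (\<alpha> * (a - fst y))) - cis (- (\<alpha> * (a - fst y')))) * F y + cis (- (\<alpha> * (a - fst y'))) * (F y - F y')"
    by (simp add: algebra_simps)
  also have "cmod \<dots> \<le> cmod (cis (- (\<alpha> * (a - fst y))) - cis (- (\<alpha> * (a - fst y')))) * cmod (F y) + cmod (F y - F y')"
    by (rule order.trans[OF norm_triangle_ineq]) (simp add: norm_mult)
  also have "\<dots> \<le> (2 * \<alpha> * norm (y - y')) * B + L * norm (y - y')"
    using assms phase_lipschitz[of a y y'] \<alpha>_nonneg by (intro add_mono mult_mono) auto
  finally show ?thesis by (simp add: algebra_simps)
qed

lemma mode_lipschitz: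
  obtains L where "L \<ge> 0" "\<And>x y y'. cmod (mode x y - mode x y') \<le> L * norm (y - y')"
proof (rule that[of "2 * cmod c0 * (2 * \<alpha> * 1 + \<kappa>)"])
  show "0 \<le> 2 * cmod c0 * (2 * \<alpha> * 1 + \<kappa>)" using \<alpha>_nonneg \<kappa>_pos by simp
  fix x y y' :: "real \<times> real"
  define F where "F y = complex_of_real (cos (\<kappa> * (snd y - snd x)))" for y :: "real \<times> real"
  have "cmod (F y - F y') \<le> \<kappa> * norm (y - y')"
  proof -
    have "cmod (F y - F y') = \<bar>cos (\<kappa> * (snd y - snd x)) - cos (\<kappa> * (snd y' - snd x))\<bar>"
      unfolding F_def by (metis norm_of_real of_real_diff)
    also have "\<dots> \<le> \<bar>\<kappa> * (snd y - snd x) - \<kappa> * (snd y' - snd x)\<bar>" by (rule abs_cos_diff_le)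
    also have "\<kappa> * (snd y - snd x) - \<kappa> * (snd y' - snd x) = \<kappa> * snd (y - y')" by (simp add: algebra_simps)
    also have "\<bar>\<kappa> * snd (y - y')\<bar> = \<kappa> * \<bar>snd (y - y')\<bar>" using \<kappa>_pos by (simp add: abs_mult)
    also have "\<dots> \<le> \<kappa> * norm (y - y')" using \<kappa>_pos by (intro mult_left_mono abs_snd_le_norm) auto
    finally show ?thesis .
  qed
  hence *: "cmod (cis (- (\<alpha> * (fst x - fst y))) * F y - cis (- (\<alpha> * (fst x - fst y'))) * F y')
      \<le> (2 * \<alpha> * 1 + \<kappa>) * norm (y - y')"
    by (intro phase_mult_lipschitz) (auto simp: F_def)
  have "mode x y - mode x y' = 2 * c0 * (cis (- (\<alpha> * (fst x - fst y))) * F y - cis (- (\<alpha> * (fst x - fst y'))) * F y')"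
    unfolding mode_def F_def by (simp add: algebra_simps)
  also have "cmod \<dots> \<le> 2 * cmod c0 * ((2 * \<alpha> * 1 + \<kappa>) * norm (y - y'))"
    using * by (simp add: norm_mult mult_left_mono)
  finally show "cmod (mode x y - mode x y') \<le> 2 * cmod c0 * (2 * \<alpha> * 1 + \<kappa>) * norm (y - y')"
    by (simp add: mult.assoc)
qed

lemma fund_sol_image:
  "fund_sol M k x ((0, m) + y) =
     c0 * (cis (- (\<alpha> * (fst x - fst y))) * hankel1_0 (k * rho M (x - ((0, m) + y))))"
  by (simp add: fund_sol_eq profile_def)

text \<open>By the addition theorem the leading terms of the two images sum exactly to
  \<open>lam P Q n * mode x y\<close>. The phase factor is the same for both, as the shift is purely
  transversal, and the error of a pair is therefore the sum of two image errors.\<close>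

lemma err_eq:
  "err P Q n x y = c0 * (cis (- (\<alpha> * (fst x - fst y))) *
     (image_err P Q 1 n x y + image_err P Q (-1) n x y))"
proof -
  define s where "s = \<kappa> * (snd y - snd x)"
  have 1: "\<kappa> * (N n + 1 * (snd y - snd x)) = \<nu> n + s" "\<kappa> * (N n + (-1) * (snd y - snd x)) = \<nu> n - s"
    by (simp_all add: \<nu>_def s_def algebra_simps)
  have 2: "osc P Q (\<nu> n + s) / sqrt (\<nu> n) + osc P Q (\<nu> n - s) / sqrt (\<nu> n) = 2 * of_real (cos s) * lam P Q n"
    unfolding lam_def add_divide_distrib[symmetric] osc_add_osc_diff by simp
  have "lam P Q n * mode x y = c0 * (cis (- (\<alpha> * (fst x - fst y))) * (2 * of_real (cos s) * lam P Q n))"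
    by (simp add: mode_def s_def)
  thus ?thesis unfolding image_err_def phase_err_def 1 err_def image_pair_def fund_sol_image 2[symmetric] by (simp add: algebra_simps)
qed

lemma err_far:
  assumes amp: "decaying (\<lambda>r. hankel1_0 r - osc P Q r / sqrt r)" and R: "R > 0"
  obtains C n0 where "C \<ge> 0"
    "\<And>n x y y'. \<lbrakk>n \<ge> n0; in_box R x; in_box R y; in_box R y'\<rbrakk> \<Longrightarrow>
      cmod (err P Q n x y) \<le> C / (\<nu> n * sqrt (\<nu> n)) \<and>
      cmod (err P Q n x y - err P Q n x y') \<le> C / (\<nu> n * sqrt (\<nu> n)) * norm (y - y')"
proof -
  obtain C n0 where C: "C \<ge> 0"
    "\<And>n g x y y'. \<lbrakk>n \<ge> n0; g = 1 \<or> g = -1; in_box R x; in_box R y; in_box R y'\<rbrakk> \<Longrightarrow>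
      cmod (image_err P Q g n x y) \<le> C / (\<nu> n * sqrt (\<nu> n)) \<and>
      cmod (image_err P Q g n x y - image_err P Q g n x y') \<le> C / (\<nu> n * sqrt (\<nu> n)) * norm (y - y')"
    using image_far[OF amp R] by blast
  define C' where "C' = cmod c0 * (2 * C) + cmod c0 * (2 * \<alpha> * (2 * C) + 2 * C)"
  show ?thesis
  proof (rule that[of C' n0])
    show "C' \<ge> 0" using C(1) \<alpha>_nonneg by (simp add: C'_def)
    fix n and x y y' :: "real \<times> real"
    assume h: "n \<ge> n0" "in_box R x" "in_box R y" "in_box R y'"
    define z where "z = 1 / (\<nu> n * sqrt (\<nu> n))"
    have z0: "z \<ge> 0" using \<nu>_pos[of n] by (simp add: z_def)
    define A where "A g y = image_err P Q g n x y" for g y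
    have A1: "cmod (A g y) \<le> C * z" "cmod (A g y - A g y') \<le> C * z * norm (y - y')" if "g = 1 \<or> g = -1" for g
      using C(2)[OF h(1) that h(2,3,4)] by (auto simp: A_def z_def)
    define F where "F y = A 1 y + A (-1) y" for y
    have F1: "cmod (F y) \<le> 2 * C * z"
      unfolding F_def using A1(1)[of 1] A1(1)[of "-1"] norm_triangle_ineq[of "A 1 y" "A (-1) y"] by simp
    have F2: "cmod (F y - F y') \<le> (2 * C * z) * norm (y - y')"
    proof -
      have "F y - F y' = (A 1 y - A 1 y') + (A (-1) y - A (-1) y')" by (simp add: F_def)
      also have "cmod \<dots> \<le> C * z * norm (y - y') + C * z * norm (y - y')"
        by (intro order.trans[OF norm_triangle_ineq] add_mono A1(2)) auto
      finally show ?thesis by simp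
    qed
    have eq: "err P Q n x y = c0 * (cis (- (\<alpha> * (fst x - fst y))) * F y)" for y
      unfolding F_def A_def by (rule err_eq)
    have "cmod (err P Q n x y) = cmod c0 * cmod (F y)" unfolding eq by (simp add: norm_mult)
    also have "\<dots> \<le> cmod c0 * (2 * C * z)" using F1 by (intro mult_left_mono) auto
    also have "\<dots> = cmod c0 * (2 * C) * z" by simp
    also have "\<dots> \<le> C' * z" unfolding C'_def using C(1) \<alpha>_nonneg z0 by (intro mult_right_mono) auto
    finally have 1: "cmod (err P Q n x y) \<le> C' * z" .
    have "err P Q n x y - err P Q n x y' =
        c0 * (cis (- (\<alpha> * (fst x - fst y))) * F y - cis (- (\<alpha> * (fst x - fst y'))) * F y')"
      unfolding eq by (simp add: algebra_simps)
    also have "cmod \<dots> \<le> cmod c0 * ((2 * \<alpha> * (2 * C * z) + 2 * C * z) * norm (y - y'))"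
      unfolding norm_mult[of c0] by (intro mult_left_mono phase_mult_lipschitz F1 F2) auto
    also have "\<dots> = cmod c0 * (2 * \<alpha> * (2 * C) + 2 * C) * z * norm (y - y')" by (simp add: algebra_simps)
    also have "\<dots> \<le> C' * z * norm (y - y')"
      unfolding C'_def using C(1) z0 by (intro mult_right_mono) auto
    finally have 2: "cmod (err P Q n x y - err P Q n x y') \<le> C' * z * norm (y - y')" .
    from 1 2 show "cmod (err P Q n x y) \<le> C' / (\<nu> n * sqrt (\<nu> n)) \<and>
      cmod (err P Q n x y - err P Q n x y') \<le> C' / (\<nu> n * sqrt (\<nu> n)) * norm (y - y')"
      by (simp add: z_def)
  qed
qed

lemma summable_\<nu>: "summable (\<lambda>n. 1 / (\<nu> n * sqrt (\<nu> n)))"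
proof -
  have "summable (\<lambda>n. real n powr (-3 / 2))" by (simp add: summable_real_powr_iff)
  hence "summable (\<lambda>n. real (Suc n) powr (-3 / 2))" by (subst summable_Suc_iff)
  hence "summable (\<lambda>n. 1 / (2 * d * \<kappa> * sqrt (2 * d * \<kappa>)) * real (Suc n) powr (-3 / 2))"
    by (rule summable_mult)
  moreover have "1 / (2 * d * \<kappa> * sqrt (2 * d * \<kappa>)) * real (Suc n) powr (-3 / 2) = 1 / (\<nu> n * sqrt (\<nu> n))" for n
  proof -
    have "real (Suc n) powr (-3 / 2) = real (Suc n) powr (- 1) * real (Suc n) powr (- (1 / 2))"
      by (simp only: powr_add[symmetric]) simp
    also have "\<dots> = 1 / (real (Suc n) * sqrt (real (Suc n)))"
      by (simp add: powr_minus powr_half_sqrt field_simps)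
    finally have 1: "real (Suc n) powr (-3 / 2) = 1 / (real (Suc n) * sqrt (real (Suc n)))" .
    have 2: "\<nu> n = (2 * d * \<kappa>) * real (Suc n)" by (simp add: \<nu>_def N_def)
    show ?thesis unfolding 1 2 real_sqrt_mult[of _ "real (Suc n)"] by (simp only: times_divide_times_eq mult_1_left ac_simps)
  qed
  ultimately show ?thesis by (simp only:)
qed

text \<open>Images are shifted by at least \<open>2 * d\<close>, while
  \<open>|snd x| \<le> d\<close> and \<open>|snd y| \<le> d - \<delta>\<close>. So even the first
  images stay at distance \<delta> from \<open>x\<close>, where the profile is Lipschitz. The
  constant may depend on \<open>n\<close>.\<close>

lemma err_lipschitz_each:
  assumes \<delta>: "\<delta> > 0" and R: "R > 0"
  obtains L where "L \<ge> 0"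
    "\<And>x y y'. \<lbrakk>in_box R x; in_box R y; in_box R y'; \<bar>snd y\<bar> \<le> d - \<delta>; \<bar>snd y'\<bar> \<le> d - \<delta>\<rbrakk> \<Longrightarrow>
      cmod (err P Q n x y - err P Q n x y') \<le> L * norm (y - y')"
proof -
  obtain Lp where Lp: "Lp \<ge> 0"
    "\<And>u v. \<lbrakk>\<delta> \<le> norm u; norm u \<le> 2 * R + N n + 2 * d; \<delta> \<le> norm v; norm v \<le> 2 * R + N n + 2 * d\<rbrakk> \<Longrightarrow>
       cmod (profile u - profile v) \<le> Lp * norm (u - v)"
    using profile_lipschitz_away[OF \<delta>] by blast
  obtain Lm where Lm: "Lm \<ge> 0" "\<And>x y y'. cmod (mode x y - mode x y') \<le> Lm * norm (y - y')"
    using mode_lipschitz by blast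
  define L where "L = cmod c0 * Lp + cmod c0 * Lp + cmod (lam P Q n) * Lm"
  show ?thesis
  proof (rule that[of L])
    show "L \<ge> 0" using Lp(1) Lm(1) by (simp add: L_def)
    fix x y y' :: "real \<times> real"
    assume h: "in_box R x" "in_box R y" "in_box R y'" "\<bar>snd y\<bar> \<le> d - \<delta>" "\<bar>snd y'\<bar> \<le> d - \<delta>"
    have N2: "N n \<ge> 2 * d" unfolding N_def using d by simp
    have u: "\<delta> \<le> norm (x - ((0, m) + y))" "norm (x - ((0, m) + y)) \<le> 2 * R + N n + 2 * d"
      if "\<bar>m\<bar> = N n" "in_box R y" "\<bar>snd y\<bar> \<le> d - \<delta>" for m y
    proof -
      have "\<delta> \<le> \<bar>snd (x - ((0, m) + y))\<bar>" using h(1) that N2 unfolding in_box_def snd_diff snd_add snd_conv by linarith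
      also have "\<dots> \<le> norm (x - ((0, m) + y))" by (rule abs_snd_le_norm)
      finally show "\<delta> \<le> norm (x - ((0, m) + y))" .
      have "norm (x - ((0, m) + y)) \<le> \<bar>fst (x - ((0, m) + y))\<bar> + \<bar>snd (x - ((0, m) + y))\<bar>"
        by (rule norm_le_abs_fst_abs_snd)
      also have "\<dots> \<le> 2 * R + N n + 2 * d" using h(1) that unfolding in_box_def snd_diff snd_add snd_conv fst_diff fst_add fst_conv by linarith
      finally show "norm (x - ((0, m) + y)) \<le> 2 * R + N n + 2 * d" .
    qed
    have f: "cmod (fund_sol M k x ((0, m) + y) - fund_sol M k x ((0, m) + y')) \<le> cmod c0 * Lp * norm (y - y')"
      if "\<bar>m\<bar> = N n" for m
    proof -
      have "fund_sol M k x ((0, m) + y) - fund_sol M k x ((0, m) + y')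
         = c0 * (profile (x - ((0, m) + y)) - profile (x - ((0, m) + y')))"
        by (simp add: fund_sol_eq right_diff_distrib)
      hence "cmod (fund_sol M k x ((0, m) + y) - fund_sol M k x ((0, m) + y'))
         \<le> cmod c0 * (Lp * norm ((x - ((0, m) + y)) - (x - ((0, m) + y'))))"
        using Lp(2)[OF u[OF that h(2,4)] u[OF that h(3,5)]] by (simp add: norm_mult mult_left_mono)
      also have "norm ((x - ((0, m) + y)) - (x - ((0, m) + y'))) = norm (y - y')"
        by (subst norm_minus_commute) (simp add: algebra_simps)
      finally show ?thesis by (simp add: mult.assoc)
    qed
    have tri: "cmod (a + b - c) \<le> A + B + D" if "cmod a \<le> A" "cmod b \<le> B" "cmod c \<le> D" for a b c A B D
      using norm_triangle_ineq4[of "a + b" c] norm_triangle_ineq[of a b] that by linarith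
    have "err P Q n x y - err P Q n x y' =
        (fund_sol M k x ((0, N n) + y) - fund_sol M k x ((0, N n) + y'))
      + (fund_sol M k x ((0, - N n) + y) - fund_sol M k x ((0, - N n) + y'))
      - lam P Q n * (mode x y - mode x y')"
      by (simp add: err_def image_pair_def algebra_simps)
    also have "cmod \<dots> \<le> cmod c0 * Lp * norm (y - y') + cmod c0 * Lp * norm (y - y') + cmod (lam P Q n) * (Lm * norm (y - y'))"
    proof (rule tri)
      show "cmod (lam P Q n * (mode x y - mode x y')) \<le> cmod (lam P Q n) * (Lm * norm (y - y'))"
        unfolding norm_mult by (intro mult_left_mono Lm) auto
    qed (use f[of "N n"] f[of "- N n"] N_pos[of n] in auto)
    also have "\<dots> = L * norm (y - y')" by (simp add: L_def algebra_simps)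
    finally show "cmod (err P Q n x y - err P Q n x y') \<le> L * norm (y - y')" .
  qed
qed

lemma err_series:
  assumes amp: "decaying (\<lambda>r. hankel1_0 r - osc P Q r / sqrt r)" and \<delta>: "\<delta> > 0" and R: "R > 0"
  obtains L where "L \<ge> 0"
    "\<And>x y. \<lbrakk>in_box R x; in_box R y\<rbrakk> \<Longrightarrow> summable (\<lambda>n. err P Q n x y)"
    "\<And>x y y'. \<lbrakk>in_box R x; in_box R y; in_box R y'; \<bar>snd y\<bar> \<le> d - \<delta>; \<bar>snd y'\<bar> \<le> d - \<delta>\<rbrakk> \<Longrightarrow>
      cmod ((\<Sum>n. err P Q n x y) - (\<Sum>n. err P Q n x y')) \<le> L * norm (y - y')"
proof -
  obtain C n0 where C: "C \<ge> 0"
    "\<And>n x y y'. \<lbrakk>n \<ge> n0; in_box R x; in_box R y; in_box R y'\<rbrakk> \<Longrightarrow>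
      cmod (err P Q n x y) \<le> C / (\<nu> n * sqrt (\<nu> n)) \<and>
      cmod (err P Q n x y - err P Q n x y') \<le> C / (\<nu> n * sqrt (\<nu> n)) * norm (y - y')"
    using err_far[OF amp R] by blast
  have "\<forall>n. \<exists>L\<ge>0. \<forall>x y y'. in_box R x \<longrightarrow> in_box R y \<longrightarrow> in_box R y' \<longrightarrow> \<bar>snd y\<bar> \<le> d - \<delta> \<longrightarrow> \<bar>snd y'\<bar> \<le> d - \<delta> \<longrightarrow>
      cmod (err P Q n x y - err P Q n x y') \<le> L * norm (y - y')"
    by (meson err_lipschitz_each[OF \<delta> R])
  then obtain L1 where L1: "\<And>n. L1 n \<ge> 0"
    "\<And>n x y y'. \<lbrakk>in_box R x; in_box R y; in_box R y'; \<bar>snd y\<bar> \<le> d - \<delta>; \<bar>snd y'\<bar> \<le> d - \<delta>\<rbrakk> \<Longrightarrow>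
      cmod (err P Q n x y - err P Q n x y') \<le> L1 n * norm (y - y')"
    by metis
  have sC: "summable (\<lambda>n. C / (\<nu> n * sqrt (\<nu> n)))" using summable_mult[OF summable_\<nu>, of C] by simp
  \<comment> \<open>Below \<open>n0\<close> only the individual constants are available. As they are
    finitely many, summability rests on the tail of order \<open>n^(-3/2)\<close>.\<close>
  define L2 where "L2 n = (if n < n0 then L1 n else C / (\<nu> n * sqrt (\<nu> n)))" for n
  have L2_nonneg: "L2 n \<ge> 0" for n using L1(1) C(1) \<nu>_pos[of n] by (simp add: L2_def)
  have sL2: "summable L2"
  proof -
    have "eventually (\<lambda>n. L2 n = C / (\<nu> n * sqrt (\<nu> n))) sequentially"
      unfolding eventually_sequentially L2_def by (intro exI[of _ n0]) auto
    from summable_cong[OF this] show ?thesis using sC by simp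
  qed
  have lip: "cmod (err P Q n x y - err P Q n x y') \<le> L2 n * norm (y - y')"
    if "in_box R x" "in_box R y" "in_box R y'" "\<bar>snd y\<bar> \<le> d - \<delta>" "\<bar>snd y'\<bar> \<le> d - \<delta>" for n x y y'
    using L1(2)[OF that, of n] C(2)[of n x y y'] that by (auto simp: L2_def)
  have sE: "summable (\<lambda>n. err P Q n x y)" if "in_box R x" "in_box R y" for x y
    by (rule summable_comparison_test'[OF sC, of n0]) (use C(2)[of _ x y y] that in auto)
  show ?thesis
  proof (rule that[of "suminf L2"])
    show "suminf L2 \<ge> 0" using sL2 L2_nonneg by (rule suminf_nonneg)
    show "summable (\<lambda>n. err P Q n x y)" if "in_box R x" "in_box R y" for x y using sE[OF that] .
    fix x y y' :: "real \<times> real"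
    assume h: "in_box R x" "in_box R y" "in_box R y'" "\<bar>snd y\<bar> \<le> d - \<delta>" "\<bar>snd y'\<bar> \<le> d - \<delta>"
    have s1: "summable (\<lambda>n. L2 n * norm (y - y'))" using sL2 by (rule summable_mult2)
    have s2: "summable (\<lambda>n. cmod (err P Q n x y - err P Q n x y'))"
      by (rule summable_comparison_test'[OF s1, of 0]) (use lip[OF h] in simp)
    have "(\<Sum>n. err P Q n x y) - (\<Sum>n. err P Q n x y') = (\<Sum>n. err P Q n x y - err P Q n x y')"
      using sE h by (intro suminf_diff) auto
    also have "cmod \<dots> \<le> (\<Sum>n. cmod (err P Q n x y - err P Q n x y'))" by (rule summable_norm[OF s2])
    also have "\<dots> \<le> (\<Sum>n. L2 n * norm (y - y'))" using s1 s2 lip[OF h] by (intro suminf_le) auto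
    also have "\<dots> = suminf L2 * norm (y - y')" by (rule suminf_mult2[OF sL2, symmetric])
    finally show "cmod ((\<Sum>n. err P Q n x y) - (\<Sum>n. err P Q n x y')) \<le> suminf L2 * norm (y - y')" .
  qed
qed

section \<open>The full image series\<close>

definition image_sum where
  "image_sum \<sigma> x y = (\<Sum>n. image_pair n x (\<sigma> y) + image_pair n x y)"

lemma duct_green_eq:
  "duct_green \<sigma> d M k x y = c0 * profile (x - y) + c0 * profile (x - \<sigma> y) + image_sum \<sigma> x y"
  unfolding duct_green_def image_sum_def fund_sol_eq[symmetric] image_pair_def N_def Let_def
  by (simp add: algebra_simps)

text \<open>After a common phase has been removed, the real part is \<open>2 cos (\<alpha>
  y\<^sub>1) cos (\<kappa> x\<^sub>2) cos (\<kappa> y\<^sub>2)\<close> for both reflections,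
  although the imaginary parts differ. It is therefore the real part that is shown to be
  nonzero.\<close>

lemma mode_sum_nonzero:
  assumes \<sigma>: "\<sigma> = mirror \<or> \<sigma> = uminus"
    and cos: "cos (\<kappa> * snd x) \<noteq> 0" "cos (\<kappa> * snd y) \<noteq> 0" "cos (\<alpha> * fst y) \<noteq> 0"
  shows "mode x (\<sigma> y) + mode x y \<noteq> 0"
proof -
  define w where "w = cis (\<alpha> * fst (\<sigma> y)) * of_real (cos (\<kappa> * (snd (\<sigma> y) - snd x)))
     + cis (\<alpha> * fst y) * of_real (cos (\<kappa> * (snd y - snd x)))"
  have ph: "cis (- (\<alpha> * (fst x - a))) = cis (- (\<alpha> * fst x)) * cis (\<alpha> * a)" for a
    by (simp add: cis_mult algebra_simps)
  have "mode x (\<sigma> y) + mode x y = 2 * c0 * cis (- (\<alpha> * fst x)) * w"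
    unfolding mode_def ph w_def by (simp add: algebra_simps)
  moreover have "Re w = 2 * (cos (\<alpha> * fst y) * cos (\<kappa> * snd x) * cos (\<kappa> * snd y))"
    using \<sigma>
  proof
    assume "\<sigma> = mirror"
    thus ?thesis by (simp add: w_def mirror_def right_diff_distrib cos_diff algebra_simps)
  next
    assume "\<sigma> = uminus"
    thus ?thesis by (simp add: w_def right_diff_distrib cos_diff algebra_simps)
  qed
  hence "w \<noteq> 0" using cos by auto
  moreover have "c0 \<noteq> 0" using b(1) by (simp add: c0_def)
  ultimately show ?thesis by simp
qed

text \<open>The points left out lie on countably many horizontal and vertical lines, a null set. Off
  these lines the coefficient of the scalar series cannot vanish.\<close>

definition generic where
  "generic y \<longleftrightarrow> cos (\<kappa> * snd y) \<noteq> 0 \<and> cos (\<alpha> * fst y) \<noteq> 0" for y :: "real \<times> real"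

lemma norm_reflection_diff:
  assumes "\<sigma> = mirror \<or> \<sigma> = uminus"
  shows "norm (\<sigma> y - \<sigma> z) = norm (y - z)"
  using assms by (auto simp: mirror_def norm_prod_def fst_diff snd_diff power2_commute norm_minus_commute)

lemma snd_reflection: "\<sigma> = mirror \<or> \<sigma> = uminus \<Longrightarrow> snd (\<sigma> y) = - snd y"
  by (auto simp: mirror_def)

lemma abs_fst_reflection: "\<sigma> = mirror \<or> \<sigma> = uminus \<Longrightarrow> \<bar>fst (\<sigma> y)\<bar> = \<bar>fst y\<bar>"
  by (auto simp: mirror_def)

lemma in_box_reflection: "\<sigma> = mirror \<or> \<sigma> = uminus \<Longrightarrow> in_box R (\<sigma> y) \<longleftrightarrow> in_box R y"
  by (simp add: in_box_def snd_reflection abs_fst_reflection)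

text \<open>At a cut-off frequency the leading parts of the image terms add up to a multiple of
  \<open>\<Sum>n. 1 / sqrt n\<close>, and \<open>suminf\<close> takes its junk value wherever the coefficient is not zero.  This
  value does not depend on the point, so it drops out of the differences.\<close>

lemma image_sum_lipschitz:
  assumes \<sigma>: "\<sigma> = mirror \<or> \<sigma> = uminus" and \<delta>: "\<delta> > 0" and R: "R > 0"
  obtains L where "L \<ge> 0"
    "\<And>x y z. \<lbrakk>in_box R x; in_box R y; in_box R z; \<bar>snd y\<bar> \<le> d - \<delta>; \<bar>snd z\<bar> \<le> d - \<delta>;
        generic x; generic y; generic z\<rbrakk> \<Longrightarrow>
      cmod (image_sum \<sigma> x y - image_sum \<sigma> x z) \<le> L * norm (y - z)"
proof -
  obtain P Q where amp: "decaying (\<lambda>r. hankel1_0 r - osc P Q r / sqrt r)"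
    using hankel_asymptotics by blast
  obtain L where L: "L \<ge> 0"
    "\<And>x y. \<lbrakk>in_box R x; in_box R y\<rbrakk> \<Longrightarrow> summable (\<lambda>n. err P Q n x y)"
    "\<And>x y y'. \<lbrakk>in_box R x; in_box R y; in_box R y'; \<bar>snd y\<bar> \<le> d - \<delta>; \<bar>snd y'\<bar> \<le> d - \<delta>\<rbrakk> \<Longrightarrow>
      cmod ((\<Sum>n. err P Q n x y) - (\<Sum>n. err P Q n x y')) \<le> L * norm (y - y')"
    using err_series[OF amp \<delta> R] by blast
  obtain Lm where Lm: "Lm \<ge> 0" "\<And>x y y'. cmod (mode x y - mode x y') \<le> Lm * norm (y - y')"
    using mode_lipschitz by blast
  define T where "T x y = mode x (\<sigma> y) + mode x y" for x y
  define E where "E n x y = err P Q n x (\<sigma> y) + err P Q n x y" for n x y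
  have terms: "image_pair n x (\<sigma> y) + image_pair n x y = lam P Q n * T x y + E n x y" for n x y
    by (simp add: err_def T_def E_def algebra_simps)
  have sE: "summable (\<lambda>n. E n x y)" if "in_box R x" "in_box R y" for x y
    unfolding E_def using that in_box_reflection[OF \<sigma>] by (intro summable_add L) auto
  have sEeq: "(\<Sum>n. E n x y) = (\<Sum>n. err P Q n x (\<sigma> y)) + (\<Sum>n. err P Q n x y)"
    if "in_box R x" "in_box R y" for x y
    unfolding E_def using that in_box_reflection[OF \<sigma>] by (intro suminf_add[symmetric] L) auto
  have T_lip: "cmod (T x y - T x z) \<le> 2 * Lm * norm (y - z)" for x y z
  proof -
    have "T x y - T x z = (mode x (\<sigma> y) - mode x (\<sigma> z)) + (mode x y - mode x z)" by (simp add: T_def)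
    also have "cmod \<dots> \<le> Lm * norm (\<sigma> y - \<sigma> z) + Lm * norm (y - z)"
      by (intro order.trans[OF norm_triangle_ineq] add_mono Lm)
    finally show ?thesis by (simp add: norm_reflection_diff[OF \<sigma>])
  qed
  have E_lip: "cmod ((\<Sum>n. E n x y) - (\<Sum>n. E n x z)) \<le> 2 * L * norm (y - z)"
    if "in_box R x" "in_box R y" "in_box R z" "\<bar>snd y\<bar> \<le> d - \<delta>" "\<bar>snd z\<bar> \<le> d - \<delta>" for x y z
  proof -
    have "(\<Sum>n. E n x y) - (\<Sum>n. E n x z) = ((\<Sum>n. err P Q n x (\<sigma> y)) - (\<Sum>n. err P Q n x (\<sigma> z)))
        + ((\<Sum>n. err P Q n x y) - (\<Sum>n. err P Q n x z))"
      using that by (simp add: sEeq)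
    also have "cmod \<dots> \<le> L * norm (\<sigma> y - \<sigma> z) + L * norm (y - z)"
      using that by (intro order.trans[OF norm_triangle_ineq] add_mono L)
        (simp_all add: in_box_reflection[OF \<sigma>] snd_reflection[OF \<sigma>])
    finally show ?thesis by (simp add: norm_reflection_diff[OF \<sigma>])
  qed
  show ?thesis
  proof (cases "summable (lam P Q)")
    case True
    define \<Lambda> where "\<Lambda> = suminf (lam P Q)"
    have eq: "image_sum \<sigma> x y = \<Lambda> * T x y + (\<Sum>n. E n x y)" if "in_box R x" "in_box R y" for x y
      unfolding image_sum_def terms \<Lambda>_def suminf_mult2[OF True]
      by (intro suminf_add[symmetric] summable_mult2 True sE that)
    show ?thesis
    proof (rule that[of "cmod \<Lambda> * (2 * Lm) + 2 * L"])
      show "0 \<le> cmod \<Lambda> * (2 * Lm) + 2 * L" using L(1) Lm(1) by simp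
      fix x y z :: "real \<times> real"
      assume h: "in_box R x" "in_box R y" "in_box R z" "\<bar>snd y\<bar> \<le> d - \<delta>" "\<bar>snd z\<bar> \<le> d - \<delta>"
      have "image_sum \<sigma> x y - image_sum \<sigma> x z = \<Lambda> * (T x y - T x z) + ((\<Sum>n. E n x y) - (\<Sum>n. E n x z))"
        unfolding eq[OF h(1,2)] eq[OF h(1,3)] by (simp add: algebra_simps)
      also have "cmod \<dots> \<le> cmod \<Lambda> * (2 * Lm * norm (y - z)) + 2 * L * norm (y - z)"
        using T_lip[of x y z] E_lip[OF h]
        by (intro order.trans[OF norm_triangle_ineq] add_mono) (auto simp: norm_mult intro!: mult_left_mono)
      finally show "cmod (image_sum \<sigma> x y - image_sum \<sigma> x z) \<le> (cmod \<Lambda> * (2 * Lm) + 2 * L) * norm (y - z)"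
        by (simp add: algebra_simps)
    qed
  next
    case False
    have eq: "image_sum \<sigma> x y = (THE s. False)"
      if "in_box R x" "in_box R y" "generic x" "generic y" for x y
    proof -
      have T0: "T x y \<noteq> 0" unfolding T_def using that by (intro mode_sum_nonzero \<sigma>) (auto simp: generic_def)
      have "\<not> summable (\<lambda>n. image_pair n x (\<sigma> y) + image_pair n x y)"
      proof
        assume "summable (\<lambda>n. image_pair n x (\<sigma> y) + image_pair n x y)"
        from summable_diff[OF this sE[OF that(1,2)]] have "summable (\<lambda>n. lam P Q n * T x y)"
          unfolding terms by simp
        from summable_mult2[OF this, of "inverse (T x y)"] have "summable (lam P Q)" using T0 by (simp add: mult.assoc)
        with False show False by simp
      qed
      \<comment> \<open>\<open>suminf\<close> is the description of an \<open>s\<close> with a given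
        \<open>sums\<close> property. For every divergent series this property is constantly false,
        so all of them receive the same value.\<close>
      hence "(sums) (\<lambda>n. image_pair n x (\<sigma> y) + image_pair n x y) = (\<lambda>s. False)"
        using sums_summable by blast
      thus ?thesis unfolding image_sum_def suminf_def by simp
    qed
    show ?thesis by (rule that[of 0]) (auto simp: eq)
  qed
qed

text \<open>Only the direct source carries the singular weight. The reflected source lies at height
  at most \<open>-\<delta>\<close> while \<open>x\<close> has height at least 0, and the image
  series is Lipschitz at generic points, so both contribute smooth increments.\<close>

lemma duct_green_hoelder:
  assumes \<sigma>: "\<sigma> = mirror \<or> \<sigma> = uminus" and \<delta>: "\<delta> > 0" and R: "R > 0" and q: "0 < q" "q < 1"
  obtains C where "C \<ge> 0"
    "\<And>x y z. \<lbrakk>in_box R x; 0 \<le> snd x; in_box R y; in_box R z; \<delta> \<le> snd y; snd y \<le> d - \<delta>; \<delta> \<le> snd z; snd z \<le> d - \<delta>;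
        generic x; generic y; generic z; y \<noteq> x; z \<noteq> x\<rbrakk> \<Longrightarrow>
      cmod (duct_green \<sigma> d M k x y - duct_green \<sigma> d M k x z)
        \<le> C * norm (y - z) powr q * (1 + norm (x - y) powr (- q) + norm (x - z) powr (- q))"
proof -
  define R' where "R' = 2 * R + 2 * d"
  have R': "R' > 0" using R d by (simp add: R'_def)
  obtain L1 where L1: "L1 \<ge> 0"
    "\<And>u v. \<lbrakk>u \<noteq> 0; v \<noteq> 0; norm u \<le> R'; norm v \<le> R'\<rbrakk> \<Longrightarrow>
       cmod (profile u - profile v) \<le> L1 * norm (u - v) powr q * (norm u powr (- q) + norm v powr (- q))"
    using profile_hoelder[OF q R'] by blast
  obtain L2 where L2: "L2 \<ge> 0"
    "\<And>u v. \<lbrakk>\<delta> \<le> norm u; norm u \<le> R'; \<delta> \<le> norm v; norm v \<le> R'\<rbrakk> \<Longrightarrow>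
       cmod (profile u - profile v) \<le> L2 * norm (u - v)"
    using profile_lipschitz_away[OF \<delta>] by blast
  obtain L3 where L3: "L3 \<ge> 0"
    "\<And>x y z. \<lbrakk>in_box R x; in_box R y; in_box R z; \<bar>snd y\<bar> \<le> d - \<delta>; \<bar>snd z\<bar> \<le> d - \<delta>;
        generic x; generic y; generic z\<rbrakk> \<Longrightarrow>
      cmod (image_sum \<sigma> x y - image_sum \<sigma> x z) \<le> L3 * norm (y - z)"
    using image_sum_lipschitz[OF \<sigma> \<delta> R] by blast
  define K where "K = (2 * R') powr (1 - q)"
  have K: "K \<ge> 0" by (simp add: K_def)
  define C where "C = cmod c0 * L1 + (cmod c0 * L2 + L3) * K"
  show ?thesis
  proof (rule that[of C])
    show "C \<ge> 0" using L1(1) L2(1) L3(1) K by (simp add: C_def)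
    fix x y z :: "real \<times> real"
    assume h: "in_box R x" "0 \<le> snd x" "in_box R y" "in_box R z" "\<delta> \<le> snd y" "snd y \<le> d - \<delta>" "\<delta> \<le> snd z" "snd z \<le> d - \<delta>"
        "generic x" "generic y" "generic z" "y \<noteq> x" "z \<noteq> x"
    define t where "t = norm (y - z)"
    define W where "W = norm (x - y) powr (- q) + norm (x - z) powr (- q)"
    have W: "W \<ge> 0" by (simp add: W_def)
    have nb: "norm (x - y) \<le> R'" if "in_box R x" "in_box R y" for x y
    proof -
      have "norm (x - y) \<le> \<bar>fst (x - y)\<bar> + \<bar>snd (x - y)\<bar>" by (rule norm_le_abs_fst_abs_snd)
      also have "\<dots> \<le> R'" using that unfolding in_box_def R'_def fst_diff snd_diff by linarith
      finally show ?thesis .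
    qed
    have t: "0 \<le> t" "t \<le> 2 * R'" using nb[OF h(3,4)] R' by (auto simp: t_def)
    have tt: "t \<le> K * t powr q" unfolding K_def using t q by (intro le_powr_mult_powr) auto
    have 1: "cmod (profile (x - y) - profile (x - z)) \<le> L1 * t powr q * W"
      using L1(2)[of "x - y" "x - z"] h nb by (simp add: t_def W_def norm_minus_commute)
    have far: "\<delta> \<le> norm (x - \<sigma> y)" if "\<delta> \<le> snd y" for y
    proof -
      have "\<delta> \<le> \<bar>snd (x - \<sigma> y)\<bar>" using h(2) that unfolding snd_diff snd_reflection[OF \<sigma>] by linarith
      also have "\<dots> \<le> norm (x - \<sigma> y)" by (rule abs_snd_le_norm)
      finally show ?thesis .
    qed
    have "cmod (profile (x - \<sigma> y) - profile (x - \<sigma> z)) \<le> L2 * norm ((x - \<sigma> y) - (x - \<sigma> z))"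
      using h far nb by (intro L2) (simp_all add: in_box_reflection[OF \<sigma>])
    also have "norm ((x - \<sigma> y) - (x - \<sigma> z)) = norm (\<sigma> y - \<sigma> z)" by (simp add: norm_minus_commute)
    finally have 2: "cmod (profile (x - \<sigma> y) - profile (x - \<sigma> z)) \<le> L2 * t"
      by (simp add: t_def norm_reflection_diff[OF \<sigma>])
    have 3: "cmod (image_sum \<sigma> x y - image_sum \<sigma> x z) \<le> L3 * t"
      unfolding t_def using h \<delta> by (intro L3) auto
    have "duct_green \<sigma> d M k x y - duct_green \<sigma> d M k x z = c0 * (profile (x - y) - profile (x - z))
       + c0 * (profile (x - \<sigma> y) - profile (x - \<sigma> z)) + (image_sum \<sigma> x y - image_sum \<sigma> x z)"
      unfolding duct_green_eq by (simp add: algebra_simps)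
    also have "cmod \<dots> \<le> cmod c0 * (L1 * t powr q * W) + cmod c0 * (L2 * t) + L3 * t"
      using 1 2 3 by (intro order.trans[OF norm_triangle_ineq] add_mono) (auto simp: norm_mult intro!: mult_left_mono)
    also have "\<dots> = cmod c0 * L1 * t powr q * W + (cmod c0 * L2 + L3) * t" by (simp add: algebra_simps)
    also have "\<dots> \<le> cmod c0 * L1 * t powr q * (1 + W) + (cmod c0 * L2 + L3) * (K * t powr q * (1 + W))"
    proof (intro add_mono mult_left_mono)
      have "t \<le> K * t powr q * 1" using tt by simp
      also have "\<dots> \<le> K * t powr q * (1 + W)" using W K by (intro mult_left_mono) auto
      finally show "t \<le> K * t powr q * (1 + W)" .
    qed (use L1(1) L2(1) L3(1) in auto)
    also have "\<dots> = C * t powr q * (1 + W)" by (simp add: C_def algebra_simps)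
    finally show "cmod (duct_green \<sigma> d M k x y - duct_green \<sigma> d M k x z)
        \<le> C * norm (y - z) powr q * (1 + norm (x - y) powr (- q) + norm (x - z) powr (- q))"
      by (simp add: t_def W_def add.assoc)
  qed
qed

end

section \<open>White noise\<close>

lemma cmod_sum_square:
  fixes a :: "'i \<Rightarrow> complex" and w :: "'i \<Rightarrow> real"
  shows "(cmod (\<Sum>i\<in>I. a i * of_real (w i)))\<^sup>2 = (\<Sum>i\<in>I. \<Sum>j\<in>I. Re (a i * cnj (a j)) * (w i * w j))"
proof -
  define z where "z = (\<Sum>i\<in>I. a i * complex_of_real (w i))"
  have "(cmod z)\<^sup>2 = Re (z * cnj z)" by (metis Re_complex_of_real complex_norm_square)
  also have "z * cnj z = (\<Sum>i\<in>I. \<Sum>j\<in>I. (a i * of_real (w i)) * (cnj (a j) * of_real (w j)))"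
    by (simp add: z_def cnj_sum sum_product)
  also have "Re \<dots> = (\<Sum>i\<in>I. \<Sum>j\<in>I. Re (a i * cnj (a j)) * (w i * w j))"
    unfolding Re_sum by (intro sum.cong refl) (simp add: algebra_simps)
  finally show ?thesis by (simp add: z_def)
qed

lemma fin_borelD: "A \<in> fin_borel \<Longrightarrow> A \<in> sets borel" "A \<in> fin_borel \<Longrightarrow> emeasure lborel A < \<infinity>"
  by (auto simp: fin_borel_def)

lemma fin_borel_subset: "A \<in> fin_borel \<Longrightarrow> B \<in> sets borel \<Longrightarrow> B \<subseteq> A \<Longrightarrow> B \<in> fin_borel"
  unfolding fin_borel_def by (auto intro: le_less_trans[OF emeasure_mono])

lemma fin_borel_Int: "A \<in> fin_borel \<Longrightarrow> B \<in> fin_borel \<Longrightarrow> A \<inter> B \<in> fin_borel"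
  using fin_borelD by (blast intro: fin_borel_subset)

lemma fin_borel_Diff: "A \<in> fin_borel \<Longrightarrow> B \<in> fin_borel \<Longrightarrow> A - B \<in> fin_borel"
  using fin_borelD by (blast intro: fin_borel_subset)

lemma white_noiseD:
  assumes "white_noise P W"
  shows "prob_space P"
    "A \<in> fin_borel \<Longrightarrow> W A \<in> borel_measurable P"
    "A \<in> fin_borel \<Longrightarrow> measure lborel A = 0 \<Longrightarrow> AE \<omega> in P. W A \<omega> = 0"
    "A \<in> fin_borel \<Longrightarrow> measure lborel A > 0 \<Longrightarrow>
        distributed P lborel (W A) (\<lambda>t. ennreal (normal_density 0 (sqrt (measure lborel A)) t))"
    "A \<in> fin_borel \<Longrightarrow> B \<in> fin_borel \<Longrightarrow> A \<inter> B = {} \<Longrightarrow> AE \<omega> in P. W (A \<union> B) \<omega> = W A \<omega> + W B \<omega>"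
    "finite \<A> \<Longrightarrow> \<A> \<subseteq> fin_borel \<Longrightarrow> disjoint \<A> \<Longrightarrow> prob_space.indep_vars P (\<lambda>_. borel) W \<A>"
  using assms unfolding white_noise_def by auto

section \<open>Second moments and the isometry\<close>

lemma white_noise_moments:
  assumes wn: "white_noise P W" and A: "A \<in> fin_borel"
  shows "integrable P (W A)" "integral\<^sup>L P (W A) = 0"
    "integrable P (\<lambda>\<omega>. (W A \<omega>)\<^sup>2)" "(\<integral>\<omega>. (W A \<omega>)\<^sup>2 \<partial>P) = measure lborel A"
proof -
  interpret prob_space P by (rule white_noiseD(1)[OF wn])
  have [measurable]: "W A \<in> borel_measurable P" by (rule white_noiseD(2)[OF wn A])
  have "integrable P (W A) \<and> integral\<^sup>L P (W A) = 0 \<and>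
    integrable P (\<lambda>\<omega>. (W A \<omega>)\<^sup>2) \<and> (\<integral>\<omega>. (W A \<omega>)\<^sup>2 \<partial>P) = measure lborel A"
  proof (cases "measure lborel A = 0")
    case True
    have ae: "AE \<omega> in P. W A \<omega> = 0" by (rule white_noiseD(3)[OF wn A True])
    have "integrable P (W A) \<longleftrightarrow> integrable P (\<lambda>_. 0 :: real)"
      using ae by (intro integrable_cong_AE) auto
    moreover have "integral\<^sup>L P (W A) = integral\<^sup>L P (\<lambda>_. 0 :: real)"
      using ae by (intro integral_cong_AE) auto
    moreover have "integrable P (\<lambda>\<omega>. (W A \<omega>)\<^sup>2) \<longleftrightarrow> integrable P (\<lambda>_. 0 :: real)"
      using ae by (intro integrable_cong_AE) auto
    moreover have "(\<integral>\<omega>. (W A \<omega>)\<^sup>2 \<partial>P) = integral\<^sup>L P (\<lambda>_. 0 :: real)"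
      using ae by (intro integral_cong_AE) auto
    ultimately show ?thesis using True by simp
  next
    case False
    hence m: "measure lborel A > 0" by (simp add: less_le)
    define \<sigma> where "\<sigma> = sqrt (measure lborel A)"
    have \<sigma>: "\<sigma> > 0" using m by (simp add: \<sigma>_def)
    have D: "distributed P lborel (W A) (\<lambda>t. ennreal (normal_density 0 \<sigma> t))"
      unfolding \<sigma>_def by (rule white_noiseD(4)[OF wn A m])
    have 1: "integrable P (W A)"
      using distributed_integrable[OF D, of "\<lambda>x. x"] integrable_normal_moment[OF \<sigma>, of 0 1] by simp
    have 2: "integrable P (\<lambda>\<omega>. (W A \<omega>)\<^sup>2)"
      using distributed_integrable[OF D, of "\<lambda>x. x\<^sup>2"] integrable_normal_moment[OF \<sigma>, of 0 2] by simp
    have 3: "integral\<^sup>L P (W A) = 0" by (rule normal_distributed_expectation[OF \<sigma> D])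
    have "variance (W A) = \<sigma>\<^sup>2" by (rule normal_distributed_variance[OF \<sigma> D])
    thus ?thesis using 1 2 3 m by (simp add: \<sigma>_def)
  qed
  thus "integrable P (W A)" "integral\<^sup>L P (W A) = 0"
    "integrable P (\<lambda>\<omega>. (W A \<omega>)\<^sup>2)" "(\<integral>\<omega>. (W A \<omega>)\<^sup>2 \<partial>P) = measure lborel A" by auto
qed

lemma integrable_mult_of_squares:
  fixes f g :: "'a \<Rightarrow> real"
  assumes [measurable]: "f \<in> borel_measurable M" "g \<in> borel_measurable M"
    and "integrable M (\<lambda>x. (f x)\<^sup>2)" "integrable M (\<lambda>x. (g x)\<^sup>2)"
  shows "integrable M (\<lambda>x. f x * g x)"
proof (rule Bochner_Integration.integrable_bound)
  show "integrable M (\<lambda>x. (f x)\<^sup>2 + (g x)\<^sup>2)" using assms by simp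
  have "\<bar>a * b\<bar> \<le> a\<^sup>2 + b\<^sup>2" for a b :: real
  proof -
    have "2 * (\<bar>a\<bar> * \<bar>b\<bar>) \<le> \<bar>a\<bar>\<^sup>2 + \<bar>b\<bar>\<^sup>2" using sum_squares_bound[of "\<bar>a\<bar>" "\<bar>b\<bar>"] by (simp add: mult.assoc)
    moreover have "0 \<le> \<bar>a\<bar> * \<bar>b\<bar>" by simp
    ultimately show ?thesis unfolding abs_mult power2_abs by linarith
  qed
  thus "AE x in M. norm (f x * g x) \<le> norm ((f x)\<^sup>2 + (g x)\<^sup>2)" by simp
qed simp

lemma white_noise_disjoint:
  assumes wn: "white_noise P W" and A: "A \<in> fin_borel" and B: "B \<in> fin_borel" and AB: "A \<inter> B = {}"
  shows "(\<integral>\<omega>. W A \<omega> * W B \<omega> \<partial>P) = 0"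
proof -
  interpret prob_space P by (rule white_noiseD(1)[OF wn])
  show ?thesis
  \<comment> \<open>Equal disjoint sets are empty. Then the index set \<open>{A, B}\<close> has a
    single element and the product over it is not the product of two factors, so independence cannot
    be applied to it.\<close>
  proof (cases "A = B")
    case True
    hence "A = {}" using AB by simp
    hence "(\<integral>\<omega>. (W A \<omega>)\<^sup>2 \<partial>P) = 0" using white_noise_moments(4)[OF wn A] by simp
    thus ?thesis using True by (simp add: power2_eq_square)
  next
    case False
    have "disjoint {A, B}" using AB by (auto simp: disjoint_def)
    hence "indep_vars (\<lambda>_. borel) W {A, B}" using A B by (intro white_noiseD(6)[OF wn]) auto
    from indep_vars_lebesgue_integral[OF _ this] white_noise_moments(1)[OF wn] A B
    have "(\<integral>\<omega>. (\<Prod>i\<in>{A, B}. W i \<omega>) \<partial>P) = (\<Prod>i\<in>{A, B}. \<integral>\<omega>. W i \<omega> \<partial>P)" by auto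
    thus ?thesis using False white_noise_moments(2)[OF wn A] by simp
  qed
qed

text \<open>Splitting both sets along their intersection, only the square of the noise of the common
  part survives; the mixed terms belong to disjoint sets.\<close>

lemma white_noise_covariance:
  assumes wn: "white_noise P W" and A: "A \<in> fin_borel" and B: "B \<in> fin_borel"
  shows "integrable P (\<lambda>\<omega>. W A \<omega> * W B \<omega>)"
    "(\<integral>\<omega>. W A \<omega> * W B \<omega> \<partial>P) = measure lborel (A \<inter> B)"
proof -
  note meas [measurable] = white_noiseD(2)[OF wn]
  have int: "integrable P (\<lambda>\<omega>. W A \<omega> * W B \<omega>)" if "A \<in> fin_borel" "B \<in> fin_borel" for A B
    using that by (intro integrable_mult_of_squares white_noise_moments[OF wn] meas)
  show "integrable P (\<lambda>\<omega>. W A \<omega> * W B \<omega>)" by (rule int[OF A B])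
  define C where "C = A \<inter> B"
  define A' where "A' = A - B"
  define B' where "B' = B - A"
  have fb: "C \<in> fin_borel" "A' \<in> fin_borel" "B' \<in> fin_borel"
    unfolding C_def A'_def B'_def using A B by (auto intro: fin_borel_Int fin_borel_Diff)
  have "A = C \<union> A'" "B = C \<union> B'" and dj: "C \<inter> A' = {}" "C \<inter> B' = {}" "A' \<inter> C = {}" "A' \<inter> B' = {}"
    by (auto simp: C_def A'_def B'_def)
  hence "AE \<omega> in P. W A \<omega> = W C \<omega> + W A' \<omega>" "AE \<omega> in P. W B \<omega> = W C \<omega> + W B' \<omega>"
    using white_noiseD(5)[OF wn fb(1,2)] white_noiseD(5)[OF wn fb(1,3)] by auto
  hence "AE \<omega> in P. W A \<omega> * W B \<omega> = W C \<omega> * W C \<omega> + W C \<omega> * W B' \<omega> + W A' \<omega> * W C \<omega> + W A' \<omega> * W B' \<omega>"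
    by eventually_elim (simp add: algebra_simps)
  hence "(\<integral>\<omega>. W A \<omega> * W B \<omega> \<partial>P) = (\<integral>\<omega>. W C \<omega> * W C \<omega> + W C \<omega> * W B' \<omega> + W A' \<omega> * W C \<omega> + W A' \<omega> * W B' \<omega> \<partial>P)"
    using A B fb by (intro integral_cong_AE borel_measurable_times borel_measurable_add meas) auto
  also have "\<dots> = (\<integral>\<omega>. W C \<omega> * W C \<omega> \<partial>P) + (\<integral>\<omega>. W C \<omega> * W B' \<omega> \<partial>P) + (\<integral>\<omega>. W A' \<omega> * W C \<omega> \<partial>P) + (\<integral>\<omega>. W A' \<omega> * W B' \<omega> \<partial>P)"
    using int fb by simp
  also have "\<dots> = (\<integral>\<omega>. (W C \<omega>)\<^sup>2 \<partial>P)"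
    using white_noise_disjoint[OF wn] fb dj by (simp add: power2_eq_square)
  also have "\<dots> = measure lborel C" by (rule white_noise_moments(4)[OF wn fb(1)])
  finally show "(\<integral>\<omega>. W A \<omega> * W B \<omega> \<partial>P) = measure lborel (A \<inter> B)" by (simp add: C_def)
qed

text \<open>The second moment of a linear combination depends on the \<open>w i\<close> only through
  their Gram matrix. White noise on the sets and the indicator functions of the sets have the same
  Gram matrix, which yields the isometry also for overlapping sets.\<close>

lemma nn_integral_cmod_sum_square:
  fixes a :: "'i \<Rightarrow> complex" and w :: "'i \<Rightarrow> 'a \<Rightarrow> real"
  assumes "\<And>i j. i \<in> I \<Longrightarrow> j \<in> I \<Longrightarrow> integrable M (\<lambda>x. w i x * w j x)"
  shows "(\<integral>\<^sup>+ x. ennreal ((cmod (\<Sum>i\<in>I. a i * of_real (w i x)))\<^sup>2) \<partial>M)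
    = ennreal (\<Sum>i\<in>I. \<Sum>j\<in>I. Re (a i * cnj (a j)) * (\<integral>x. w i x * w j x \<partial>M))"
proof -
  define f where "f x = (\<Sum>i\<in>I. \<Sum>j\<in>I. Re (a i * cnj (a j)) * (w i x * w j x))" for x
  have int: "integrable M f"
    unfolding f_def by (intro Bochner_Integration.integrable_sum integrable_mult_right assms)
  have "f x \<ge> 0" for x unfolding f_def cmod_sum_square[symmetric] by simp
  hence "(\<integral>\<^sup>+ x. ennreal (f x) \<partial>M) = ennreal (integral\<^sup>L M f)"
    by (intro nn_integral_eq_integral int) simp
  also have "integral\<^sup>L M f = (\<Sum>i\<in>I. \<integral>x. (\<Sum>j\<in>I. Re (a i * cnj (a j)) * (w i x * w j x)) \<partial>M)"
    unfolding f_def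
    by (intro Bochner_Integration.integral_sum Bochner_Integration.integrable_sum integrable_mult_right assms)
  also have "\<dots> = (\<Sum>i\<in>I. \<Sum>j\<in>I. \<integral>x. Re (a i * cnj (a j)) * (w i x * w j x) \<partial>M)"
    by (intro sum.cong refl Bochner_Integration.integral_sum integrable_mult_right assms)
  also have "\<dots> = (\<Sum>i\<in>I. \<Sum>j\<in>I. Re (a i * cnj (a j)) * (\<integral>x. w i x * w j x \<partial>M))"
    by (simp only: integral_mult_right_zero)
  finally show ?thesis by (simp only: f_def cmod_sum_square)
qed

lemma white_noise_isometry:
  fixes a :: "'i \<Rightarrow> complex"
  assumes wn: "white_noise P W" and A: "\<And>i. i \<in> I \<Longrightarrow> A i \<in> fin_borel"
  shows "(\<integral>\<^sup>+ \<omega>. ennreal ((cmod (\<Sum>i\<in>I. a i * of_real (W (A i) \<omega>)))\<^sup>2) \<partial>P)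
     = (\<integral>\<^sup>+ y. ennreal ((cmod (\<Sum>i\<in>I. a i * of_real (indicat_real (A i) y)))\<^sup>2) \<partial>lborel)"
proof -
  have int: "integrable lborel (\<lambda>y. indicat_real (A i) y * indicat_real (A j) y)"
      and val: "(\<integral>y. indicat_real (A i) y * indicat_real (A j) y \<partial>lborel) = measure lborel (A i \<inter> A j)"
      if "i \<in> I" "j \<in> I" for i j
  proof -
    have eq: "(\<lambda>y. indicat_real (A i) y * indicat_real (A j) y) = indicat_real (A i \<inter> A j)"
      by (auto simp: indicator_inter_arith)
    have "A i \<inter> A j \<in> fin_borel" using A that by (intro fin_borel_Int) auto
    thus "integrable lborel (\<lambda>y. indicat_real (A i) y * indicat_real (A j) y)"
      "(\<integral>y. indicat_real (A i) y * indicat_real (A j) y \<partial>lborel) = measure lborel (A i \<inter> A j)"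
      unfolding eq using fin_borelD[of "A i \<inter> A j"] by auto
  qed
  show ?thesis
    by (subst (1 2) nn_integral_cmod_sum_square)
      (auto simp: val white_noise_covariance[OF wn] A intro!: int)
qed

lemma ennreal_cmod_diff_square_le:
  "ennreal ((cmod (a - b))\<^sup>2) \<le> 2 * ennreal ((cmod (c - a))\<^sup>2) + 2 * ennreal ((cmod (c - b))\<^sup>2)"
proof -
  have "(cmod (a - b))\<^sup>2 \<le> (cmod (c - a) + cmod (c - b))\<^sup>2"
    using norm_triangle_ineq4[of "c - b" "c - a"] by (intro power_mono) auto
  also have "\<dots> \<le> 2 * (cmod (c - a))\<^sup>2 + 2 * (cmod (c - b))\<^sup>2"
    using sum_squares_bound[of "cmod (c - a)" "cmod (c - b)"] by (simp add: power2_sum)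
  finally have "ennreal ((cmod (a - b))\<^sup>2) \<le> ennreal (2 * (cmod (c - a))\<^sup>2 + 2 * (cmod (c - b))\<^sup>2)"
    by (rule ennreal_leI)
  thus ?thesis by (simp add: ennreal_plus ennreal_mult)
qed

lemma ennreal_cmod_diff_square_le':
  "ennreal ((cmod (a - b))\<^sup>2) \<le> 2 * ennreal ((cmod (a - c))\<^sup>2) + 2 * ennreal ((cmod (c - b))\<^sup>2)"
  using ennreal_cmod_diff_square_le[of a b c] by (simp add: norm_minus_commute)

text \<open>The isometry is applied to an approximating simple function minus the cell sum, and the
  limit is taken in the resulting bound. The factor 4 is the price of using
  \<open>(a + b)\<^sup>2 \<le> 2 a\<^sup>2 + 2 b\<^sup>2\<close> twice, and it does not affect the
  rate.\<close>

lemma noise_integral_error: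
  fixes c :: "(real \<times> real) set \<Rightarrow> complex"
  assumes wn: "white_noise P W" and ni: "has_noise_integral P W D \<phi> X"
    and T: "finite T" "T \<subseteq> fin_borel"
  shows "(\<integral>\<^sup>+ \<omega>. ennreal ((cmod (X \<omega> - (\<Sum>K\<in>T. c K * of_real (W K \<omega>))))\<^sup>2) \<partial>P)
    \<le> 4 * (\<integral>\<^sup>+ y. ennreal ((cmod (indicat_real D y *\<^sub>R \<phi> y - (\<Sum>K\<in>T. c K * of_real (indicat_real K y))))\<^sup>2) \<partial>lborel)"
proof -
  obtain s where s: "\<And>n. Bochner_Integration.simple_bochner_integrable lborel (s n)"
    and lim1: "(\<lambda>n. \<integral>\<^sup>+ y. ennreal ((cmod (s n y - indicat_real D y *\<^sub>R \<phi> y))\<^sup>2) \<partial>lborel) \<longlonglongrightarrow> 0"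
    and lim2: "(\<lambda>n. \<integral>\<^sup>+ \<omega>. ennreal ((cmod (simple_noise_integral W (s n) \<omega> - X \<omega>))\<^sup>2) \<partial>P) \<longlonglongrightarrow> 0"
    and phi: "(\<lambda>y. indicat_real D y *\<^sub>R \<phi> y) \<in> borel_measurable lborel" and X[measurable]: "X \<in> borel_measurable P"
    using ni unfolding has_noise_integral_def set_borel_measurable_def by auto
  note phi' = phi[unfolded measurable_lborel1, measurable]
  note meas = white_noiseD(2)[OF wn]
  have [measurable]: "W K \<in> borel_measurable P" if "K \<in> T" for K using meas T that by auto
  have [measurable]: "K \<in> sets borel" if "K \<in> T" for K using fin_borelD T that by auto
  define Y where "Y \<omega> = (\<Sum>K\<in>T. c K * complex_of_real (W K \<omega>))" for \<omega>
  define t where "t y = (\<Sum>K\<in>T. c K * complex_of_real (indicat_real K y))" for y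
  have [measurable]: "Y \<in> borel_measurable P" "t \<in> borel_measurable borel"
    unfolding Y_def t_def by measurable
  let ?a = "\<lambda>n. \<integral>\<^sup>+ y. ennreal ((cmod (s n y - indicat_real D y *\<^sub>R \<phi> y))\<^sup>2) \<partial>lborel"
  let ?b = "\<lambda>n. \<integral>\<^sup>+ \<omega>. ennreal ((cmod (simple_noise_integral W (s n) \<omega> - X \<omega>))\<^sup>2) \<partial>P"
  let ?e = "\<integral>\<^sup>+ y. ennreal ((cmod (indicat_real D y *\<^sub>R \<phi> y - t y))\<^sup>2) \<partial>lborel"
  have bound: "(\<integral>\<^sup>+ \<omega>. ennreal ((cmod (X \<omega> - Y \<omega>))\<^sup>2) \<partial>P) \<le> 2 * ?b n + 2 * (2 * ?a n + 2 * ?e)" for n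
  proof -
    define J where "J = range (s n) - {0}"
    have sf: "simple_function lborel (s n)" and fin: "emeasure lborel {y. s n y \<noteq> 0} \<noteq> \<infinity>"
      using s[of n] by (auto simp: simple_bochner_integrable.simps)
    have J: "finite J" using simple_functionD(1)[OF sf] by (simp add: J_def)
    have [measurable]: "s n \<in> borel_measurable borel" using borel_measurable_simple_function[OF sf] by simp
    have J': "s n -` {x} \<in> fin_borel" if "x \<in> J" for x
    proof -
      have "{y. s n y \<noteq> 0} \<in> sets borel" by measurable
      hence "{y. s n y \<noteq> 0} \<in> fin_borel" using fin by (simp add: fin_borel_def less_top)
      moreover have "s n -` {x} \<in> sets borel"
        using measurable_sets[of "s n" borel borel "{x}"] by simp
      moreover have "s n -` {x} \<subseteq> {y. s n y \<noteq> 0}" using that by (auto simp: J_def)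
      ultimately show ?thesis by (rule fin_borel_subset)
    qed
    have [measurable]: "simple_noise_integral W (s n) \<in> borel_measurable P"
    proof -
      have "W (s n -` {x}) \<in> borel_measurable P" if "x \<in> J" for x by (rule meas[OF J'[OF that]])
      thus ?thesis unfolding simple_noise_integral_def J_def[symmetric] by measurable
    qed
    \<comment> \<open>Level sets of the simple function and cells are merged into one linear
      combination. A disjoint sum of indices is needed because a level set may coincide with a
      cell.\<close>
    define A where "A i = (case i of Inl x \<Rightarrow> s n -` {x} | Inr K \<Rightarrow> K)" for i :: "complex + (real \<times> real) set"
    define a where "a i = (case i of Inl x \<Rightarrow> x | Inr K \<Rightarrow> - c K)" for i :: "complex + (real \<times> real) set"
    have split: "(\<Sum>i\<in>J <+> T. a i * of_real (F (A i))) =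
        (\<Sum>x\<in>J. x * of_real (F (s n -` {x}))) - (\<Sum>K\<in>T. c K * of_real (F K))" for F :: "_ \<Rightarrow> real"
      using J T(1) by (simp add: sum.Plus A_def a_def sum_negf)
    have sum_s: "(\<Sum>x\<in>J. x * of_real (indicat_real (s n -` {x}) y)) = s n y" for y
    proof -
      have "(\<Sum>x\<in>J. x * of_real (indicat_real (s n -` {x}) y)) = (\<Sum>x\<in>J. if x = s n y then x else 0)"
        by (intro sum.cong) (auto simp: indicator_def)
      also have "\<dots> = s n y" using J by (auto simp: J_def)
      finally show ?thesis .
    qed
    have "(\<integral>\<^sup>+ \<omega>. ennreal ((cmod (simple_noise_integral W (s n) \<omega> - Y \<omega>))\<^sup>2) \<partial>P)
       = (\<integral>\<^sup>+ \<omega>. ennreal ((cmod (\<Sum>i\<in>J <+> T. a i * of_real (W (A i) \<omega>)))\<^sup>2) \<partial>P)"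
      unfolding split[of "\<lambda>A. W A _"] simple_noise_integral_def J_def[symmetric] Y_def ..
    also have "\<dots> = (\<integral>\<^sup>+ y. ennreal ((cmod (\<Sum>i\<in>J <+> T. a i * of_real (indicat_real (A i) y)))\<^sup>2) \<partial>lborel)"
      using J J' T by (intro white_noise_isometry[OF wn]) (auto simp: A_def)
    also have "\<dots> = (\<integral>\<^sup>+ y. ennreal ((cmod (s n y - t y))\<^sup>2) \<partial>lborel)"
      unfolding split[of "\<lambda>A. indicat_real A _"] sum_s t_def ..
    also have "\<dots> \<le> (\<integral>\<^sup>+ y. 2 * ennreal ((cmod (s n y - indicat_real D y *\<^sub>R \<phi> y))\<^sup>2)
        + 2 * ennreal ((cmod (indicat_real D y *\<^sub>R \<phi> y - t y))\<^sup>2) \<partial>lborel)"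
      by (intro nn_integral_mono ennreal_cmod_diff_square_le')
    also have "\<dots> = 2 * ?a n + 2 * ?e"
      by (subst nn_integral_add) (simp_all add: nn_integral_cmult)
    finally have iso: "(\<integral>\<^sup>+ \<omega>. ennreal ((cmod (simple_noise_integral W (s n) \<omega> - Y \<omega>))\<^sup>2) \<partial>P) \<le> 2 * ?a n + 2 * ?e" .
    have "(\<integral>\<^sup>+ \<omega>. ennreal ((cmod (X \<omega> - Y \<omega>))\<^sup>2) \<partial>P)
      \<le> (\<integral>\<^sup>+ \<omega>. 2 * ennreal ((cmod (simple_noise_integral W (s n) \<omega> - X \<omega>))\<^sup>2)
         + 2 * ennreal ((cmod (simple_noise_integral W (s n) \<omega> - Y \<omega>))\<^sup>2) \<partial>P)"
      by (intro nn_integral_mono ennreal_cmod_diff_square_le)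
    also have "\<dots> = 2 * ?b n + 2 * (\<integral>\<^sup>+ \<omega>. ennreal ((cmod (simple_noise_integral W (s n) \<omega> - Y \<omega>))\<^sup>2) \<partial>P)"
      by (subst nn_integral_add) (simp_all add: nn_integral_cmult)
    also have "\<dots> \<le> 2 * ?b n + 2 * (2 * ?a n + 2 * ?e)" using iso by (intro add_left_mono mult_left_mono) auto
    finally show ?thesis .
  qed
  have "(\<lambda>n. 2 * ?b n + 2 * (2 * ?a n + 2 * ?e)) \<longlonglongrightarrow> 2 * 0 + 2 * (2 * 0 + 2 * ?e)"
    by (intro tendsto_add ennreal_tendsto_cmult lim1 lim2 tendsto_const) auto
  hence "(\<integral>\<^sup>+ \<omega>. ennreal ((cmod (X \<omega> - Y \<omega>))\<^sup>2) \<partial>P) \<le> 2 * 0 + 2 * (2 * 0 + 2 * ?e)"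
    by (rule LIMSEQ_le_const) (use bound in auto)
  also have "\<dots> = 4 * ?e" by (simp add: mult.assoc[symmetric])
  finally show ?thesis unfolding Y_def t_def .
qed

section \<open>Singular weights and cell averages\<close>

lemma AE_lborel_inner_notin_countable:
  fixes u :: "'a :: euclidean_space"
  assumes "countable S" "u \<in> Basis"
  shows "AE x in lborel. x \<bullet> u \<notin> S"
proof -
  have "AE x in lborel. x \<bullet> u \<noteq> c" for c
  proof -
    have "{x. x \<bullet> u = c} \<in> null_sets lebesgue"
      using negligible_standard_hyperplane[OF assms(2)] by (simp add: negligible_iff_null_sets)
    moreover have "closed {x. x \<bullet> u = c}" by (intro closed_Collect_eq continuous_intros)
    ultimately have "{x. x \<bullet> u = c} \<in> null_sets lborel"
      by (simp add: null_sets_completion_iff borel_closed)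
    from AE_not_in[OF this] show ?thesis by simp
  qed
  hence "AE x in lborel. \<forall>c\<in>S. x \<bullet> u \<noteq> c"
    by (subst AE_ball_countable[OF assms(1)]) auto
  thus ?thesis by (auto elim!: eventually_mono)
qed

lemma AE_lborel_fst_snd_notin_countable:
  assumes "countable S" "countable T"
  shows "AE x in (lborel :: (real \<times> real) measure). fst x \<notin> S \<and> snd x \<notin> T"
  using AE_lborel_inner_notin_countable[OF assms(1), of "(1, 0) :: real \<times> real"]
    AE_lborel_inner_notin_countable[OF assms(2), of "(0, 1) :: real \<times> real"]
  by (auto elim!: eventually_elim2 simp: inner_prod_def Basis_prod_def)

lemma countable_cos_zeros: "countable {t. cos (c * t) = (0 :: real)}"
proof (cases "c = 0")
  case False
  have "{t. cos (c * t) = 0} \<subseteq> (\<lambda>i::int. of_int i * (pi / 2) / c) ` UNIV"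
  proof
    fix t assume "t \<in> {t. cos (c * t) = 0}"
    then obtain i :: int where "c * t = of_int i * (pi / 2)" by (auto simp: cos_zero_iff_int)
    hence "t = of_int i * (pi / 2) / c" using False by (simp add: field_simps)
    thus "t \<in> (\<lambda>i::int. of_int i * (pi / 2) / c) ` UNIV" by blast
  qed
  thus ?thesis by (rule countable_subset) simp
qed simp

lemma (in convected_duct) AE_generic: "AE y in lborel. generic y"
  using AE_lborel_fst_snd_notin_countable[OF countable_cos_zeros[of \<alpha>] countable_cos_zeros[of \<kappa>]]
  by eventually_elim (simp add: generic_def)

section \<open>Integrability of the singular weight\<close>

lemma nn_integral_abs_powr_finite:
  fixes S q :: real
  assumes q: "q < 1" and S: "S \<ge> 0"
  shows "(\<integral>\<^sup>+ t. ennreal (\<bar>t\<bar> powr (- q)) * indicator {-S..S} t \<partial>lborel) < \<infinity>"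
proof -
  define I where "I = (\<integral>\<^sup>+ t. ennreal (t powr (- q)) * indicator {0..S} t \<partial>lborel)"
  have "((\<lambda>x. x powr (- q)) has_integral (S powr (- q + 1) / (- q + 1))) {0..S}"
    by (rule has_integral_powr_from_0) (use assms in auto)
  hence "I = ennreal (S powr (- q + 1) / (- q + 1))"
    unfolding I_def by (intro nn_integral_has_integral_lebesgue') auto
  hence I: "I < \<infinity>" by simp
  have refl: "(\<integral>\<^sup>+ t. ennreal ((- t) powr (- q)) * indicator {0..S} (- t) \<partial>lborel) = I"
    unfolding I_def using nn_integral_real_affine[of "\<lambda>t. ennreal (t powr (- q)) * indicator {0..S} t" "-1" 0]
    by simp
  have "(\<integral>\<^sup>+ t. ennreal (\<bar>t\<bar> powr (- q)) * indicator {-S..S} t \<partial>lborel)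
    \<le> (\<integral>\<^sup>+ t. ennreal (t powr (- q)) * indicator {0..S} t + ennreal ((- t) powr (- q)) * indicator {0..S} (- t) \<partial>lborel)"
    by (intro nn_integral_mono) (auto simp: indicator_def)
  also have "\<dots> = I + I" by (subst nn_integral_add) (simp_all add: refl I_def)
  finally show ?thesis using I by (simp add: less_top[symmetric] top_unique)
    (metis ennreal_add_eq_top less_top neq_top_trans)
qed

text \<open>The substitution \<open>c - t\<close> carries the interval into the doubled one, so the
  bound is uniform in the position of the singularity.\<close>

lemma nn_integral_abs_powr_translate:
  fixes S q c :: real
  assumes c: "\<bar>c\<bar> \<le> S"
  shows "(\<integral>\<^sup>+ t. ennreal (\<bar>c - t\<bar> powr (- q)) * indicator {-S..S} t \<partial>lborel)
    \<le> (\<integral>\<^sup>+ t. ennreal (\<bar>t\<bar> powr (- q)) * indicator {-(2*S)..2*S} t \<partial>lborel)"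
proof -
  have "(\<integral>\<^sup>+ t. ennreal (\<bar>t\<bar> powr (- q)) * indicator {-(2*S)..2*S} t \<partial>lborel)
    = (\<integral>\<^sup>+ t. ennreal (\<bar>c + (-1) * t\<bar> powr (- q)) * indicator {-(2*S)..2*S} (c + (-1) * t) \<partial>lborel)"
    using nn_integral_real_affine[of "\<lambda>t. ennreal (\<bar>t\<bar> powr (- q)) * indicator {-(2*S)..2*S} t" "-1" c] by simp
  also have "\<dots> \<ge> (\<integral>\<^sup>+ t. ennreal (\<bar>c - t\<bar> powr (- q)) * indicator {-S..S} t \<partial>lborel)"
    using c by (intro nn_integral_mono) (auto simp: indicator_def)
  finally show ?thesis .
qed

text \<open>From \<open>|u\<^sub>1| |u\<^sub>2| \<le> |u|\<^sup>2\<close>. The planar singularity of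
  degree \<open>2 q\<close> is thereby reduced to two one-dimensional ones of degree
  \<open>q\<close>, each integrable for \<open>q < 1\<close>, without polar coordinates.\<close>

lemma norm_powr_le_product:
  fixes u :: "real \<times> real"
  assumes "fst u \<noteq> 0" "snd u \<noteq> 0" "q > 0"
  shows "norm u powr (- (2 * q)) \<le> \<bar>fst u\<bar> powr (- q) * \<bar>snd u\<bar> powr (- q)"
proof -
  have 1: "\<bar>fst u\<bar> * \<bar>snd u\<bar> \<le> (norm u)\<^sup>2"
    unfolding power2_eq_square by (intro mult_mono abs_fst_le_norm abs_snd_le_norm) auto
  have "u \<noteq> 0" using assms by auto
  hence "(norm u)\<^sup>2 = norm u powr 2" by simp
  hence "norm u powr (- (2 * q)) = ((norm u)\<^sup>2) powr (- q)"
    by (simp only: powr_powr) simp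
  also have "\<dots> \<le> (\<bar>fst u\<bar> * \<bar>snd u\<bar>) powr (- q)" using assms 1 by (intro powr_mono2') auto
  also have "\<dots> = \<bar>fst u\<bar> powr (- q) * \<bar>snd u\<bar> powr (- q)" by (simp add: powr_mult)
  finally show ?thesis .
qed

lemma singular_weight_integrable:
  assumes q: "0 < q" "q < 1" and S: "S \<ge> 0"
  obtains C :: real where "C \<ge> 0"
    "\<And>x :: real \<times> real. \<lbrakk>\<bar>fst x\<bar> \<le> S; \<bar>snd x\<bar> \<le> S\<rbrakk> \<Longrightarrow>
       (\<integral>\<^sup>+ y. ennreal (norm (x - y) powr (- (2 * q))) * indicator ({-S..S} \<times> {-S..S}) y \<partial>lborel) \<le> ennreal C"
proof -
  define I where "I = (\<integral>\<^sup>+ t. ennreal (\<bar>t\<bar> powr (- q)) * indicator {-(2*S)..2*S} t \<partial>lborel)"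
  have I: "I < \<infinity>" unfolding I_def using nn_integral_abs_powr_finite[of q "2 * S"] q S by simp
  then obtain C where C: "I = ennreal C" "C \<ge> 0" by (cases I) auto
  show ?thesis
  proof (rule that[of "C * C"])
    show "C * C \<ge> 0" by simp
    fix x :: "real \<times> real" assume x: "\<bar>fst x\<bar> \<le> S" "\<bar>snd x\<bar> \<le> S"
    define g where "g c t = ennreal (\<bar>c - t\<bar> powr (- q)) * indicator {-S..S} t" for c t :: real
    have g[measurable]: "g c \<in> borel_measurable borel" for c unfolding g_def by measurable
    have gI: "(\<integral>\<^sup>+ t. g c t \<partial>lborel) \<le> I" if "\<bar>c\<bar> \<le> S" for c
      unfolding g_def I_def using that by (rule nn_integral_abs_powr_translate)
    have ae: "AE y in (lborel :: (real \<times> real) measure). fst y \<noteq> fst x \<and> snd y \<noteq> snd x"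
      using AE_lborel_fst_snd_notin_countable[of "{fst x}" "{snd x}"] by auto
    have "(\<integral>\<^sup>+ y. ennreal (norm (x - y) powr (- (2 * q))) * indicator ({-S..S} \<times> {-S..S}) y \<partial>lborel)
       \<le> (\<integral>\<^sup>+ y. g (fst x) (fst y) * g (snd x) (snd y) \<partial>lborel)"
    proof (intro nn_integral_mono_AE, use ae in eventually_elim)
      fix y :: "real \<times> real" assume y: "fst y \<noteq> fst x \<and> snd y \<noteq> snd x"
      have "ennreal (norm (x - y) powr (- (2 * q))) \<le> ennreal (\<bar>fst x - fst y\<bar> powr (- q) * \<bar>snd x - snd y\<bar> powr (- q))"
        using norm_powr_le_product[of "x - y" q] y q by (intro ennreal_leI) auto
      thus "ennreal (norm (x - y) powr (- (2 * q))) * indicator ({-S..S} \<times> {-S..S}) y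
         \<le> g (fst x) (fst y) * g (snd x) (snd y)"
        by (cases y) (auto simp: g_def indicator_def ennreal_mult)
    qed
    also have "\<dots> = (\<integral>\<^sup>+ y. g (fst x) (fst y) * g (snd x) (snd y) \<partial>(lborel \<Otimes>\<^sub>M lborel))"
      by (simp add: lborel_prod)
    also have "\<dots> = (\<integral>\<^sup>+ s. \<integral>\<^sup>+ t. g (fst x) s * g (snd x) t \<partial>lborel \<partial>lborel)"
      by (subst lborel.nn_integral_fst[symmetric]) auto
    also have "\<dots> = (\<integral>\<^sup>+ s. g (fst x) s \<partial>lborel) * (\<integral>\<^sup>+ t. g (snd x) t \<partial>lborel)"
      by (simp add: nn_integral_cmult nn_integral_multc)
    also have "\<dots> \<le> I * I" using gI x by (intro mult_mono) auto
    also have "\<dots> = ennreal (C * C)" using C by (simp add: ennreal_mult)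
    finally show "(\<integral>\<^sup>+ y. ennreal (norm (x - y) powr (- (2 * q))) * indicator ({-S..S} \<times> {-S..S}) y \<partial>lborel) \<le> ennreal (C * C)" .
  qed
qed

text \<open>By Cauchy-Schwarz, \<open>|g y - c|\<^sup>2\<close> is at most the mean over
  \<open>z\<close> of \<open>|g y - g z|\<^sup>2\<close>. Integrating in \<open>y\<close> as well,
  the weight is met once through \<open>y\<close> and once through \<open>z\<close>, whence the
  factor 2.\<close>

lemma average_error:
  fixes g :: "real \<times> real \<Rightarrow> complex" and w :: "real \<times> real \<Rightarrow> ennreal"
  assumes K: "K \<in> fin_borel" and [measurable]: "g \<in> borel_measurable borel" "w \<in> borel_measurable borel"
    and int: "integrable lborel (\<lambda>y. g y * of_real (indicat_real K y))"
    and ae: "AE y in lborel. y \<in> H"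
    and bd: "\<And>y z. \<lbrakk>y \<in> K; z \<in> K; y \<in> H; z \<in> H\<rbrakk> \<Longrightarrow> ennreal ((cmod (g y - g z))\<^sup>2) \<le> B * (1 + w y + w z)"
    and c: "c = (LINT y|lborel. g y * of_real (indicat_real K y)) / of_real (measure lborel K)"
  shows "(\<integral>\<^sup>+ y. ennreal ((cmod (g y - c))\<^sup>2) * indicator K y \<partial>lborel)
    \<le> B * (emeasure lborel K + 2 * (\<integral>\<^sup>+ y. w y * indicator K y \<partial>lborel))"
proof (cases "measure lborel K = 0")
  \<comment> \<open>On a null cell \<open>c\<close> is a quotient by zero, but the integral over the
    cell vanishes whatever its value.\<close>
  case True
  have Kb[measurable]: "K \<in> sets borel" by (rule fin_borelD[OF K])
  have "emeasure lborel K = 0"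
    using True fin_borelD(2)[OF K] by (auto simp: measure_def enn2real_eq_0_iff)
  hence "AE y in lborel. y \<notin> K" by (intro AE_not_in) auto
  hence "(\<integral>\<^sup>+ y. ennreal ((cmod (g y - c))\<^sup>2) * indicator K y \<partial>lborel) = (\<integral>\<^sup>+ y. 0 \<partial>(lborel :: (real \<times> real) measure))"
    by (intro nn_integral_cong_AE) (auto elim!: eventually_mono)
  thus ?thesis by simp
next
  case False
  define m where "m = measure lborel K"
  have m: "m > 0" using False by (simp add: m_def less_le)
  have em: "emeasure lborel K = ennreal m"
    using fin_borelD(2)[OF K] unfolding m_def by (intro emeasure_eq_ennreal_measure) auto
  have Kb[measurable]: "K \<in> sets borel" by (rule fin_borelD[OF K])
  define J where "J = (\<integral>\<^sup>+ z. w z * indicator K z \<partial>lborel)"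
  have intK: "integrable lborel (\<lambda>z. of_real (indicat_real K z) :: complex)"
    using fin_borelD[OF K] by (intro integrable_of_real) auto
  have pt: "ennreal ((cmod (g y - c))\<^sup>2) * ennreal m \<le> B * (ennreal m + w y * ennreal m + J)" if y: "y \<in> K" "y \<in> H" for y
  proof -
    define f where "f z = ennreal (cmod (g y - g z)) * indicator K z" for z
    have [measurable]: "f \<in> borel_measurable borel" unfolding f_def by measurable
    \<comment> \<open>Because \<open>c\<close> is the mean, integrating \<open>g y - g z\<close>
      over the cell in \<open>z\<close> gives \<open>m\<close> times the deviation at
      \<open>y\<close>.\<close>
    have I1: "(LINT z|lborel. (g y - g z) * of_real (indicat_real K z)) = of_real m * (g y - c)"
    proof -
      have "(LINT z|lborel. (g y - g z) * of_real (indicat_real K z)) =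
         (LINT z|lborel. g y * of_real (indicat_real K z)) - (LINT z|lborel. g z * of_real (indicat_real K z))"
        using int intK by (simp add: left_diff_distrib)
      also have "(LINT z|lborel. g y * complex_of_real (indicat_real K z)) = g y * of_real m"
        using fin_borelD[OF K] by (simp add: m_def)
      also have "(LINT z|lborel. g z * complex_of_real (indicat_real K z)) = of_real m * c"
        using False by (simp add: c m_def)
      finally show ?thesis by (simp add: algebra_simps)
    qed
    have "ennreal (m * cmod (g y - c)) = ennreal (cmod (LINT z|lborel. (g y - g z) * of_real (indicat_real K z)))"
      unfolding I1 using m by (simp add: norm_mult)
    also have "\<dots> \<le> (\<integral>\<^sup>+ z. ennreal (cmod ((g y - g z) * of_real (indicat_real K z))) \<partial>lborel)"
      by (intro integral_norm_bound_ennreal) (use int intK in \<open>simp add: left_diff_distrib\<close>)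
    also have "\<dots> = (\<integral>\<^sup>+ z. f z * indicator K z \<partial>lborel)"
      unfolding f_def by (intro nn_integral_cong) (auto simp: norm_mult indicator_def)
    finally have le: "ennreal (m * cmod (g y - c)) \<le> (\<integral>\<^sup>+ z. f z * indicator K z \<partial>lborel)" .
    have "(ennreal (m * cmod (g y - c)))\<^sup>2 \<le> (\<integral>\<^sup>+ z. f z * indicator K z \<partial>lborel)\<^sup>2"
      using le by (intro power_mono) auto
    also have "\<dots> \<le> (\<integral>\<^sup>+ z. (f z)\<^sup>2 \<partial>lborel) * (\<integral>\<^sup>+ z. (indicator K z)\<^sup>2 \<partial>lborel)"
      by (rule Cauchy_Schwarz_nn_integral) auto
    also have "(\<integral>\<^sup>+ z. (indicator K z)\<^sup>2 \<partial>lborel) = (\<integral>\<^sup>+ z. indicator K z \<partial>(lborel :: (real \<times> real) measure))"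
      by (intro nn_integral_cong) (auto simp: indicator_def)
    also have "\<dots> = ennreal m" by (simp add: em)
    also have "(\<integral>\<^sup>+ z. (f z)\<^sup>2 \<partial>lborel) \<le> (\<integral>\<^sup>+ z. B * (indicator K z + w y * indicator K z + w z * indicator K z) \<partial>lborel)"
    proof (intro nn_integral_mono_AE, use ae in eventually_elim)
      fix z assume z: "z \<in> H"
      show "(f z)\<^sup>2 \<le> B * (indicator K z + w y * indicator K z + w z * indicator K z)"
      proof (cases "z \<in> K")
        case True
        have "(f z)\<^sup>2 = ennreal ((cmod (g y - g z))\<^sup>2)" using True by (simp add: f_def ennreal_power)
        thus ?thesis using bd[OF y(1) True y(2) z] True by simp
      qed (simp add: f_def)
    qed
    also have "\<dots> = B * (ennreal m + w y * ennreal m + J)"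
      by (simp add: nn_integral_cmult nn_integral_add em J_def)
    finally have "(ennreal (m * cmod (g y - c)))\<^sup>2 \<le> B * (ennreal m + w y * ennreal m + J) * ennreal m"
      by (simp add: mult_right_mono)
    also have "(ennreal (m * cmod (g y - c)))\<^sup>2 = ennreal ((cmod (g y - c))\<^sup>2) * ennreal m * ennreal m"
      using m by (simp add: ennreal_power[symmetric] ennreal_mult power2_eq_square ac_simps)
    finally show ?thesis
      using m by (subst (asm) ennreal_mult_le_mult_iff[of "ennreal m", symmetric] ) (auto simp: mult.commute ennreal_mult_le_mult_iff)
  qed
  have "(\<integral>\<^sup>+ y. ennreal ((cmod (g y - c))\<^sup>2) * indicator K y \<partial>lborel) * ennreal m
     = (\<integral>\<^sup>+ y. ennreal ((cmod (g y - c))\<^sup>2) * ennreal m * indicator K y \<partial>lborel)"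
    by (subst nn_integral_multc[symmetric]) (auto simp: ac_simps)
  also have "\<dots> \<le> (\<integral>\<^sup>+ y. B * ((ennreal m + J) * indicator K y + ennreal m * (w y * indicator K y)) \<partial>lborel)"
  proof (intro nn_integral_mono_AE, use ae in eventually_elim)
    fix y assume y: "y \<in> H"
    show "ennreal ((cmod (g y - c))\<^sup>2) * ennreal m * indicator K y
       \<le> B * ((ennreal m + J) * indicator K y + ennreal m * (w y * indicator K y))"
      using pt[OF _ y] by (cases "y \<in> K") (simp_all add: ac_simps)
  qed
  also have "\<dots> = B * ((ennreal m + J) * ennreal m + ennreal m * J)"
    by (simp add: nn_integral_cmult nn_integral_add em J_def)
  also have "\<dots> = B * (ennreal m + 2 * J) * ennreal m"
    unfolding mult_2 by (simp only: distrib_left distrib_right ac_simps)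
  finally show ?thesis
    using m unfolding em J_def[symmetric]
    by (simp add: mult.commute[of _ "ennreal m"] ennreal_mult_le_mult_iff)
qed

section \<open>Triangulations\<close>

text \<open>A merely continuous arc can have positive area. Piecewise continuous differentiability
  makes the curved edges null sets, and hence also the overlaps of neighbouring cells.\<close>

lemma negligible_valid_path_image:
  fixes g :: "real \<Rightarrow> real \<times> real"
  assumes "valid_path g"
  shows "negligible (path_image g)"
proof -
  obtain S where S: "finite S" "g C1_differentiable_on ({0..1} - S)"
    using assms unfolding valid_path_def piecewise_C1_differentiable_on_def by blast
  have "g differentiable_on ({0..1} - S)"
    using S(2) by (auto simp: C1_differentiable_on_eq differentiable_on_def intro: differentiable_at_withinI)
  hence "negligible (g ` ({0..1} - S))"
    by (intro negligible_differentiable_image_lowdim) auto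
  moreover have "negligible (g ` S)" using S(1) by (intro negligible_finite) simp
  ultimately have "negligible (g ` ({0..1} - S) \<union> g ` S)" by (rule negligible_Un)
  moreover have "path_image g \<subseteq> g ` ({0..1} - S) \<union> g ` S" by (auto simp: path_image_def)
  ultimately show ?thesis by (rule negligible_subset)
qed

lemma curved_triangle_closed: "curved_triangle K V E \<Longrightarrow> closed K"
  unfolding curved_triangle_def Let_def
  by (auto intro: closed_path_image_Un_inside simple_path_imp_path)

lemma curved_triangle_edge_negligible:
  assumes "curved_triangle K V E" "e \<in> E"
  shows "negligible e"
proof -
  have "negligible (closed_segment u v)" for u v :: "real \<times> real"
    using negligible_valid_path_image[of "linepath u v"] by simp
  thus ?thesis using assms negligible_valid_path_image unfolding curved_triangle_def Let_def by auto
qed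

text \<open>The cells are closed and share vertices and edges, so a point determines its cell only
  almost everywhere.\<close>

lemma triangulation_facts:
  assumes T: "triangulation S \<T>" and S: "compact S"
  shows "finite \<T>" "\<Union>\<T> = S"
    "\<And>K. K \<in> \<T> \<Longrightarrow> K \<in> fin_borel"
    "\<And>K y z. K \<in> \<T> \<Longrightarrow> y \<in> K \<Longrightarrow> z \<in> K \<Longrightarrow> norm (y - z) \<le> mesh_size \<T>"
    "AE y in lborel. \<forall>K\<in>\<T>. \<forall>L\<in>\<T>. y \<in> K \<longrightarrow> y \<in> L \<longrightarrow> K = L"
proof -
  show fin: "finite \<T>" and un: "\<Union>\<T> = S" using T unfolding triangulation_def by auto
  obtain V E where VE': "\<forall>K\<in>\<T>. curved_triangle K (V K) (E K)"
    and meet': "\<forall>K\<in>\<T>. \<forall>L\<in>\<T>. K \<noteq> L \<longrightarrow>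
           K \<inter> L = {} \<or> (\<exists>v \<in> V K \<inter> V L. K \<inter> L = {v}) \<or> K \<inter> L \<in> E K \<inter> E L"
    using T unfolding triangulation_def by (elim conjE exE) rule
  note VE = VE'[rule_format] and meet = meet'[rule_format]
  have cl: "closed K" if "K \<in> \<T>" for K using VE[OF that] by (rule curved_triangle_closed)
  have bd: "bounded K" if "K \<in> \<T>" for K
    by (rule bounded_subset[OF compact_imp_bounded[OF S]]) (use that un in auto)
  have Sfin: "S \<in> fin_borel"
    using emeasure_compact_finite[OF S] S by (simp add: fin_borel_def borel_compact)
  show "K \<in> fin_borel" if "K \<in> \<T>" for K
    using fin_borel_subset[OF Sfin borel_closed[OF cl[OF that]]] that un by auto
  show "norm (y - z) \<le> mesh_size \<T>" if "K \<in> \<T>" "y \<in> K" "z \<in> K" for K y z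
  proof -
    have "norm (y - z) \<le> diameter K"
      using diameter_bounded_bound[OF bd[OF that(1)] that(2,3)] by (simp add: dist_norm)
    also have "\<dots> \<le> mesh_size \<T>" unfolding mesh_size_def using fin that(1) by (intro Max_ge) auto
    finally show ?thesis .
  qed
  have "AE y in lborel. y \<in> K \<longrightarrow> y \<in> L \<longrightarrow> K = L" if "K \<in> \<T>" "L \<in> \<T>" for K L
  proof (cases "K = L")
    case False
    have "negligible (K \<inter> L)"
      using meet[OF that False] curved_triangle_edge_negligible[OF VE[OF that(1)]] by auto
    hence "K \<inter> L \<in> null_sets lebesgue" by (simp add: negligible_iff_null_sets)
    moreover have "K \<inter> L \<in> sets lborel" using cl that by (simp add: borel_closed closed_Int)
    ultimately have "K \<inter> L \<in> null_sets lborel" by (simp add: null_sets_completion_iff)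
    from AE_not_in[OF this] show ?thesis by eventually_elim auto
  qed simp
  thus "AE y in lborel. \<forall>K\<in>\<T>. \<forall>L\<in>\<T>. y \<in> K \<longrightarrow> y \<in> L \<longrightarrow> K = L"
    by (intro AE_finite_allI[OF fin])
qed

section \<open>Borel measurability\<close>

lemma measurable_hankel1_0: "hankel1_0 \<in> borel_measurable borel"
  unfolding hankel1_0_def [abs_def] bessel_J0_def [abs_def] bessel_Y0_def [abs_def] by measurable

context convected_duct
begin

lemma measurable_profile: "profile \<in> borel_measurable borel"
proof -
  have [measurable]: "(\<lambda>u. k * rho M u) \<in> borel_measurable borel"
    unfolding rho_eq_norm using b(1)
    by (intro borel_measurable_continuous_onI continuous_intros) auto
  have [measurable]: "(\<lambda>u. cis (- (\<alpha> * fst u))) \<in> borel_measurable (borel :: (real \<times> real) measure)"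
    by (intro borel_measurable_continuous_onI continuous_intros)
  note measurable_hankel1_0[measurable]
  show ?thesis unfolding profile_def [abs_def] by measurable
qed

lemma measurable_duct_green:
  assumes \<sigma>: "\<sigma> = mirror \<or> \<sigma> = uminus"
  shows "(\<lambda>(x, y). duct_green \<sigma> d M k x y) \<in> borel_measurable (borel \<Otimes>\<^sub>M borel)"
proof -
  have "mirror \<in> borel_measurable borel"
    unfolding mirror_def [abs_def] by (intro borel_measurable_continuous_onI continuous_intros)
  hence [measurable]: "\<sigma> \<in> borel_measurable borel" using \<sigma> by auto
  note measurable_profile[measurable]
  show ?thesis
    unfolding duct_green_def fund_sol_eq Let_def case_prod_beta by measurable
qed

end

text \<open>The source \<open>f\<close> is only Lebesgue measurable. A Borel version lets the
  deterministic part be treated as a parameter integral over Borel sets, measurable in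
  \<open>x\<close>.\<close>

lemma lebesgue_on_measurable_borel_version:
  fixes f :: "real \<times> real \<Rightarrow> complex"
  assumes D: "D \<in> sets borel" and f: "f \<in> borel_measurable (lebesgue_on D)"
  obtains f' where "f' \<in> borel_measurable borel" "AE y in lborel. y \<in> D \<longrightarrow> f y = f' y"
proof -
  define g where "g y = indicat_real D y *\<^sub>R f y" for y
  have g: "g \<in> borel_measurable lebesgue"
    using f D unfolding g_def by (subst (asm) borel_measurable_restrict_space_iff) auto
  have "(\<lambda>y. Re (g y)) \<in> borel_measurable lebesgue" "(\<lambda>y. Im (g y)) \<in> borel_measurable lebesgue"
    using g by measurable
  then obtain r i where r: "r \<in> borel_measurable lborel" "AE y in lborel. Re (g y) = r y"
    and i: "i \<in> borel_measurable lborel" "AE y in lborel. Im (g y) = i y"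
    using completion_ex_borel_measurable_real[of "\<lambda>y. Re (g y)" lborel]
      completion_ex_borel_measurable_real[of "\<lambda>y. Im (g y)" lborel] by blast
  show ?thesis
  proof (rule that[of "\<lambda>y. Complex (r y) (i y)"])
    have "(\<lambda>y. Complex (r y) (i y)) = (\<lambda>y. of_real (r y) + \<i> * of_real (i y))"
      by (simp add: Complex_eq)
    also have "\<dots> \<in> borel_measurable borel" using r(1) i(1) by measurable
    finally show "(\<lambda>y. Complex (r y) (i y)) \<in> borel_measurable borel" .
    show "AE y in lborel. y \<in> D \<longrightarrow> f y = Complex (r y) (i y)"
      using r(2) i(2) by eventually_elim (auto simp: g_def complex_eq_iff)
  qed
qed

section \<open>The discretized solution\<close>

text \<open>For a null cell the quotient is zero by convention, in agreement with the discretized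
  noise, whose powers of the cell area are then zero too.\<close>

definition cell_mean :: "(real \<times> real \<Rightarrow> complex) \<Rightarrow> (real \<times> real) set \<Rightarrow> complex" where
  "cell_mean g K = (LINT y|lborel. g y * of_real (indicat_real K y)) / of_real (measure lborel K)"

text \<open>Off a null set every point of \<open>S\<close> lies in exactly one cell. The sums over
  cells therefore reduce to a single term pointwise, and the cellwise bounds add up to integrals
  over \<open>S\<close>.\<close>

lemma piecewise_average_error:
  fixes g :: "real \<times> real \<Rightarrow> complex" and w :: "real \<times> real \<Rightarrow> ennreal"
  assumes T: "finite \<T>" "\<Union>\<T> = S" "\<T> \<subseteq> fin_borel"
    and overlap: "AE y in lborel. \<forall>K\<in>\<T>. \<forall>L\<in>\<T>. y \<in> K \<longrightarrow> y \<in> L \<longrightarrow> K = L"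
    and g[measurable]: "g \<in> borel_measurable borel" and w[measurable]: "w \<in> borel_measurable borel"
    and int: "\<And>K. K \<in> \<T> \<Longrightarrow> integrable lborel (\<lambda>y. g y * of_real (indicat_real K y))"
    and ae: "AE y in lborel. y \<in> H"
    and bd: "\<And>K y z. \<lbrakk>K \<in> \<T>; y \<in> K; z \<in> K; y \<in> H; z \<in> H\<rbrakk> \<Longrightarrow> ennreal ((cmod (g y - g z))\<^sup>2) \<le> B * (1 + w y + w z)"
    and SD: "S \<subseteq> D"
  shows "(\<integral>\<^sup>+ y. ennreal ((cmod (indicat_real D y *\<^sub>R (g y * indicator S y) -
       (\<Sum>K\<in>\<T>. cell_mean g K * of_real (indicat_real K y))))\<^sup>2) \<partial>lborel)
    \<le> B * (emeasure lborel S + 2 * (\<integral>\<^sup>+ y. w y * indicator S y \<partial>lborel))"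
proof -
  have Kb[measurable]: "K \<in> sets borel" if "K \<in> \<T>" for K using T that fin_borelD by auto
  have sum_ind: "AE y in lborel. (\<Sum>K\<in>\<T>. indicator K y) = (indicator S y :: ennreal)"
    using overlap
  proof eventually_elim
    fix y assume y: "\<forall>K\<in>\<T>. \<forall>L\<in>\<T>. y \<in> K \<longrightarrow> y \<in> L \<longrightarrow> K = L"
    show "(\<Sum>K\<in>\<T>. indicator K y) = (indicator S y :: ennreal)"
    proof (cases "y \<in> S")
      case True
      then obtain K where K: "K \<in> \<T>" "y \<in> K" using T(2) by auto
      have "(\<Sum>L\<in>\<T>. indicator L y) = (\<Sum>L\<in>\<T>. if L = K then 1 else (0 :: ennreal))"
        using K y by (intro sum.cong) (auto simp: indicator_def)
      thus ?thesis using K T(1) True by simp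
    next
      case False
      hence "\<forall>K\<in>\<T>. y \<notin> K" using T(2) by auto
      thus ?thesis using False by simp
    qed
  qed
  have total: "(\<Sum>K\<in>\<T>. \<integral>\<^sup>+ y. v y * indicator K y \<partial>lborel) = (\<integral>\<^sup>+ y. v y * indicator S y \<partial>lborel)"
    if [measurable]: "v \<in> borel_measurable borel" for v :: "real \<times> real \<Rightarrow> ennreal"
  proof -
    have "(\<Sum>K\<in>\<T>. \<integral>\<^sup>+ y. v y * indicator K y \<partial>lborel) = (\<integral>\<^sup>+ y. (\<Sum>K\<in>\<T>. v y * indicator K y) \<partial>lborel)"
      by (rule nn_integral_sum[symmetric]) simp
    also have "\<dots> = (\<integral>\<^sup>+ y. v y * indicator S y \<partial>lborel)"
      using sum_ind by (intro nn_integral_cong_AE) (auto elim!: eventually_mono simp: sum_distrib_left[symmetric])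
    finally show ?thesis .
  qed
  have "(\<integral>\<^sup>+ y. ennreal ((cmod (indicat_real D y *\<^sub>R (g y * indicator S y) -
       (\<Sum>K\<in>\<T>. cell_mean g K * of_real (indicat_real K y))))\<^sup>2) \<partial>lborel)
    \<le> (\<integral>\<^sup>+ y. (\<Sum>K\<in>\<T>. ennreal ((cmod (g y - cell_mean g K))\<^sup>2) * indicator K y) \<partial>lborel)"
  proof (intro nn_integral_mono_AE, use overlap in eventually_elim)
    fix y assume y: "\<forall>K\<in>\<T>. \<forall>L\<in>\<T>. y \<in> K \<longrightarrow> y \<in> L \<longrightarrow> K = L"
    show "ennreal ((cmod (indicat_real D y *\<^sub>R (g y * indicator S y) -
       (\<Sum>K\<in>\<T>. cell_mean g K * of_real (indicat_real K y))))\<^sup>2)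
      \<le> (\<Sum>K\<in>\<T>. ennreal ((cmod (g y - cell_mean g K))\<^sup>2) * indicator K y)"
    proof (cases "y \<in> S")
      case True
      then obtain K where K: "K \<in> \<T>" "y \<in> K" using T(2) by auto
      have "(\<Sum>L\<in>\<T>. cell_mean g L * of_real (indicat_real L y)) = (\<Sum>L\<in>\<T>. if L = K then cell_mean g K else 0)"
        using K y by (intro sum.cong) (auto simp: indicator_def)
      hence 1: "(\<Sum>L\<in>\<T>. cell_mean g L * of_real (indicat_real L y)) = cell_mean g K" using K T(1) by simp
      have "(\<Sum>L\<in>\<T>. ennreal ((cmod (g y - cell_mean g L))\<^sup>2) * indicator L y)
         = (\<Sum>L\<in>\<T>. if L = K then ennreal ((cmod (g y - cell_mean g K))\<^sup>2) else 0)"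
        using K y by (intro sum.cong) (auto simp: indicator_def)
      hence 2: "(\<Sum>L\<in>\<T>. ennreal ((cmod (g y - cell_mean g L))\<^sup>2) * indicator L y) = ennreal ((cmod (g y - cell_mean g K))\<^sup>2)"
        using K T(1) by simp
      show ?thesis unfolding 1 2 using True SD by auto
    next
      case False
      hence "\<forall>K\<in>\<T>. y \<notin> K" using T(2) by auto
      thus ?thesis using False by simp
    qed
  qed
  also have "\<dots> = (\<Sum>K\<in>\<T>. \<integral>\<^sup>+ y. ennreal ((cmod (g y - cell_mean g K))\<^sup>2) * indicator K y \<partial>lborel)"
    by (rule nn_integral_sum) simp
  also have "\<dots> \<le> (\<Sum>K\<in>\<T>. B * (emeasure lborel K + 2 * (\<integral>\<^sup>+ y. w y * indicator K y \<partial>lborel)))"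
  proof (rule sum_mono)
    fix K assume K: "K \<in> \<T>"
    show "(\<integral>\<^sup>+ y. ennreal ((cmod (g y - cell_mean g K))\<^sup>2) * indicator K y \<partial>lborel)
       \<le> B * (emeasure lborel K + 2 * (\<integral>\<^sup>+ y. w y * indicator K y \<partial>lborel))"
      using K T(3) by (intro average_error[where H = H] g w int ae bd) (auto simp: cell_mean_def)
  qed
  also have "\<dots> = B * ((\<Sum>K\<in>\<T>. emeasure lborel K) + 2 * (\<Sum>K\<in>\<T>. \<integral>\<^sup>+ y. w y * indicator K y \<partial>lborel))"
    by (simp only: sum_distrib_left[symmetric] sum.distrib)
  also have "(\<Sum>K\<in>\<T>. emeasure lborel K) = (\<Sum>K\<in>\<T>. \<integral>\<^sup>+ y. 1 * indicator K y \<partial>lborel)"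
    by (intro sum.cong) auto
  also have "\<dots> = (\<integral>\<^sup>+ y. 1 * indicator S y \<partial>lborel)" by (rule total) simp
  also have "\<dots> = emeasure lborel S"
  proof -
    have "S \<in> sets borel" using T(1,2) Kb by (metis sets.finite_Union subsetI)
    thus ?thesis by simp
  qed
  also have "(\<Sum>K\<in>\<T>. \<integral>\<^sup>+ y. w y * indicator K y \<partial>lborel) = (\<integral>\<^sup>+ y. w y * indicator S y \<partial>lborel)"
    by (rule total) simp
  finally show ?thesis .
qed

text \<open>The integrand has finite square distance from a simple function with support of finite
  measure, which is itself square integrable. This provides the cell means of the Green function for
  every \<open>x\<close> in the duct, including the points that are not generic.\<close>

lemma has_noise_integral_square_integrable:
  assumes "has_noise_integral P W D \<phi> X"
  shows "(\<integral>\<^sup>+ y. ennreal ((cmod (indicat_real D y *\<^sub>R \<phi> y))\<^sup>2) \<partial>lborel) < \<infinity>"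
proof -
  obtain s where s: "\<And>n. Bochner_Integration.simple_bochner_integrable lborel (s n)"
    and lim: "(\<lambda>n. \<integral>\<^sup>+ y. ennreal ((cmod (s n y - indicat_real D y *\<^sub>R \<phi> y))\<^sup>2) \<partial>lborel) \<longlonglongrightarrow> 0"
    and phi: "(\<lambda>y. indicat_real D y *\<^sub>R \<phi> y) \<in> borel_measurable lborel"
    using assms unfolding has_noise_integral_def set_borel_measurable_def by auto
  note [measurable] = phi[unfolded measurable_lborel1]
  have "eventually (\<lambda>n. (\<integral>\<^sup>+ y. ennreal ((cmod (s n y - indicat_real D y *\<^sub>R \<phi> y))\<^sup>2) \<partial>lborel) < 1) sequentially"
    by (rule order_tendstoD(2)[OF lim]) simp
  then obtain n where n: "(\<integral>\<^sup>+ y. ennreal ((cmod (s n y - indicat_real D y *\<^sub>R \<phi> y))\<^sup>2) \<partial>lborel) < 1"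
    unfolding eventually_sequentially by blast
  have sf: "simple_function lborel (s n)" and fin: "emeasure lborel {y. s n y \<noteq> 0} \<noteq> \<infinity>"
    using s[of n] by (auto simp: simple_bochner_integrable.simps)
  have [measurable]: "s n \<in> borel_measurable borel" using borel_measurable_simple_function[OF sf] by simp
  define m where "m = Max ((\<lambda>y. (cmod (s n y))\<^sup>2) ` UNIV)"
  have "finite ((\<lambda>c. (cmod c)\<^sup>2) ` range (s n))" using simple_functionD(1)[OF sf] by simp
  hence m: "(cmod (s n y))\<^sup>2 \<le> m" for y unfolding m_def image_image by (intro Max_ge) auto
  have "(\<integral>\<^sup>+ y. ennreal ((cmod (s n y))\<^sup>2) \<partial>lborel) \<le> (\<integral>\<^sup>+ y. ennreal m * indicator {y. s n y \<noteq> 0} y \<partial>lborel)"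
    using m by (intro nn_integral_mono) (auto simp: indicator_def intro!: ennreal_leI)
  also have "\<dots> = ennreal m * emeasure lborel {y. s n y \<noteq> 0}"
    by (rule nn_integral_cmult_indicator) simp
  also have "\<dots> < \<infinity>" using fin by (simp add: ennreal_mult_less_top less_top)
  finally have fs: "(\<integral>\<^sup>+ y. ennreal ((cmod (s n y))\<^sup>2) \<partial>lborel) < \<infinity>" .
  have "(\<integral>\<^sup>+ y. ennreal ((cmod (indicat_real D y *\<^sub>R \<phi> y))\<^sup>2) \<partial>lborel)
    \<le> (\<integral>\<^sup>+ y. 2 * ennreal ((cmod (s n y - indicat_real D y *\<^sub>R \<phi> y))\<^sup>2) + 2 * ennreal ((cmod (s n y))\<^sup>2) \<partial>lborel)"
  proof (rule nn_integral_mono)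
    show "ennreal ((cmod (indicat_real D y *\<^sub>R \<phi> y))\<^sup>2)
      \<le> 2 * ennreal ((cmod (s n y - indicat_real D y *\<^sub>R \<phi> y))\<^sup>2) + 2 * ennreal ((cmod (s n y))\<^sup>2)" for y
      using ennreal_cmod_diff_square_le[of "indicat_real D y *\<^sub>R \<phi> y" 0 "s n y"] by (simp del: norm_scaleR)
  qed
  also have "\<dots> = 2 * (\<integral>\<^sup>+ y. ennreal ((cmod (s n y - indicat_real D y *\<^sub>R \<phi> y))\<^sup>2) \<partial>lborel)
      + 2 * (\<integral>\<^sup>+ y. ennreal ((cmod (s n y))\<^sup>2) \<partial>lborel)"
    by (subst nn_integral_add) (simp_all add: nn_integral_cmult)
  also have "\<dots> < \<infinity>" using n fs less_trans[OF n, of \<top>] by (simp add: ennreal_mult_less_top)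
  finally show ?thesis .
qed

lemma square_integrable_imp_integrable_on:
  fixes \<phi> :: "real \<times> real \<Rightarrow> complex"
  assumes [measurable]: "\<phi> \<in> borel_measurable borel"
    and fin: "(\<integral>\<^sup>+ y. ennreal ((cmod (\<phi> y))\<^sup>2) \<partial>lborel) < \<infinity>" and K: "K \<in> fin_borel"
  shows "integrable lborel (\<lambda>y. \<phi> y * of_real (indicat_real K y))"
proof -
  note [measurable] = fin_borelD(1)[OF K]
  have "integrable lborel (\<lambda>y. (cmod (\<phi> y))\<^sup>2)"
    using fin by (intro integrableI_bounded) auto
  moreover have "integrable lborel (\<lambda>y. (indicat_real K y)\<^sup>2)"
  proof -
    have "(\<lambda>y. (indicat_real K y)\<^sup>2) = indicat_real K" by (auto simp: indicator_def)
    thus ?thesis using fin_borelD[OF K] by simp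
  qed
  ultimately have "integrable lborel (\<lambda>y. cmod (\<phi> y) * indicat_real K y)"
    by (intro integrable_mult_of_squares) auto
  thus ?thesis
    by (rule Bochner_Integration.integrable_bound) (auto simp: norm_mult)
qed

text \<open>The factor \<open>|K|^(-1/2)\<close> occurs twice, in the coefficient of the noise and
  in its expansion. Together they divide the integral of the Green function over the cell by its
  area, so integrating against the discretized noise replaces the Green function by its cell
  means.\<close>

lemma discrete_solution_eq:
  assumes T: "finite \<T>" "\<T> \<subseteq> fin_borel" "\<Union>\<T> = ess_support D f" and D: "D \<in> sets borel"
    and int: "\<And>K. K \<in> \<T> \<Longrightarrow> integrable lborel (\<lambda>y. G x y * of_real (indicat_real K y))"
  shows "discrete_solution W D G f \<T> x \<omega> =
    deterministic_part D G f x + (\<Sum>K\<in>\<T>. cell_mean (G x) K * of_real (W K \<omega>))"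
proof -
  have sub: "K \<subseteq> ess_support D f" "K \<subseteq> D" if "K \<in> \<T>" for K
    using T(3) that by (auto simp: ess_support_def)
  define a where "a K = measure lborel K powr (- 1 / 2) * noise_coeff W K \<omega>" for K
  have a: "a K = W K \<omega> / measure lborel K" for K
  proof (cases "measure lborel K = 0")
    case False
    hence "measure lborel K powr (- 1 / 2) * measure lborel K powr (- 1 / 2) = 1 / measure lborel K"
      by (simp add: powr_add[symmetric] powr_minus_divide)
    thus ?thesis by (simp add: a_def noise_coeff_def mult.assoc[symmetric])
  qed (simp add: a_def)
  have eq: "indicat_real D y *\<^sub>R (G x y * indicator (ess_support D f) y * complex_of_real (discrete_noise W \<T> \<omega> y))
      = (\<Sum>K\<in>\<T>. of_real (a K) * (G x y * of_real (indicat_real K y)))" for y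
  proof -
    have "(\<Sum>K\<in>\<T>. of_real (a K) * (G x y * of_real (indicat_real K y)))
       = (\<Sum>K\<in>\<T>. indicat_real D y *\<^sub>R (G x y * indicator (ess_support D f) y * of_real (a K * indicat_real K y)))"
      using sub by (intro sum.cong refl) (auto simp: indicator_def)
    also have "\<dots> = indicat_real D y *\<^sub>R (G x y * indicator (ess_support D f) y * of_real (\<Sum>K\<in>\<T>. a K * indicat_real K y))"
      by (simp add: scaleR_sum_right sum_distrib_left)
    finally show ?thesis by (simp add: discrete_noise_def a_def)
  qed
  have "(LINT y|lebesgue_on D. G x y * indicator (ess_support D f) y * complex_of_real (discrete_noise W \<T> \<omega> y))
     = (LINT y|lebesgue. (\<Sum>K\<in>\<T>. of_real (a K) * (G x y * of_real (indicat_real K y))))"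
    using D by (subst integral_restrict_space) (auto simp: eq)
  also have "\<dots> = (LINT y|lborel. (\<Sum>K\<in>\<T>. of_real (a K) * (G x y * of_real (indicat_real K y))))"
    by (intro integral_completion borel_measurable_integrable Bochner_Integration.integrable_sum integrable_mult_right int)
  also have "\<dots> = (\<Sum>K\<in>\<T>. of_real (a K) * (LINT y|lborel. G x y * of_real (indicat_real K y)))"
    using int by (simp add: Bochner_Integration.integral_sum)
  also have "\<dots> = (\<Sum>K\<in>\<T>. cell_mean (G x) K * of_real (W K \<omega>))"
    by (intro sum.cong refl) (simp add: a cell_mean_def)
  finally show ?thesis by (simp add: discrete_solution_def)
qed

lemma measurable_cell_mean:
  assumes [measurable]: "(\<lambda>(x, y). G x y) \<in> borel_measurable (borel \<Otimes>\<^sub>M borel)" "K \<in> sets borel"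
  shows "(\<lambda>x. cell_mean (G x) K) \<in> borel_measurable (borel :: (real \<times> real) measure)"
proof -
  have "(\<lambda>x. LINT y|lborel. G x y * of_real (indicat_real K y)) \<in> borel_measurable (borel :: (real \<times> real) measure)"
    by (rule lborel.borel_measurable_lebesgue_integral) simp
  thus ?thesis unfolding cell_mean_def by measurable
qed

lemma measurable_deterministic_part:
  assumes G: "(\<lambda>(x, y). G x y) \<in> borel_measurable (borel \<Otimes>\<^sub>M borel)"
    and D: "D \<in> sets borel" and f: "f \<in> borel_measurable (lebesgue_on D)"
  shows "deterministic_part D G f \<in> borel_measurable (borel :: (real \<times> real) measure)"
proof -
  note [measurable] = G D
  obtain f' where f'[measurable]: "f' \<in> borel_measurable borel" and ff': "AE y in lborel. y \<in> D \<longrightarrow> f y = f' y"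
    using lebesgue_on_measurable_borel_version[OF D f] by blast
  have Gx[measurable]: "G x \<in> borel_measurable borel" for x
    using measurable_compose[OF measurable_Pair1' G, of x] by simp
  have gf: "(\<lambda>y. indicat_real D y *\<^sub>R f y) \<in> borel_measurable lebesgue"
    using f D by (subst (asm) borel_measurable_restrict_space_iff) auto
  have "deterministic_part D G f x = (LINT y|lborel. indicat_real D y *\<^sub>R (G x y * f' y))" for x
  proof -
    have "deterministic_part D G f x = (LINT y|lebesgue. indicat_real D y *\<^sub>R (G x y * f y))"
      unfolding deterministic_part_def using D by (intro integral_restrict_space) auto
    also have "\<dots> = (LINT y|lebesgue. indicat_real D y *\<^sub>R (G x y * f' y))"
    proof (rule integral_cong_AE)
      have "(\<lambda>y. G x y * (indicat_real D y *\<^sub>R f y)) \<in> borel_measurable lebesgue"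
        by (intro borel_measurable_times gf measurable_completion) simp
      thus "(\<lambda>y. indicat_real D y *\<^sub>R (G x y * f y)) \<in> borel_measurable lebesgue" by simp
      show "(\<lambda>y. indicat_real D y *\<^sub>R (G x y * f' y)) \<in> borel_measurable lebesgue"
        by (rule measurable_completion) simp
      show "AE y in lebesgue. indicat_real D y *\<^sub>R (G x y * f y) = indicat_real D y *\<^sub>R (G x y * f' y)"
        by (rule AE_completion) (use ff' in \<open>auto elim!: eventually_mono simp: indicator_def\<close>)
    qed
    also have "\<dots> = (LINT y|lborel. indicat_real D y *\<^sub>R (G x y * f' y))"
      by (rule integral_completion) simp
    finally show ?thesis .
  qed
  moreover have "(\<lambda>x. LINT y|lborel. indicat_real D y *\<^sub>R (G x y * f' y)) \<in> borel_measurable (borel :: (real \<times> real) measure)"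
    by (rule lborel.borel_measurable_lebesgue_integral) simp
  ultimately show ?thesis by presburger
qed

section \<open>Convergence rate\<close>

text \<open>The kernel enters only through measurability and a weighted bound on its increments,
  which separates wave propagation from noise. Tonelli exchanges expectation and spatial integral,
  after which the estimates act at one \<open>x\<close> at a time.\<close>

lemma expected_error_bound:
  fixes p :: "real \<times> real \<Rightarrow> 'w \<Rightarrow> complex" and w :: "real \<times> real \<Rightarrow> real \<times> real \<Rightarrow> ennreal"
  assumes G: "(\<lambda>(x, y). G x y) \<in> borel_measurable (borel \<Otimes>\<^sub>M borel)"
    and D: "D \<in> sets borel" and \<Omega>: "\<Omega> \<in> sets borel" "\<Omega> \<subseteq> D"
    and f: "f \<in> borel_measurable (lebesgue_on D)" and S: "compact (ess_support D f)"
    and wn: "white_noise P W" and p: "noise_solution P W D G f p"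
    and T: "triangulation (ess_support D f) \<T>"
    and ae: "AE y in lborel. y \<in> H"
    and w[measurable]: "\<And>x. w x \<in> borel_measurable borel"
    and bd: "\<And>x K y z. \<lbrakk>x \<in> \<Omega>; x \<in> H; K \<in> \<T>; y \<in> K; z \<in> K; y \<in> H; z \<in> H; y \<noteq> x; z \<noteq> x\<rbrakk> \<Longrightarrow>
        ennreal ((cmod (G x y - G x z))\<^sup>2) \<le> B * (1 + w x y + w x z)"
    and J: "\<And>x. x \<in> \<Omega> \<Longrightarrow> (\<integral>\<^sup>+ y. w x y * indicator (ess_support D f) y \<partial>lborel) \<le> J"
  shows "expected_sq_L2_norm P \<Omega> (\<lambda>x \<omega>. p x \<omega> - discrete_solution W D G f \<T> x \<omega>)
     \<le> 4 * (B * (emeasure lborel (ess_support D f) + 2 * J)) * emeasure lborel \<Omega>"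
proof -
  define E where "E = ess_support D f"
  interpret P: prob_space P by (rule white_noiseD(1)[OF wn])
  note Tf = triangulation_facts[OF T S]
  note [measurable] = G D \<Omega>(1)
  have ED: "E \<subseteq> D" by (auto simp: E_def ess_support_def)
  have E_meas[measurable]: "E \<in> sets borel" using S unfolding E_def by (rule borel_compact)
  have Gx[measurable]: "G x \<in> borel_measurable borel" for x
    using measurable_compose[OF measurable_Pair1' G, of x] by simp
  have Tfb: "\<T> \<subseteq> fin_borel" using Tf(3) by auto
  \<comment> \<open>The random field is jointly measurable only over \<open>D\<close>, so Tonelli is
    applied to the restricted measure and the integral over the smaller domain is recovered by an
    indicator.\<close>
  define MD where "MD = restrict_space (lborel :: (real \<times> real) measure) D"
  have spMD: "space MD = D" using D by (simp add: MD_def space_restrict_space)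
  interpret MD: sigma_finite_measure MD
    unfolding MD_def using D by (intro sigma_finite_measure_restrict_space lborel.sigma_finite_measure_axioms) simp
  interpret MP: pair_sigma_finite MD P by unfold_locales
  have ni: "has_noise_integral P W D (\<lambda>y. G x y * indicator E y) (\<lambda>\<omega>. p x \<omega> - deterministic_part D G f x)"
    if "x \<in> D" for x
    using p that unfolding noise_solution_def E_def by blast
  have int: "integrable lborel (\<lambda>y. G x y * of_real (indicat_real K y))" if x: "x \<in> D" and K: "K \<in> \<T>" for x K
  proof -
    have KE: "K \<subseteq> E" using Tf(2) K by (auto simp: E_def)
    have "(\<integral>\<^sup>+ y. ennreal ((cmod (indicat_real D y *\<^sub>R (G x y * indicator E y)))\<^sup>2) \<partial>lborel) < \<infinity>"
      by (rule has_noise_integral_square_integrable[OF ni[OF x]])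
    also have "(\<lambda>y. indicat_real D y *\<^sub>R (G x y * indicator E y)) = (\<lambda>y. G x y * indicator E y)"
      using ED by (intro ext) (auto simp: indicator_def)
    finally have "integrable lborel (\<lambda>y. (G x y * indicator E y) * of_real (indicat_real K y))"
      by (intro square_integrable_imp_integrable_on Tf(3) K) simp_all
    also have "(\<lambda>y. (G x y * indicator E y) * of_real (indicat_real K y)) = (\<lambda>y. G x y * of_real (indicat_real K y))"
      using KE by (intro ext) (auto simp: indicator_def)
    finally show ?thesis .
  qed
  define Y where "Y x \<omega> = p x \<omega> - deterministic_part D G f x - (\<Sum>K\<in>\<T>. cell_mean (G x) K * of_real (W K \<omega>))" for x \<omega>
  have diff: "p x \<omega> - discrete_solution W D G f \<T> x \<omega> = Y x \<omega>" if "x \<in> D" for x \<omega>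
    using discrete_solution_eq[where G = G and x = x, OF Tf(1) Tfb Tf(2) D int[OF that], of W \<omega>] by (simp add: Y_def)
  have Y_meas: "(\<lambda>(x, \<omega>). Y x \<omega>) \<in> borel_measurable (MD \<Otimes>\<^sub>M P)"
  proof -
    have [measurable]: "(\<lambda>(x, \<omega>). p x \<omega>) \<in> borel_measurable (MD \<Otimes>\<^sub>M P)"
      using p unfolding noise_solution_def MD_def by blast
    have [measurable]: "deterministic_part D G f \<in> borel_measurable MD"
      unfolding MD_def by (rule measurable_restrict_space1) (use measurable_deterministic_part[OF G D f] in simp)
    have [measurable]: "(\<lambda>x. cell_mean (G x) K) \<in> borel_measurable MD" if "K \<in> \<T>" for K
      unfolding MD_def using measurable_cell_mean[OF G fin_borelD(1)[OF Tf(3)[OF that]]]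
      by (intro measurable_restrict_space1) simp
    have [measurable]: "W K \<in> borel_measurable P" if "K \<in> \<T>" for K
      by (rule white_noiseD(2)[OF wn Tf(3)[OF that]])
    show ?thesis unfolding Y_def by measurable
  qed
  have pt: "(\<integral>\<^sup>+ \<omega>. ennreal ((cmod (Y x \<omega>))\<^sup>2) \<partial>P) \<le> 4 * (B * (emeasure lborel E + 2 * J))"
    if x: "x \<in> \<Omega>" "x \<in> H" for x
  proof -
    have xD: "x \<in> D" using x \<Omega> by auto
    \<comment> \<open>The increment bound excludes the singularity itself, so the single point
      \<open>x\<close> is removed from the good set as well.\<close>
    have ae': "AE y in lborel. y \<in> H - {x}"
      using ae AE_lborel_singleton[of x] by eventually_elim auto
    have "(\<integral>\<^sup>+ \<omega>. ennreal ((cmod (Y x \<omega>))\<^sup>2) \<partial>P)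
      \<le> 4 * (\<integral>\<^sup>+ y. ennreal ((cmod (indicat_real D y *\<^sub>R (G x y * indicator E y) -
          (\<Sum>K\<in>\<T>. cell_mean (G x) K * of_real (indicat_real K y))))\<^sup>2) \<partial>lborel)"
      unfolding Y_def by (rule noise_integral_error[OF wn ni[OF xD] Tf(1) Tfb])
    also have "\<dots> \<le> 4 * (B * (emeasure lborel E + 2 * (\<integral>\<^sup>+ y. w x y * indicator E y \<partial>lborel)))"
      using Tf Tfb x ED
      by (intro mult_left_mono piecewise_average_error[where H = "H - {x}"] ae' int xD bd) (auto simp: E_def)
    also have "\<dots> \<le> 4 * (B * (emeasure lborel E + 2 * J))"
      using J[OF x(1)] unfolding E_def by (intro mult_left_mono add_left_mono) auto
    finally show ?thesis .
  qed
  have "expected_sq_L2_norm P \<Omega> (\<lambda>x \<omega>. p x \<omega> - discrete_solution W D G f \<T> x \<omega>)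
    = (\<integral>\<^sup>+ \<omega>. (\<integral>\<^sup>+ x. ennreal ((cmod (Y x \<omega>))\<^sup>2) * indicator \<Omega> x \<partial>MD) \<partial>P)"
    unfolding expected_sq_L2_norm_def
  proof (rule nn_integral_cong)
    fix \<omega>
    have "(\<integral>\<^sup>+ x. ennreal ((cmod (Y x \<omega>))\<^sup>2) * indicator \<Omega> x \<partial>MD)
      = (\<integral>\<^sup>+ x. ennreal ((cmod (Y x \<omega>))\<^sup>2) * indicator \<Omega> x * indicator D x \<partial>lborel)"
      unfolding MD_def using D by (intro nn_integral_restrict_space) simp
    also have "\<dots> = (\<integral>\<^sup>+ x\<in>\<Omega>. ennreal ((cmod (p x \<omega> - discrete_solution W D G f \<T> x \<omega>))\<^sup>2) \<partial>lborel)"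
      using \<Omega> diff by (intro nn_integral_cong) (auto simp: indicator_def)
    finally show "(\<integral>\<^sup>+ x\<in>\<Omega>. ennreal ((cmod (p x \<omega> - discrete_solution W D G f \<T> x \<omega>))\<^sup>2) \<partial>lborel)
       = (\<integral>\<^sup>+ x. ennreal ((cmod (Y x \<omega>))\<^sup>2) * indicator \<Omega> x \<partial>MD)" ..
  qed
  also have "\<dots> = (\<integral>\<^sup>+ x. (\<integral>\<^sup>+ \<omega>. ennreal ((cmod (Y x \<omega>))\<^sup>2) * indicator \<Omega> x \<partial>P) \<partial>MD)"
  proof -
    have [measurable]: "\<Omega> \<in> sets MD"
      using \<Omega> D unfolding MD_def by (subst sets_restrict_space_iff) auto
    note [measurable] = Y_meas
    have "(\<lambda>(x, \<omega>). ennreal ((cmod (Y x \<omega>))\<^sup>2) * indicator \<Omega> x) \<in> borel_measurable (MD \<Otimes>\<^sub>M P)"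
      by measurable
    from MP.Fubini[OF this] show ?thesis by simp
  qed
  also have "\<dots> = (\<integral>\<^sup>+ x. (\<integral>\<^sup>+ \<omega>. ennreal ((cmod (Y x \<omega>))\<^sup>2) * indicator \<Omega> x \<partial>P) * indicator D x \<partial>lborel)"
    unfolding MD_def using D by (intro nn_integral_restrict_space) simp
  also have "\<dots> \<le> (\<integral>\<^sup>+ x. 4 * (B * (emeasure lborel E + 2 * J)) * indicator \<Omega> x \<partial>lborel)"
  proof (intro nn_integral_mono_AE, use ae in eventually_elim)
    fix x assume "x \<in> H"
    thus "(\<integral>\<^sup>+ \<omega>. ennreal ((cmod (Y x \<omega>))\<^sup>2) * indicator \<Omega> x \<partial>P) * indicator D x
       \<le> 4 * (B * (emeasure lborel E + 2 * J)) * indicator \<Omega> x"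
      using pt[of x] \<Omega>(2) by (cases "x \<in> \<Omega>") auto
  qed
  also have "\<dots> = 4 * (B * (emeasure lborel E + 2 * J)) * emeasure lborel \<Omega>"
    using \<Omega> by (intro nn_integral_cmult_indicator) simp
  finally show ?thesis unfolding E_def .
qed

section \<open>Application to the duct\<close>

lemma compact_subset_duct_margin:
  assumes S: "compact S" "S \<subseteq> duct d"
  obtains \<delta> where "\<delta> > 0" "\<And>y. y \<in> S \<Longrightarrow> \<delta> \<le> snd y \<and> snd y \<le> d - \<delta>"
proof (cases "S = {}")
  case False
  have c: "continuous_on S snd" by (intro continuous_intros)
  obtain u where u: "u \<in> S" "\<And>y. y \<in> S \<Longrightarrow> snd u \<le> snd y"
    using continuous_attains_inf[OF S(1) False c] by blast
  obtain v where v: "v \<in> S" "\<And>y. y \<in> S \<Longrightarrow> snd y \<le> snd v"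
    using continuous_attains_sup[OF S(1) False c] by blast
  show ?thesis
  proof (rule that[of "min (snd u) (d - snd v)"])
    show "0 < min (snd u) (d - snd v)" using u(1) v(1) S(2) by (auto simp: duct_def)
    fix y assume "y \<in> S"
    thus "min (snd u) (d - snd v) \<le> snd y \<and> snd y \<le> d - min (snd u) (d - snd v)"
      using u(2)[of y] v(2)[of y] by auto
  qed
qed (use that[of 1] in auto)

lemma open_duct: "open (duct d)"
  unfolding duct_def by (intro open_Collect_conj open_Collect_less continuous_intros)

lemma square_three_le: "(1 + a + b)\<^sup>2 \<le> 3 * (1 + a\<^sup>2 + b\<^sup>2)" for a b :: real
proof -
  have "0 \<le> (1 - a)\<^sup>2 + (1 - b)\<^sup>2 + (a - b)\<^sup>2" by simp
  thus ?thesis by (simp add: power2_eq_square algebra_simps)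
qed

text \<open>The case distinction is needed because \<open>mesh_size\<close> of an empty
  triangulation is the \<open>Max\<close> of an empty set, about which nothing is known. The support
  is then empty and the bound is zero.\<close>

lemma (in convected_duct) convergence_rate:
  assumes f: "f \<in> borel_measurable (lebesgue_on (duct d))"
    and S: "compact (ess_support (duct d) f)"
    and \<Omega>: "open \<Omega>" "bounded \<Omega>" "\<Omega> \<subseteq> duct d" "ess_support (duct d) f \<subseteq> \<Omega>"
    and \<sigma>: "\<sigma> = mirror \<or> \<sigma> = uminus"
    and wn: "white_noise P W"
    and p: "noise_solution P W (duct d) (duct_green \<sigma> d M k) f p"
    and q: "0 < q" "q < 1"
  obtains C where "C \<ge> 0" "\<And>\<T>. triangulation (ess_support (duct d) f) \<T> \<Longrightarrow>
      expected_sq_L2_norm P \<Omega> (\<lambda>x \<omega>. p x \<omega> - discrete_solution W (duct d) (duct_green \<sigma> d M k) f \<T> x \<omega>)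
      \<le> ennreal (if \<T> = {} then 0 else C * mesh_size \<T> powr (2 * q))"
proof -
  define E where "E = ess_support (duct d) f"
  define G where "G = duct_green \<sigma> d M k"
  obtain \<delta> where \<delta>: "\<delta> > 0" "\<And>y. y \<in> E \<Longrightarrow> \<delta> \<le> snd y \<and> snd y \<le> d - \<delta>"
    using compact_subset_duct_margin[OF S order.trans[OF \<Omega>(4,3)]] unfolding E_def by blast
  obtain R where R: "R > 0" "\<And>x. x \<in> \<Omega> \<Longrightarrow> norm x \<le> R"
    using \<Omega>(2) unfolding bounded_pos by blast
  have box: "in_box R x" "0 \<le> snd x" if "x \<in> \<Omega>" for x
  proof -
    have "\<bar>fst x\<bar> \<le> R" using abs_fst_le_norm[of x] R(2)[OF that] by linarith
    moreover have "0 < snd x" "snd x < d" using \<Omega>(3) that by (auto simp: duct_def)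
    ultimately show "in_box R x" "0 \<le> snd x" by (auto simp: in_box_def)
  qed
  have E\<Omega>: "E \<subseteq> \<Omega>" using \<Omega>(4) by (simp add: E_def)
  obtain C where C: "C \<ge> 0"
    "\<And>x y z. \<lbrakk>in_box R x; 0 \<le> snd x; in_box R y; in_box R z; \<delta> \<le> snd y; snd y \<le> d - \<delta>; \<delta> \<le> snd z; snd z \<le> d - \<delta>;
        generic x; generic y; generic z; y \<noteq> x; z \<noteq> x\<rbrakk> \<Longrightarrow>
      cmod (G x y - G x z) \<le> C * norm (y - z) powr q * (1 + norm (x - y) powr (- q) + norm (x - z) powr (- q))"
    using duct_green_hoelder[OF \<sigma> \<delta>(1) R(1) q] unfolding G_def by blast
  define R' where "R' = max R d"
  have R': "R' \<ge> 0" using R(1) by (simp add: R'_def)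
  obtain Cw where Cw: "Cw \<ge> 0"
    "\<And>x :: real \<times> real. \<lbrakk>\<bar>fst x\<bar> \<le> R'; \<bar>snd x\<bar> \<le> R'\<rbrakk> \<Longrightarrow>
       (\<integral>\<^sup>+ y. ennreal (norm (x - y) powr (- (2 * q))) * indicator ({-R'..R'} \<times> {-R'..R'}) y \<partial>lborel) \<le> ennreal Cw"
    using singular_weight_integrable[OF q R'] by blast
  have E_fin: "emeasure lborel E = ennreal (measure lborel E)"
    using emeasure_compact_finite[OF S] unfolding E_def by (intro emeasure_eq_ennreal_measure) auto
  have \<Omega>_fin: "emeasure lborel \<Omega> = ennreal (measure lborel \<Omega>)"
    using emeasure_bounded_finite[OF \<Omega>(2)] by (intro emeasure_eq_ennreal_measure) auto
  \<comment> \<open>The 4 comes from \<open>noise_integral_error\<close>, the 3 from squaring the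
    three-term weight, and \<open>2 * Cw\<close> from the singular weight at the two points of an
    increment.\<close>
  define C' where "C' = 4 * (3 * C\<^sup>2 * (measure lborel E + 2 * Cw)) * measure lborel \<Omega>"
  define w where "w x y = ennreal (norm (x - y) powr (- (2 * q)))" for x y :: "real \<times> real"
  have J: "(\<integral>\<^sup>+ y. w x y * indicator E y \<partial>lborel) \<le> ennreal Cw" if x: "x \<in> \<Omega>" for x
  proof -
    have "(\<integral>\<^sup>+ y. w x y * indicator E y \<partial>lborel)
       \<le> (\<integral>\<^sup>+ y. w x y * indicator ({-R'..R'} \<times> {-R'..R'}) y \<partial>lborel)"
    proof (rule nn_integral_mono)
      fix y
      have "y \<in> {-R'..R'} \<times> {-R'..R'}" if "y \<in> E"
      proof -
        have "\<bar>fst y\<bar> \<le> R'" "\<bar>snd y\<bar> \<le> R'"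
          using box(1)[OF subsetD[OF E\<Omega> that]] by (auto simp: in_box_def R'_def)
        thus ?thesis by (cases y) (simp add: abs_le_iff)
      qed
      thus "w x y * indicator E y \<le> w x y * indicator ({-R'..R'} \<times> {-R'..R'}) y"
        by (auto simp: indicator_def)
    qed
    also have "\<dots> \<le> ennreal Cw"
      unfolding w_def using box(1)[OF x] by (intro Cw) (auto simp: in_box_def R'_def)
    finally show ?thesis .
  qed
  have w_meas: "w x \<in> borel_measurable borel" for x unfolding w_def by measurable
  show ?thesis
  proof (rule that[of C'])
    show "C' \<ge> 0" unfolding C'_def using Cw(1) by simp
    fix \<T> assume T: "triangulation (ess_support (duct d) f) \<T>"
    note Tf = triangulation_facts[OF T S]
    define h where "h = mesh_size \<T>"
    define b where "b = (if \<T> = {} then 0 else 3 * C\<^sup>2 * h powr (2 * q))"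
    have b0: "b \<ge> 0" by (simp add: b_def)
    have bd: "ennreal ((cmod (G x y - G x z))\<^sup>2) \<le> ennreal b * (1 + w x y + w x z)"
      if h: "x \<in> \<Omega>" "x \<in> {x. generic x}" "K \<in> \<T>" "y \<in> K" "z \<in> K" "y \<in> {x. generic x}" "z \<in> {x. generic x}" "y \<noteq> x" "z \<noteq> x"
      for x K y z
    proof -
      have yz: "y \<in> E" "z \<in> E" using Tf(2) h by (auto simp: E_def)
      define t where "t = norm (y - z)"
      define u where "u = norm (x - y)"
      define v where "v = norm (x - z)"
      have uv: "u > 0" "v > 0" using h by (auto simp: u_def v_def)
      have "cmod (G x y - G x z) \<le> C * t powr q * (1 + u powr (- q) + v powr (- q))"
        unfolding t_def u_def v_def
        using h box[OF h(1)] box(1)[OF subsetD[OF E\<Omega> yz(1)]] box(1)[OF subsetD[OF E\<Omega> yz(2)]]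
          \<delta>(2)[OF yz(1)] \<delta>(2)[OF yz(2)]
        by (intro C(2)) auto
      hence "(cmod (G x y - G x z))\<^sup>2 \<le> (C * t powr q * (1 + u powr (- q) + v powr (- q)))\<^sup>2"
        by (intro power_mono) auto
      also have "\<dots> = C\<^sup>2 * (t powr q)\<^sup>2 * (1 + u powr (- q) + v powr (- q))\<^sup>2" by (simp only: power_mult_distrib)
      also have "\<dots> \<le> C\<^sup>2 * h powr (2 * q) * (3 * (1 + (u powr (- q))\<^sup>2 + (v powr (- q))\<^sup>2))"
      proof (intro mult_mono square_three_le)
        have "(t powr q)\<^sup>2 = t powr (2 * q)" by (simp add: power2_eq_square powr_add[symmetric])
        also have "\<dots> \<le> h powr (2 * q)"
          using Tf(4)[OF h(3,4,5)] q unfolding t_def h_def by (intro powr_mono2) auto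
        finally show "(t powr q)\<^sup>2 \<le> h powr (2 * q)" .
      qed auto
      also have "\<dots> = b * (1 + u powr (- (2 * q)) + v powr (- (2 * q)))"
        using h(3) by (auto simp: b_def power2_eq_square powr_add[symmetric])
      finally have "ennreal ((cmod (G x y - G x z))\<^sup>2) \<le> ennreal (b * (1 + u powr (- (2 * q)) + v powr (- (2 * q))))"
        by (rule ennreal_leI)
      thus ?thesis using b0 by (simp add: w_def u_def v_def ennreal_mult)
    qed
    have "expected_sq_L2_norm P \<Omega> (\<lambda>x \<omega>. p x \<omega> - discrete_solution W (duct d) G f \<T> x \<omega>)
      \<le> 4 * (ennreal b * (emeasure lborel (ess_support (duct d) f) + 2 * ennreal Cw)) * emeasure lborel \<Omega>"
      by (rule expected_error_bound[where H = "{x. generic x}" and w = w, OF _ _ _ \<Omega>(3) f S wn _ T _ w_meas bd])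
        (use J measurable_duct_green[OF \<sigma>] open_duct \<Omega>(1) p AE_generic in \<open>auto simp: G_def E_def borel_open\<close>)
    also have "\<dots> = ennreal (4 * (b * (measure lborel E + 2 * Cw)) * measure lborel \<Omega>)"
      unfolding E_def[symmetric] E_fin \<Omega>_fin using b0 Cw(1) by (simp add: ennreal_mult ennreal_plus)
    also have "4 * (b * (measure lborel E + 2 * Cw)) * measure lborel \<Omega> = (if \<T> = {} then 0 else C' * mesh_size \<T> powr (2 * q))"
      by (simp add: b_def C'_def h_def)
    finally show "expected_sq_L2_norm P \<Omega> (\<lambda>x \<omega>. p x \<omega> - discrete_solution W (duct d) (duct_green \<sigma> d M k) f \<T> x \<omega>)
      \<le> ennreal (if \<T> = {} then 0 else C' * mesh_size \<T> powr (2 * q))"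
      unfolding G_def .
  qed
qed

lemma mesh_size_nonneg:
  assumes "triangulation S \<T>" "compact S" "\<T> \<noteq> {}" "\<And>K. K \<in> \<T> \<Longrightarrow> K \<noteq> {}"
  shows "mesh_size \<T> \<ge> 0"
proof -
  note Tf = triangulation_facts[OF assms(1,2)]
  obtain K y where "K \<in> \<T>" "y \<in> K" using assms(3,4) by blast
  from Tf(4)[OF this this(2)] show ?thesis by simp
qed

theorem theorem2p3:
  fixes d M k \<gamma> :: real
    and f :: "real \<times> real \<Rightarrow> complex"
    and \<Omega>b :: "(real \<times> real) set"
    and \<sigma> :: "real \<times> real \<Rightarrow> real \<times> real"
    and P :: "'w measure"
    and W :: "(real \<times> real) set \<Rightarrow> 'w \<Rightarrow> real"
    and p :: "real \<times> real \<Rightarrow> 'w \<Rightarrow> complex"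
  assumes "d > 0" and "0 \<le> M" and "M < 1" and "k > 0"
    and "f \<in> borel_measurable (lebesgue_on (duct d))"
    and "integrable (lebesgue_on (duct d)) (\<lambda>x. (cmod (f x))\<^sup>2)"
    and "compact (ess_support (duct d) f)"
    and "open \<Omega>b" and "connected \<Omega>b" and "bounded \<Omega>b"
    and "ess_support (duct d) f \<subseteq> \<Omega>b" and "\<Omega>b \<subseteq> duct d"
    and "\<sigma> = mirror \<or> \<sigma> = uminus"
    and "white_noise P W"
    and "noise_solution P W (duct d) (duct_green \<sigma> d M k) f p"
    and "\<gamma> > 0"
  shows "\<exists>C>0. \<forall>\<epsilon>. 0 < \<epsilon> \<and> \<epsilon> < 1 \<longrightarrow>
    (\<exists>h0>0. \<forall>\<T>. triangulation (ess_support (duct d) f) \<T> \<and> quasi_uniform \<gamma> \<T> \<and> mesh_size \<T> < h0 \<longrightarrow>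
      expected_sq_L2_norm P \<Omega>b
        (\<lambda>x \<omega>. p x \<omega> - discrete_solution W (duct d) (duct_green \<sigma> d M k) f \<T> x \<omega>)
      \<le> ennreal (C * mesh_size \<T> powr (2 - \<epsilon>)))"
proof (rule exI[of _ 1], intro conjI allI impI)
  interpret convected_duct d M k by unfold_locales (use assms in auto)
  fix \<epsilon> :: real assume \<epsilon>: "0 < \<epsilon> \<and> \<epsilon> < 1"
  define q where "q = 1 - \<epsilon> / 4"
  have q: "0 < q" "q < 1" using \<epsilon> by (auto simp: q_def)
  obtain C where C: "C \<ge> 0" "\<And>\<T>. triangulation (ess_support (duct d) f) \<T> \<Longrightarrow>
      expected_sq_L2_norm P \<Omega>b (\<lambda>x \<omega>. p x \<omega> - discrete_solution W (duct d) (duct_green \<sigma> d M k) f \<T> x \<omega>)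
      \<le> ennreal (if \<T> = {} then 0 else C * mesh_size \<T> powr (2 * q))"
    using convergence_rate[OF assms(5,7,8,10,12,11,13,14,15) q] by blast
  \<comment> \<open>The constant of the theorem is fixed before \<epsilon>, whereas this
    \<open>C\<close> depends on \<epsilon>. Below the threshold
    \<open>C * h powr (\<epsilon> / 2)\<close> is at most \<open>C / (C + 1)\<close>, hence at most
    1; taking \<open>C + 1\<close> also covers \<open>C = 0\<close>.\<close>
  define h0 where "h0 = (1 / (C + 1)) powr (2 / \<epsilon>)"
  have h0: "h0 > 0" using C(1) by (simp add: h0_def)
  show "\<exists>h0>0. \<forall>\<T>. triangulation (ess_support (duct d) f) \<T> \<and> quasi_uniform \<gamma> \<T> \<and> mesh_size \<T> < h0 \<longrightarrow>
      expected_sq_L2_norm P \<Omega>b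
        (\<lambda>x \<omega>. p x \<omega> - discrete_solution W (duct d) (duct_green \<sigma> d M k) f \<T> x \<omega>)
      \<le> ennreal (1 * mesh_size \<T> powr (2 - \<epsilon>))"
  proof (intro exI[of _ h0] conjI allI impI h0)
    fix \<T> assume T: "triangulation (ess_support (duct d) f) \<T> \<and> quasi_uniform \<gamma> \<T> \<and> mesh_size \<T> < h0"
    have "(if \<T> = {} then 0 else C * mesh_size \<T> powr (2 * q)) \<le> 1 * mesh_size \<T> powr (2 - \<epsilon>)"
    proof (cases "\<T> = {}")
      case False
      define h where "h = mesh_size \<T>"
      have "h \<ge> 0"
      proof -
        have "K \<noteq> {}" if "K \<in> \<T>" for K
          using T that unfolding triangulation_def curved_triangle_def Let_def by fastforce
        thus ?thesis unfolding h_def using T assms(7) False by (intro mesh_size_nonneg) auto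
      qed
      have "C * h powr (2 * q) = C * h powr (\<epsilon> / 2) * h powr (2 - \<epsilon>)"
        by (simp add: powr_add[symmetric] q_def)
      also have "\<dots> \<le> 1 * h powr (2 - \<epsilon>)"
      proof (intro mult_right_mono)
        have "h powr (\<epsilon> / 2) \<le> h0 powr (\<epsilon> / 2)"
          using \<open>h \<ge> 0\<close> T \<epsilon> by (intro powr_mono2) (auto simp: h_def)
        also have "\<dots> = 1 / (C + 1)" using \<epsilon> C(1) by (simp add: h0_def powr_powr)
        finally have "C * h powr (\<epsilon> / 2) \<le> C * (1 / (C + 1))" using C(1) by (intro mult_left_mono)
        also have "\<dots> \<le> 1" using C(1) by simp
        finally show "C * h powr (\<epsilon> / 2) \<le> 1" .
      qed simp
      finally show ?thesis using False by (simp add: h_def)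
    qed simp
    hence "ennreal (if \<T> = {} then 0 else C * mesh_size \<T> powr (2 * q)) \<le> ennreal (1 * mesh_size \<T> powr (2 - \<epsilon>))"
      by (rule ennreal_leI)
    with C(2)[of \<T>] T show "expected_sq_L2_norm P \<Omega>b
        (\<lambda>x \<omega>. p x \<omega> - discrete_solution W (duct d) (duct_green \<sigma> d M k) f \<T> x \<omega>)
      \<le> ennreal (1 * mesh_size \<T> powr (2 - \<epsilon>))"
      using order.trans by blast
  qed
qed simp

end
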